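(* Let $(X,T,\mu)$ be a classical dynamical system, i.e. a probability space $(X,\mu)$ with a measure preserving invertible transformation $T:X\to X$, such that $L^2(X,\mu)$ is infinite dimensional, and let $G$ be a countable multiplicative subgroup of $\mathbb R_+$. Let $\mathfrak G$ be the associated unital $C^*$-algebra on the full Fock space, generated by $s(f)=a(f)+a^+(f)$, $f\in\mathcal K_{\mathbb R}$, let $\alpha$ be the automorphism of $\mathfrak G$ induced by $\alpha(s(f))=s(Uf)$ (construction in the context), and let $\omega=\langle\,\cdot\,\Omega,\Omega\rangle$ be the Fock vacuum state. Then: (i) If $(X,T,\mu)$ is ergodic but not weakly mixing, then $(\mathfrak G,\alpha)$ is uniquely ergodic with respect to the fixed point algebra $\mathfrak G^\alpha$, which is always nontrivial. (ii) If $(X,T,\mu)$ is weakly mixing but not mixing, then $(\mathfrak G,\alpha)$ is uniquely weak mixing but not uniquely mixing, with $\omega$ as the unique invariant state. (iii) If $(X,T,\mu)$ is mixing, then $(\mathfrak G,\alpha)$ is uniquely mixing, with $\omega$ the unique invariant state.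
   Context: All Hilbert spaces are separable; inner products are linear in the first variable. Classical system: let $u_0F=F\circ T^{-1}$ on $L^2(X,\mu)\ominus\mathbb C1$. $(X,T,\mu)$ is ergodic, weakly mixing, mixing if for all $\xi,\eta\in L^2(X,\mu)\ominus\mathbb C1$ one has, respectively, $\lim_n\frac1n\sum_{k=1}^n\langle u_0^k\xi,\eta\rangle=0$; $\lim_n\frac1n\sum_{k=1}^n|\langle u_0^k\xi,\eta\rangle|=0$; $\lim_n\langle u_0^n\xi,\eta\rangle=0$. Construction of $(\mathfrak G,\alpha)$: let $\mathcal K_{\mathbb R}=(L^2_{\mathbb R}(X,\mu)\ominus\mathbb R1)\otimes\big(\bigoplus_{\lambda\in G}\mathbb R^2\big)$ (real Hilbert space). Let $uf=f\circ T^{-1}$ on $L^2_{\mathbb R}(X,\mu)\ominus\mathbb R1$ and $v(t)=\bigoplus_{\lambda\in G}\begin{pmatrix}\cos(t\ln\lambda)&-\sin(t\ln\lambda)\\ \sin(t\ln\lambda)&\cos(t\ln\lambda)\end{pmatrix}$, $t\in\mathbb R$. Then $u\otimes I$ and $I\otimes v(t)$ are commuting orthogonal transformations of $\mathcal K_{\mathbb R}$. Let $\mathcal K_{\mathbb C}$ be the complexification of $\mathcal K_{\mathbb R}$, with inner product $(\cdot,\cdot)$, and let $A$ be the positive nonsingular operator on $\mathcal K_{\mathbb C}$ such that $A^{it}$ is the complexification of $I\otimes v(t)$ for all $t$. Let $\mathcal H$ be the completion of $\mathcal K_{\mathbb C}$ with respect to the inner product $\langle x,y\rangle=(2A(I+A)^{-1}x,y)$,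 and let $U$ be the unitary on $\mathcal H$ extending (the complexification of) $u\otimes I$. On the full Fock space $\mathcal F(\mathcal H)=\mathbb C\Omega\oplus\bigoplus_{n\ge1}\mathcal H^{\otimes n}$ ($\Omega$ the unit vacuum vector), the creator is $a^+(f)\Omega=f$, $a^+(f)f_1\otimes\cdots\otimes f_n=f\otimes f_1\otimes\cdots\otimes f_n$, and the annihilator $a(f)$ is its adjoint. $\mathfrak G$ is the unital $C^*$-algebra on $\mathcal F(\mathcal H)$ generated by $\{s(f)=a(f)+a^+(f): f\in\mathcal K_{\mathbb R}\}$, and $\alpha$ is the automorphism of $\mathfrak G$ determined by $\alpha(s(f))=s(Uf)$, $f\in\mathcal K_{\mathbb R}$. Quantum ergodic properties: for a unital $C^*$-algebra $\mathfrak A$ with state space $\mathcal S(\mathfrak A)$ and an automorphism $\alpha$, let $\mathfrak A^\alpha=\{x:\alpha(x)=x\}$; it is nontrivial if it is not $\mathbb C\mathbf 1$. The system $(\mathfrak A,\alpha)$ is uniquely ergodic with respect to the fixed point algebra if there is a linear map $E:\mathfrak A\to\mathfrak A$ (automatically an $\alpha$-invariant conditional expectation onto $\mathfrak A^\alpha$) with $\lim_n\frac1n\sum_{k=0}^{n-1}\varphi(\alpha^k(x))=\varphi(E(x))$ for all $x\in\mathfrak A$, $\varphi\in\mathcal S(\mathfrak A)$. It is uniquely weak mixing if $\lim_n\frac1n\sum_{k=0}^{n-1}|\varphi(\alpha^k(x))-\varphi(E(x))|=0$ for all $x,\varphi$, with $E=\omega(\cdot)\mathbf 1$ for a state $\omega$;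 and uniquely mixing if $\lim_n\varphi(\alpha^n(x))=\varphi(E(x))$ for all $x,\varphi$, with $E=\omega(\cdot)\mathbf 1$ for a state $\omega$. In the last two cases $\omega$ is the unique $\alpha$-invariant state. *)

theory Defs
  imports "HOL-Probability.Probability"
begin

section \<open>Complex Hilbert spaces\<close>

text \<open>
  The inner product is linear in the first variable.  The real inner product inherited from
  \<^class>\<open>real_inner\<close> is the real part of the complex one, so the norm and topology are the
  library ones.
\<close>

class complex_inner = real_inner +
  fixes scaleC :: "complex \<Rightarrow> 'a \<Rightarrow> 'a" (infixr "*\<^sub>C" 75)
    and cinner :: "'a \<Rightarrow> 'a \<Rightarrow> complex"
  assumes scaleC_add_right: "c *\<^sub>C (x + y) = c *\<^sub>C x + c *\<^sub>C y"
    and scaleC_add_left: "(c + d) *\<^sub>C x = c *\<^sub>C x + d *\<^sub>C x"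
    and scaleC_scaleC: "c *\<^sub>C (d *\<^sub>C x) = (c * d) *\<^sub>C x"
    and scaleC_of_real: "complex_of_real r *\<^sub>C x = r *\<^sub>R x"
    and cinner_commute: "cinner x y = cnj (cinner y x)"
    and cinner_add_left: "cinner (x + y) z = cinner x z + cinner y z"
    and cinner_scaleC_left: "cinner (c *\<^sub>C x) y = c * cinner x y"
    and Re_cinner: "Re (cinner x y) = inner x y"

class chilbert_space = complex_inner + complete_space

definition cspan :: "'a::complex_inner set \<Rightarrow> 'a set" where
  "cspan S = span {c *\<^sub>C x |c x. x \<in> S}"

definition unitary :: "('h::complex_inner \<Rightarrow> 'h) \<Rightarrow> bool" where
  "unitary U \<longleftrightarrow> (\<forall>x y. U (x + y) = U x + U y) \<and> (\<forall>c x. U (c *\<^sub>C x) = c *\<^sub>C U x) \<and>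
     (\<forall>x y. cinner (U x) (U y) = cinner x y) \<and> surj U"


section \<open>Complexification of a real Hilbert space\<close>

text \<open>\<open>Cx f g\<close> is \<open>f + \<i> g\<close>.\<close>

datatype 'k complexified = Cx (reC: 'k) (imC: 'k)

instantiation complexified :: (real_inner) complex_inner
begin

definition zero_complexified :: "'a complexified" where "0 = Cx 0 0"
definition plus_complexified :: "'a complexified \<Rightarrow> 'a complexified \<Rightarrow> 'a complexified" where
  "z + w = Cx (reC z + reC w) (imC z + imC w)"
definition minus_complexified :: "'a complexified \<Rightarrow> 'a complexified \<Rightarrow> 'a complexified" where
  "z - w = Cx (reC z - reC w) (imC z - imC w)"
definition uminus_complexified :: "'a complexified \<Rightarrow> 'a complexified" where
  "- z = Cx (- reC z) (- imC z)"
definition scaleR_complexified :: "real \<Rightarrow> 'a complexified \<Rightarrow> 'a complexified" where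
  "r *\<^sub>R z = Cx (r *\<^sub>R reC z) (r *\<^sub>R imC z)"
definition scaleC_complexified :: "complex \<Rightarrow> 'a complexified \<Rightarrow> 'a complexified" where
  "c *\<^sub>C z = Cx (Re c *\<^sub>R reC z - Im c *\<^sub>R imC z) (Re c *\<^sub>R imC z + Im c *\<^sub>R reC z)"
definition inner_complexified :: "'a complexified \<Rightarrow> 'a complexified \<Rightarrow> real" where
  "inner z w = inner (reC z) (reC w) + inner (imC z) (imC w)"
definition cinner_complexified :: "'a complexified \<Rightarrow> 'a complexified \<Rightarrow> complex" where
  "cinner z w = Complex (inner (reC z) (reC w) + inner (imC z) (imC w))
                        (inner (imC z) (reC w) - inner (reC z) (imC w))"
definition norm_complexified :: "'a complexified \<Rightarrow> real" where
  "norm z = sqrt (inner z z)" for z :: "'a complexified"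
definition dist_complexified :: "'a complexified \<Rightarrow> 'a complexified \<Rightarrow> real" where
  "dist z w = norm (z - w)" for z :: "'a complexified"
definition sgn_complexified :: "'a complexified \<Rightarrow> 'a complexified" where
  "sgn z = inverse (norm z) *\<^sub>R z" for z :: "'a complexified"
definition uniformity_complexified :: "('a complexified \<times> 'a complexified) filter" where
  "uniformity = (INF e\<in>{0<..}. principal {(z :: 'a complexified, w). dist z w < e})"
definition open_complexified :: "'a complexified set \<Rightarrow> bool" where
  "open S = (\<forall>z\<in>S. \<forall>\<^sub>F (z', w) in uniformity. z' = z \<longrightarrow> w \<in> S)"
    for S :: "'a complexified set"

lemmas complexified_defs = zero_complexified_def plus_complexified_def minus_complexified_def
  uminus_complexified_def scaleR_complexified_def scaleC_complexified_def inner_complexified_def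
  cinner_complexified_def

instance
proof
  fix x y z :: "'a complexified" and r s :: real and c d :: complex
  show "x + y + z = x + (y + z)" by (simp add: complexified_defs)
  show "x + y = y + x" by (simp add: complexified_defs)
  show "0 + x = x" by (simp add: complexified_defs)
  show "- x + x = 0" by (simp add: complexified_defs)
  show "x - y = x + - y" by (simp add: complexified_defs)
  show "r *\<^sub>R (x + y) = r *\<^sub>R x + r *\<^sub>R y" by (simp add: complexified_defs algebra_simps)
  show "(r + s) *\<^sub>R x = r *\<^sub>R x + s *\<^sub>R x" by (simp add: complexified_defs algebra_simps)
  show "r *\<^sub>R s *\<^sub>R x = (r * s) *\<^sub>R x" by (simp add: complexified_defs)
  show "1 *\<^sub>R x = x" by (simp add: complexified_defs)
  show "dist x y = norm (x - y)" by (simp add: dist_complexified_def)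
  show "sgn x = inverse (norm x) *\<^sub>R x" by (simp add: sgn_complexified_def)
  show "uniformity = (INF e\<in>{0<..}. principal {(z :: 'a complexified, w). dist z w < e})"
    by (simp add: uniformity_complexified_def)
  show "open S = (\<forall>z\<in>S. \<forall>\<^sub>F (z', w) in uniformity. z' = z \<longrightarrow> w \<in> S)"
    for S :: "'a complexified set" by (simp add: open_complexified_def)
  show "inner x y = inner y x" by (simp add: complexified_defs inner_commute)
  show "inner (x + y) z = inner x z + inner y z" by (simp add: complexified_defs inner_add_left)
  show "inner (r *\<^sub>R x) y = r * inner x y" by (simp add: complexified_defs algebra_simps)
  show "0 \<le> inner x x" by (simp add: complexified_defs)
  show "inner x x = 0 \<longleftrightarrow> x = 0"
    by (cases x) (simp add: complexified_defs add_nonneg_eq_0_iff)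
  show "norm x = sqrt (inner x x)" by (simp add: norm_complexified_def)
  show "c *\<^sub>C (x + y) = c *\<^sub>C x + c *\<^sub>C y" by (simp add: complexified_defs algebra_simps)
  show "(c + d) *\<^sub>C x = c *\<^sub>C x + d *\<^sub>C x" by (simp add: complexified_defs algebra_simps)
  show "c *\<^sub>C d *\<^sub>C x = (c * d) *\<^sub>C x" by (simp add: complexified_defs algebra_simps)
  show "complex_of_real r *\<^sub>C x = r *\<^sub>R x" by (simp add: complexified_defs)
  show "cinner x y = cnj (cinner y x)"
    by (simp add: complexified_defs complex_eq_iff inner_commute)
  show "cinner (x + y) z = cinner x z + cinner y z"
    by (simp add: complexified_defs complex_eq_iff inner_add_left)
  show "cinner (c *\<^sub>C x) y = c * cinner x y"
    by (simp add: complexified_defs complex_eq_iff inner_add_left inner_diff_left algebra_simps)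
  show "Re (cinner x y) = inner x y" by (simp add: complexified_defs)
qed

end

instance complexified :: ("{real_inner, complete_space}") chilbert_space
proof
  fix X :: "nat \<Rightarrow> 'a complexified"
  assume X: "Cauchy X"
  have n2: "(norm z)\<^sup>2 = (norm (reC z))\<^sup>2 + (norm (imC z))\<^sup>2" for z :: "'a complexified"
    by (simp add: power2_norm_eq_inner inner_complexified_def)
  have re: "norm (reC z) \<le> norm z" and im: "norm (imC z) \<le> norm z" for z :: "'a complexified"
    by (rule power2_le_imp_le; simp add: n2)+
  have diff: "reC (z - w) = reC z - reC w" "imC (z - w) = imC z - imC w"
    for z w :: "'a complexified" by (simp_all add: minus_complexified_def)
  have "Cauchy (\<lambda>n. reC (X n))" "Cauchy (\<lambda>n. imC (X n))"
    using X re[of "X m - X n" for m n] im[of "X m - X n" for m n]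
    unfolding Cauchy_iff diff by (meson order_le_less_trans)+
  then obtain a b where a: "(\<lambda>n. reC (X n)) \<longlonglongrightarrow> a" and b: "(\<lambda>n. imC (X n)) \<longlonglongrightarrow> b"
    by (meson Cauchy_convergent convergent_def)
  have "norm (X n - Cx a b) = sqrt ((norm (reC (X n) - a))\<^sup>2 + (norm (imC (X n) - b))\<^sup>2)" for n
    using n2[of "X n - Cx a b"] by (simp add: diff real_sqrt_unique)
  moreover have "(\<lambda>n. sqrt ((norm (reC (X n) - a))\<^sup>2 + (norm (imC (X n) - b))\<^sup>2))
      \<longlonglongrightarrow> sqrt ((norm (a - a))\<^sup>2 + (norm (b - b))\<^sup>2)"
    by (intro tendsto_intros a b)
  ultimately have "(\<lambda>n. norm (X n - Cx a b)) \<longlonglongrightarrow> 0" by simp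
  then show "convergent X"
    unfolding convergent_def using LIM_zero_cancel tendsto_norm_zero_iff by blast
qed

definition complexify :: "('k \<Rightarrow> 'l) \<Rightarrow> 'k complexified \<Rightarrow> 'l complexified" where
  "complexify a z = Cx (a (reC z)) (a (imC z))"


section \<open>Positive nonsingular operators and their imaginary powers\<close>

text \<open>
  An unbounded operator is given by its domain \<open>D\<close> and a function \<open>A\<close>, of which only the
  restriction to \<open>D\<close> matters.  The last clause of \<open>selfadjoint_operator\<close> says that the graph of
  the operator is the graph of its adjoint; it forces \<open>D\<close> to be a complex subspace and \<open>A\<close> to be
  linear on \<open>D\<close>.
\<close>

definition selfadjoint_operator :: "'h::complex_inner set \<Rightarrow> ('h \<Rightarrow> 'h) \<Rightarrow> bool" where
  "selfadjoint_operator D A \<longleftrightarrow> closure D = UNIV \<and>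
     (\<forall>x y. x \<in> D \<and> A x = y \<longleftrightarrow> (\<forall>z\<in>D. cinner (A z) x = cinner z y))"

definition positive_nonsingular :: "'h::complex_inner set \<Rightarrow> ('h \<Rightarrow> 'h) \<Rightarrow> bool" where
  "positive_nonsingular D A \<longleftrightarrow> selfadjoint_operator D A \<and>
     (\<forall>x\<in>D. cinner (A x) x \<in> \<real>\<^sub>\<ge>\<^sub>0) \<and> (\<forall>x\<in>D. A x = 0 \<longrightarrow> x = 0)"

definition orthogonal_projection :: "('h::complex_inner \<Rightarrow>\<^sub>L 'h) \<Rightarrow> bool" where
  "orthogonal_projection P \<longleftrightarrow> P o\<^sub>L P = P \<and> (\<forall>x y. cinner (P x) y = cinner x (P y))"

definition spectral_measure :: "(real set \<Rightarrow> 'h::complex_inner \<Rightarrow>\<^sub>L 'h) \<Rightarrow> bool" where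
  "spectral_measure E \<longleftrightarrow>
     (\<forall>B\<in>sets borel. orthogonal_projection (E B)) \<and> E UNIV = id_blinfun \<and>
     (\<forall>B :: nat \<Rightarrow> real set. range B \<subseteq> sets borel \<and> disjoint_family B \<longrightarrow>
        (\<forall>x. (\<lambda>n. E (B n) x) sums E (\<Union>n. B n) x))"

text \<open>The finite measure \<open>B \<mapsto> \<langle>E(B) x, x\<rangle>\<close>.\<close>

definition spectral_distribution ::
    "(real set \<Rightarrow> 'h::complex_inner \<Rightarrow>\<^sub>L 'h) \<Rightarrow> 'h \<Rightarrow> real measure" where
  "spectral_distribution E x =
     measure_of UNIV (sets borel) (\<lambda>B. ennreal (Re (cinner (E B x) x)))"

text \<open>\<open>A = \<integral> s dE(s)\<close>; by polarization the quadratic forms determine the operators.\<close>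

definition spectral_resolution ::
    "'h::complex_inner set \<Rightarrow> ('h \<Rightarrow> 'h) \<Rightarrow> (real set \<Rightarrow> 'h \<Rightarrow>\<^sub>L 'h) \<Rightarrow> bool" where
  "spectral_resolution D A E \<longleftrightarrow> spectral_measure E \<and>
     D = {x. integrable (spectral_distribution E x) (\<lambda>s. s\<^sup>2)} \<and>
     (\<forall>x\<in>D. cinner (A x) x = complex_of_real (\<integral>s. s \<partial>spectral_distribution E x))"

text \<open>
  \<open>W = A\<^sup>i\<^sup>t = \<integral> s\<^sup>i\<^sup>t dE(s)\<close>, where \<open>E\<close> is the (unique) spectral resolution of \<open>A\<close>.
  For positive nonsingular \<open>A\<close> the measures are concentrated on \<open>s > 0\<close>.
\<close>

definition is_imaginary_power ::
    "'h::complex_inner set \<Rightarrow> ('h \<Rightarrow> 'h) \<Rightarrow> real \<Rightarrow> ('h \<Rightarrow> 'h) \<Rightarrow> bool" where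
  "is_imaginary_power D A t W \<longleftrightarrow> (\<exists>E. spectral_resolution D A E \<and>
     (\<forall>x. cinner (W x) x =
        (\<integral>s. complex_of_real s powr (\<i> * complex_of_real t) \<partial>spectral_distribution E x)))"

text \<open>\<open>2 A (I + A)\<^sup>-\<^sup>1\<close>; for a positive selfadjoint \<open>A\<close>, \<open>I + A\<close> maps \<open>D\<close> bijectively onto the
  whole space.\<close>

definition modular_weight :: "'h::complex_inner set \<Rightarrow> ('h \<Rightarrow> 'h) \<Rightarrow> 'h \<Rightarrow> 'h" where
  "modular_weight D A x = 2 *\<^sub>R A (the_inv_into D (\<lambda>z. z + A z) x)"


section \<open>Classical dynamical systems\<close>

text \<open>Elements of \<open>L\<^sup>2\<close> are represented by functions; equality is almost everywhere.\<close>

definition L2 :: "'a measure \<Rightarrow> ('a \<Rightarrow> 'b::{banach, second_countable_topology}) set" where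
  "L2 M = {f \<in> borel_measurable M. integrable M (\<lambda>x. (norm (f x))\<^sup>2)}"

text \<open>The orthogonal complement of the constants in \<open>L\<^sup>2\<close> of a probability space.\<close>

definition L2_0 :: "'a measure \<Rightarrow> ('a \<Rightarrow> 'b::{banach, second_countable_topology}) set" where
  "L2_0 M = {f \<in> L2 M. (\<integral>x. f x \<partial>M) = 0}"

definition infinite_dimensional_L2 :: "'a measure \<Rightarrow> bool" where
  "infinite_dimensional_L2 M \<longleftrightarrow>
     \<not> (\<exists>B :: ('a \<Rightarrow> complex) set. finite B \<and> B \<subseteq> L2 M \<and>
          (\<forall>f\<in>L2 M. \<exists>c. AE x in M. f x = (\<Sum>b\<in>B. c b * b x)))"

definition separable_L2 :: "'a measure \<Rightarrow> bool" where
  "separable_L2 M \<longleftrightarrow>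
     (\<exists>D :: ('a \<Rightarrow> complex) set. countable D \<and> D \<subseteq> L2 M \<and>
        (\<forall>f\<in>L2 M. \<forall>\<epsilon>>0. \<exists>g\<in>D. (\<integral>x. (norm (f x - g x))\<^sup>2 \<partial>M) < \<epsilon>))"

definition classical_system :: "'a measure \<Rightarrow> ('a \<Rightarrow> 'a) \<Rightarrow> bool" where
  "classical_system M T \<longleftrightarrow> prob_space M \<and> bij_betw T (space M) (space M) \<and>
     T \<in> M \<rightarrow>\<^sub>M M \<and> the_inv_into (space M) T \<in> M \<rightarrow>\<^sub>M M \<and> distr M M T = M"

definition koopman :: "'a measure \<Rightarrow> ('a \<Rightarrow> 'a) \<Rightarrow> ('a \<Rightarrow> 'b) \<Rightarrow> 'a \<Rightarrow> 'b" where
  "koopman M T f = (\<lambda>x. f (the_inv_into (space M) T x))"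

definition correlation ::
    "'a measure \<Rightarrow> ('a \<Rightarrow> 'a) \<Rightarrow> ('a \<Rightarrow> complex) \<Rightarrow> ('a \<Rightarrow> complex) \<Rightarrow> nat \<Rightarrow> complex" where
  "correlation M T \<xi> \<eta> n = (\<integral>x. (koopman M T ^^ n) \<xi> x * cnj (\<eta> x) \<partial>M)"

definition ergodic :: "'a measure \<Rightarrow> ('a \<Rightarrow> 'a) \<Rightarrow> bool" where
  "ergodic M T \<longleftrightarrow> (\<forall>\<xi>\<in>L2_0 M. \<forall>\<eta>\<in>L2_0 M.
     (\<lambda>n. (\<Sum>k=1..n. correlation M T \<xi> \<eta> k) / of_nat n) \<longlonglongrightarrow> 0)"

definition weakly_mixing :: "'a measure \<Rightarrow> ('a \<Rightarrow> 'a) \<Rightarrow> bool" where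
  "weakly_mixing M T \<longleftrightarrow> (\<forall>\<xi>\<in>L2_0 M. \<forall>\<eta>\<in>L2_0 M.
     (\<lambda>n. (\<Sum>k=1..n. cmod (correlation M T \<xi> \<eta> k)) / real n) \<longlonglongrightarrow> 0)"

definition mixing :: "'a measure \<Rightarrow> ('a \<Rightarrow> 'a) \<Rightarrow> bool" where
  "mixing M T \<longleftrightarrow> (\<forall>\<xi>\<in>L2_0 M. \<forall>\<eta>\<in>L2_0 M. correlation M T \<xi> \<eta> \<longlonglongrightarrow> 0)"


section \<open>The one-particle space\<close>

definition multiplicative_subgroup :: "real set \<Rightarrow> bool" where
  "multiplicative_subgroup G \<longleftrightarrow> G \<subseteq> {0<..} \<and> 1 \<in> G \<and>
     (\<forall>a\<in>G. \<forall>b\<in>G. a * b \<in> G) \<and> (\<forall>a\<in>G. inverse a \<in> G)"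

text \<open>The Hilbert direct sum of copies of \<open>\<real>\<^sup>2\<close> indexed by \<open>G\<close>.\<close>

definition plane_sum :: "real set \<Rightarrow> (real \<Rightarrow> real^2) set" where
  "plane_sum G = {w. (\<forall>l. l \<notin> G \<longrightarrow> w l = 0) \<and> (\<lambda>l. (norm (w l))\<^sup>2) summable_on G}"

definition plane_sum_inner :: "real set \<Rightarrow> (real \<Rightarrow> real^2) \<Rightarrow> (real \<Rightarrow> real^2) \<Rightarrow> real" where
  "plane_sum_inner G w w' = (\<Sum>\<^sub>\<infinity>l\<in>G. inner (w l) (w' l))"

definition rotation_matrix :: "real \<Rightarrow> real^2^2" where
  "rotation_matrix \<theta> = vector [vector [cos \<theta>, - sin \<theta>], vector [sin \<theta>, cos \<theta>]]"

definition rotation_group :: "real \<Rightarrow> (real \<Rightarrow> real^2) \<Rightarrow> real \<Rightarrow> real^2" where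
  "rotation_group t w = (\<lambda>l. rotation_matrix (t * ln l) *v w l)"

text \<open>
  The Hilbert spaces of the construction are determined up to unitary equivalence.  The predicates
  below say when a complete space, with its canonical map, is a Hilbert tensor product, a
  completion or a full Fock space; statements are made for arbitrary such realizations.  As all
  spaces involved are separable, realizations on types isomorphic to \<open>\<ell>\<^sup>2(\<nat>)\<close> always exist.
\<close>

definition is_hilbert_tensor_product ::
    "'v set \<Rightarrow> ('v \<Rightarrow> 'v \<Rightarrow> real) \<Rightarrow> 'w set \<Rightarrow> ('w \<Rightarrow> 'w \<Rightarrow> real) \<Rightarrow>
     ('v \<Rightarrow> 'w \<Rightarrow> 'k::{real_inner, complete_space}) \<Rightarrow> bool" where
  "is_hilbert_tensor_product V ipV W ipW tensor \<longleftrightarrow>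
     (\<forall>v\<in>V. \<forall>v'\<in>V. \<forall>w\<in>W. \<forall>w'\<in>W. inner (tensor v w) (tensor v' w') = ipV v v' * ipW w w') \<and>
     closure (span {tensor v w |v w. v \<in> V \<and> w \<in> W}) = UNIV"

text \<open>The realizations of the real Hilbert space \<open>K\<^sub>\<real>\<close>.\<close>

definition is_one_particle_space ::
    "'a measure \<Rightarrow> real set \<Rightarrow>
     (('a \<Rightarrow> real) \<Rightarrow> (real \<Rightarrow> real^2) \<Rightarrow> 'k::{real_inner, complete_space}) \<Rightarrow> bool" where
  "is_one_particle_space M G tensor \<longleftrightarrow>
     is_hilbert_tensor_product (L2_0 M) (\<lambda>f g. \<integral>x. f x * g x \<partial>M)
       (plane_sum G) (plane_sum_inner G) tensor"

text \<open>The bounded operator \<open>a \<otimes> b\<close> on \<open>K\<^sub>\<real>\<close>.\<close>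

definition tensor_operator ::
    "'a measure \<Rightarrow> real set \<Rightarrow>
     (('a \<Rightarrow> real) \<Rightarrow> (real \<Rightarrow> real^2) \<Rightarrow> 'k::{real_inner, complete_space}) \<Rightarrow>
     (('a \<Rightarrow> real) \<Rightarrow> ('a \<Rightarrow> real)) \<Rightarrow> ((real \<Rightarrow> real^2) \<Rightarrow> (real \<Rightarrow> real^2)) \<Rightarrow> 'k \<Rightarrow>\<^sub>L 'k" where
  "tensor_operator M G tensor a b =
     (THE x :: 'k \<Rightarrow>\<^sub>L 'k. \<forall>f\<in>L2_0 M. \<forall>w\<in>plane_sum G. x (tensor f w) = tensor (a f) (b w))"

definition is_completion ::
    "('c::complex_inner \<Rightarrow> 'c \<Rightarrow> complex) \<Rightarrow> ('c \<Rightarrow> 'h::chilbert_space) \<Rightarrow> bool" where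
  "is_completion ip j \<longleftrightarrow>
     (\<forall>x y. j (x + y) = j x + j y) \<and> (\<forall>c x. j (c *\<^sub>C x) = c *\<^sub>C j x) \<and>
     (\<forall>x y. cinner (j x) (j y) = ip x y) \<and> closure (range j) = UNIV"


section \<open>Bounded operators and C*-algebras\<close>

text \<open>
  Operators are elements of the library type of bounded real-linear operators, with its operator
  norm; \<open>bounded_operators\<close> singles out the complex-linear ones.
\<close>

definition bounded_operators :: "('f::chilbert_space \<Rightarrow>\<^sub>L 'f) set" where
  "bounded_operators = {x :: 'f \<Rightarrow>\<^sub>L 'f. \<forall>c v. x (c *\<^sub>C v) = c *\<^sub>C x v}"

definition op_scaleC :: "complex \<Rightarrow> ('f::chilbert_space \<Rightarrow>\<^sub>L 'f) \<Rightarrow> 'f \<Rightarrow>\<^sub>L 'f" where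
  "op_scaleC c x = Blinfun (\<lambda>v. c *\<^sub>C x v)"

definition op_adjoint :: "('f::chilbert_space \<Rightarrow>\<^sub>L 'f) \<Rightarrow> 'f \<Rightarrow>\<^sub>L 'f" where
  "op_adjoint x = (THE y :: 'f \<Rightarrow>\<^sub>L 'f. \<forall>u v. cinner (x u) v = cinner u (y v))"

definition unital_cstar_algebra :: "('f::chilbert_space \<Rightarrow>\<^sub>L 'f) set \<Rightarrow> bool" where
  "unital_cstar_algebra \<AA> \<longleftrightarrow> \<AA> \<subseteq> bounded_operators \<and> id_blinfun \<in> \<AA> \<and>
     (\<forall>x\<in>\<AA>. \<forall>y\<in>\<AA>. x + y \<in> \<AA>) \<and> (\<forall>c. \<forall>x\<in>\<AA>. op_scaleC c x \<in> \<AA>) \<and>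
     (\<forall>x\<in>\<AA>. \<forall>y\<in>\<AA>. x o\<^sub>L y \<in> \<AA>) \<and> (\<forall>x\<in>\<AA>. op_adjoint x \<in> \<AA>) \<and> closed \<AA>"

definition generated_cstar_algebra ::
    "('f::chilbert_space \<Rightarrow>\<^sub>L 'f) set \<Rightarrow> ('f \<Rightarrow>\<^sub>L 'f) set" where
  "generated_cstar_algebra S = \<Inter>{\<AA>. unital_cstar_algebra \<AA> \<and> S \<subseteq> \<AA>}"

definition linear_on_algebra ::
    "('f::chilbert_space \<Rightarrow>\<^sub>L 'f) set \<Rightarrow> (('f \<Rightarrow>\<^sub>L 'f) \<Rightarrow> ('f \<Rightarrow>\<^sub>L 'f)) \<Rightarrow> bool" where
  "linear_on_algebra \<AA> E \<longleftrightarrow> (\<forall>x\<in>\<AA>. \<forall>y\<in>\<AA>. E (x + y) = E x + E y) \<and>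
     (\<forall>c. \<forall>x\<in>\<AA>. E (op_scaleC c x) = op_scaleC c (E x))"

definition automorphism ::
    "('f::chilbert_space \<Rightarrow>\<^sub>L 'f) set \<Rightarrow> (('f \<Rightarrow>\<^sub>L 'f) \<Rightarrow> ('f \<Rightarrow>\<^sub>L 'f)) \<Rightarrow> bool" where
  "automorphism \<AA> \<alpha> \<longleftrightarrow> bij_betw \<alpha> \<AA> \<AA> \<and> linear_on_algebra \<AA> \<alpha> \<and>
     (\<forall>x\<in>\<AA>. \<forall>y\<in>\<AA>. \<alpha> (x o\<^sub>L y) = \<alpha> x o\<^sub>L \<alpha> y) \<and>
     (\<forall>x\<in>\<AA>. \<alpha> (op_adjoint x) = op_adjoint (\<alpha> x))"

definition states :: "('f::chilbert_space \<Rightarrow>\<^sub>L 'f) set \<Rightarrow> (('f \<Rightarrow>\<^sub>L 'f) \<Rightarrow> complex) set" where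
  "states \<AA> = {\<phi>. (\<forall>x\<in>\<AA>. \<forall>y\<in>\<AA>. \<phi> (x + y) = \<phi> x + \<phi> y) \<and>
     (\<forall>c. \<forall>x\<in>\<AA>. \<phi> (op_scaleC c x) = c * \<phi> x) \<and>
     (\<forall>x\<in>\<AA>. \<phi> (op_adjoint x o\<^sub>L x) \<in> \<real>\<^sub>\<ge>\<^sub>0) \<and> \<phi> id_blinfun = 1}"

definition fixed_point_algebra ::
    "('f::chilbert_space \<Rightarrow>\<^sub>L 'f) set \<Rightarrow> (('f \<Rightarrow>\<^sub>L 'f) \<Rightarrow> ('f \<Rightarrow>\<^sub>L 'f)) \<Rightarrow> ('f \<Rightarrow>\<^sub>L 'f) set" where
  "fixed_point_algebra \<AA> \<alpha> = {x\<in>\<AA>. \<alpha> x = x}"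

definition nontrivial_algebra :: "('f::chilbert_space \<Rightarrow>\<^sub>L 'f) set \<Rightarrow> bool" where
  "nontrivial_algebra \<AA> \<longleftrightarrow> \<AA> \<noteq> range (\<lambda>c. op_scaleC c id_blinfun)"


section \<open>Ergodic properties of quantum dynamical systems\<close>

definition uniquely_ergodic_fixed_point ::
    "('f::chilbert_space \<Rightarrow>\<^sub>L 'f) set \<Rightarrow> (('f \<Rightarrow>\<^sub>L 'f) \<Rightarrow> ('f \<Rightarrow>\<^sub>L 'f)) \<Rightarrow> bool" where
  "uniquely_ergodic_fixed_point \<AA> \<alpha> \<longleftrightarrow>
     (\<exists>E. E ` \<AA> \<subseteq> \<AA> \<and> linear_on_algebra \<AA> E \<and>
        (\<forall>x\<in>\<AA>. \<forall>\<phi>\<in>states \<AA>.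
           (\<lambda>n. (\<Sum>k<n. \<phi> ((\<alpha> ^^ k) x)) / of_nat n) \<longlonglongrightarrow> \<phi> (E x)))"

definition uniquely_weak_mixing ::
    "('f::chilbert_space \<Rightarrow>\<^sub>L 'f) set \<Rightarrow> (('f \<Rightarrow>\<^sub>L 'f) \<Rightarrow> ('f \<Rightarrow>\<^sub>L 'f)) \<Rightarrow> bool" where
  "uniquely_weak_mixing \<AA> \<alpha> \<longleftrightarrow>
     (\<exists>\<omega>\<in>states \<AA>. let E = (\<lambda>x. op_scaleC (\<omega> x) id_blinfun) in
        \<forall>x\<in>\<AA>. \<forall>\<phi>\<in>states \<AA>.
          (\<lambda>n. (\<Sum>k<n. cmod (\<phi> ((\<alpha> ^^ k) x) - \<phi> (E x))) / real n) \<longlonglongrightarrow> 0)"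

definition uniquely_mixing ::
    "('f::chilbert_space \<Rightarrow>\<^sub>L 'f) set \<Rightarrow> (('f \<Rightarrow>\<^sub>L 'f) \<Rightarrow> ('f \<Rightarrow>\<^sub>L 'f)) \<Rightarrow> bool" where
  "uniquely_mixing \<AA> \<alpha> \<longleftrightarrow>
     (\<exists>\<omega>\<in>states \<AA>. let E = (\<lambda>x. op_scaleC (\<omega> x) id_blinfun) in
        \<forall>x\<in>\<AA>. \<forall>\<phi>\<in>states \<AA>. (\<lambda>n. \<phi> ((\<alpha> ^^ n) x)) \<longlonglongrightarrow> \<phi> (E x))"

text \<open>Functionals are only compared on the algebra, since they are total functions.\<close>

definition is_unique_invariant_state ::
    "('f::chilbert_space \<Rightarrow>\<^sub>L 'f) set \<Rightarrow> (('f \<Rightarrow>\<^sub>L 'f) \<Rightarrow> ('f \<Rightarrow>\<^sub>L 'f)) \<Rightarrow>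
     (('f \<Rightarrow>\<^sub>L 'f) \<Rightarrow> complex) \<Rightarrow> bool" where
  "is_unique_invariant_state \<AA> \<alpha> \<omega> \<longleftrightarrow>
     \<omega> \<in> states \<AA> \<and> (\<forall>x\<in>\<AA>. \<omega> (\<alpha> x) = \<omega> x) \<and>
     (\<forall>\<phi>\<in>states \<AA>. (\<forall>x\<in>\<AA>. \<phi> (\<alpha> x) = \<phi> x) \<longrightarrow> (\<forall>x\<in>\<AA>. \<phi> x = \<omega> x))"


section \<open>The full Fock space and the algebra generated by the fields\<close>

text \<open>
  \<open>word [f\<^sub>1, \<dots>, f\<^sub>n]\<close> is the simple tensor \<open>f\<^sub>1 \<otimes> \<dots> \<otimes> f\<^sub>n\<close>, and \<open>word []\<close> is the vacuum
  \<open>\<Omega>\<close>.  The first clause describes the inner product of the tensor power \<open>H\<^sup>\<otimes>\<^sup>n\<close> (for \<open>n = 0\<close>: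
  \<open>\<Omega>\<close> is a unit vector), the second the orthogonality of the summands, the third says that
  simple tensors are total.  Multilinearity of \<open>word\<close> follows from the first clause.
\<close>

definition is_full_fock_space :: "('h::chilbert_space list \<Rightarrow> 'f::chilbert_space) \<Rightarrow> bool" where
  "is_full_fock_space word \<longleftrightarrow>
     (\<forall>fs gs. length fs = length gs \<longrightarrow>
        cinner (word fs) (word gs) = (\<Prod>i<length fs. cinner (fs ! i) (gs ! i))) \<and>
     (\<forall>fs gs. length fs \<noteq> length gs \<longrightarrow> cinner (word fs) (word gs) = 0) \<and>
     closure (cspan (range word)) = UNIV"

definition creator ::
    "('h::chilbert_space list \<Rightarrow> 'f::chilbert_space) \<Rightarrow> 'h \<Rightarrow> 'f \<Rightarrow>\<^sub>L 'f" where
  "creator word f =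
     (THE x :: 'f \<Rightarrow>\<^sub>L 'f. x \<in> bounded_operators \<and> (\<forall>fs. x (word fs) = word (f # fs)))"

definition annihilator ::
    "('h::chilbert_space list \<Rightarrow> 'f::chilbert_space) \<Rightarrow> 'h \<Rightarrow> 'f \<Rightarrow>\<^sub>L 'f" where
  "annihilator word f = op_adjoint (creator word f)"

definition field_op ::
    "('h::chilbert_space list \<Rightarrow> 'f::chilbert_space) \<Rightarrow> 'h \<Rightarrow> 'f \<Rightarrow>\<^sub>L 'f" where
  "field_op word f = annihilator word f + creator word f"

text \<open>\<open>Cx f 0\<close> is \<open>f \<in> K\<^sub>\<real>\<close> regarded as an element of the complexification, which \<open>j\<close> maps into
  its completion \<open>H\<close>.\<close>

definition gauss_algebra ::
    "('k::{real_inner, complete_space} complexified \<Rightarrow> 'h::chilbert_space) \<Rightarrow>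
     ('h list \<Rightarrow> 'f::chilbert_space) \<Rightarrow> ('f \<Rightarrow>\<^sub>L 'f) set" where
  "gauss_algebra j word = generated_cstar_algebra {field_op word (j (Cx f 0)) |f. f \<in> UNIV}"

definition vacuum_state ::
    "('h::chilbert_space list \<Rightarrow> 'f::chilbert_space) \<Rightarrow> ('f \<Rightarrow>\<^sub>L 'f) \<Rightarrow> complex" where
  "vacuum_state word x = cinner (x (word [])) (word [])"

end

theory Submission
  imports Defs "HOL-Computational_Algebra.Polynomial"
begin

text \<open>
  The algebra is governed by normal ordering.  Because \<open>a(g) a\<^sup>+(f) = \<langle>f, g\<rangle> 1\<close>, every product of
  fields is a combination of normally ordered products \<open>a\<^sup>+(f\<^sub>1) \<cdots> a\<^sup>+(f\<^sub>m) a(g\<^sub>1) \<cdots> a(g\<^sub>l)\<close>, and since \<open>U\<close> is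
  isometric, the coefficients do not change when all the one-particle vectors are moved by \<open>U\<^sup>k\<close>.
  The key estimate \<open>norm_sum_normal_ordered_le\<close> bounds the norm of a linear combination, with
  coefficients \<open>c\<^sub>k\<close>, of the translates by \<open>U\<^sup>k\<close> of one normally ordered product.  The square of the
  norm is at most the value at \<open>c\<close> of a quadratic form whose kernel is the product of
  the one-particle correlations \<open>\<langle>U\<^sup>i f\<^sub>r, U\<^sup>j f\<^sub>r\<rangle>\<close> and of the conjugates of \<open>\<langle>U\<^sup>i g\<^sub>r, U\<^sup>j g\<^sub>r\<rangle>\<close>.  This kernel is
  positive and depends only on \<open>i - j\<close>.

  A positive stationary kernel defines a semi-inner product on polynomials for which
  multiplication by \<open>X\<close> is isometric, so that the argument of the mean ergodic theorem shows that the averages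
  of \<open>\<alpha>\<^sup>k(x)\<close> converge in norm (\<open>averages_converge\<close>).  The limits form the map \<open>E\<close>.  If the correlations
  vanish in mean, so does the kernel of every normally ordered product other than \<open>1\<close>.  Then averages with
  arbitrary weights of modulus at most one tend to zero in norm.  A suitable choice of the weights gives the
  convergence in mean of \<open>|\<phi>(\<alpha>\<^sup>k(x)) - \<omega>(x)|\<close> for every state (\<open>states_converge_in_mean\<close>).  In the
  mixing case the same argument applies along every subsequence of times, which is equivalent to
  convergence.  Passing from products of fields to the whole algebra requires that states and automorphisms
  are contractive (\<open>state_norm_le\<close>, \<open>automorphism_norm_le\<close>).

  Conversely, if the fixed points were scalars, then the two-particle component of the averages of
  \<open>s(U\<^sup>k h)\<^sup>2 \<Omega>\<close> would tend to zero, that is, the averages of \<open>\<langle>U\<^sup>k h, g\<rangle>\<^sup>2\<close> would.  If the system were uniquely mixing,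
  then the vector states of \<open>\<Omega> + g\<close> would force \<open>Re \<langle>U\<^sup>n h, g\<rangle>\<close> to tend to zero.

  The classical system enters through the weight \<open>B = 2 A (I + A)\<^sup>-\<^sup>1\<close>: the correlation of \<open>x\<close>
  and \<open>y\<close> in the completion is \<open>((u\<^sup>n \<otimes> I) x, B y)\<close>.  Thus decay of classical correlations carries over to the
  completion.  In the opposite direction, \<open>B\<close> has dense range because \<open>A\<close> is selfadjoint and injective
  (\<open>modular_weight_dense_range\<close>), so decay against all \<open>B y\<close> implies decay against all vectors.
\<close>

section \<open>Complex inner products\<close>

instance chilbert_space \<subseteq> banach ..

lemma cinner_add_right: "cinner x (y + z) = cinner x y + cinner x (z :: 'a::complex_inner)"
  by (metis cinner_add_left cinner_commute complex_cnj_add)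

lemma cinner_scaleC_right: "cinner x (c *\<^sub>C y) = cnj c * cinner x (y :: 'a::complex_inner)"
  by (metis cinner_scaleC_left cinner_commute complex_cnj_mult)

lemma cinner_self: "cinner x x = of_real ((norm x)\<^sup>2)" for x :: "'a::complex_inner"
proof (rule complex_eqI)
  show "Re (cinner x x) = Re (of_real ((norm x)\<^sup>2))"
    by (simp add: Re_cinner power2_norm_eq_inner)
  have "Im (cinner x x) = - Im (cinner x x)"
    by (subst (1) cinner_commute) simp
  then show "Im (cinner x x) = Im (of_real ((norm x)\<^sup>2))" by simp
qed

lemma norm_scaleC: "norm (c *\<^sub>C x) = cmod c * norm (x :: 'a::complex_inner)"
proof -
  have "of_real ((norm (c *\<^sub>C x))\<^sup>2) = cinner (c *\<^sub>C x) (c *\<^sub>C x)" by (simp only: cinner_self)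
  also have "\<dots> = (c * cnj c) * cinner x x" by (simp add: cinner_scaleC_left cinner_scaleC_right)
  also have "\<dots> = of_real ((cmod c * norm x)\<^sup>2)"
    by (simp only: cinner_self complex_norm_square[symmetric] of_real_mult[symmetric] of_real_power[symmetric] power_mult_distrib)
  finally have "(norm (c *\<^sub>C x))\<^sup>2 = (cmod c * norm x)\<^sup>2" using of_real_eq_iff by blast
  then show ?thesis by simp
qed

lemma phase_exists: "\<exists>c. cmod c \<le> 1 \<and> c * z = of_real (cmod z)"
proof (cases "z = 0")
  case True
  then show ?thesis by (intro exI[of _ 0]) simp
next
  case False
  have "cnj (sgn z) * z = z * cnj z / of_real (cmod z)"
    by (simp add: sgn_div_norm scaleR_conv_of_real divide_inverse mult.commute)
  also have "\<dots> = of_real ((cmod z)\<^sup>2 / cmod z)"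
    by (simp only: complex_norm_square[symmetric] of_real_divide of_real_power)
  finally show ?thesis by (intro exI[of _ "cnj (sgn z)"]) (simp add: norm_sgn power2_eq_square)
qed

text \<open>Multiplying \<open>x\<close> by a phase makes the complex inner product real, so that the real Cauchy-Schwarz
  inequality applies.\<close>

lemma norm_cinner_le: "cmod (cinner x y) \<le> norm x * norm (y :: 'a::complex_inner)"
proof -
  obtain c where c: "cmod c \<le> 1" "c * cinner x y = of_real (cmod (cinner x y))"
    using phase_exists by blast
  have "cmod (cinner x y) = Re (cinner (c *\<^sub>C x) y)" by (simp add: cinner_scaleC_left c)
  also have "\<dots> = inner (c *\<^sub>C x) y" by (rule Re_cinner)
  also have "\<dots> \<le> norm (c *\<^sub>C x) * norm y" by (rule norm_cauchy_schwarz)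
  also have "\<dots> \<le> norm x * norm y"
    by (intro mult_right_mono) (simp_all add: norm_scaleC c mult_left_le_one_le)
  finally show ?thesis .
qed

lemma bounded_bilinear_cinner: "bounded_bilinear (cinner :: 'a::complex_inner \<Rightarrow> 'a \<Rightarrow> complex)"
proof
  show "\<exists>K. \<forall>x y :: 'a. cmod (cinner x y) \<le> norm x * norm y * K"
    by (intro exI[of _ 1]) (simp add: norm_cinner_le)
qed (simp_all add: cinner_add_left cinner_add_right cinner_scaleC_left cinner_scaleC_right
       scaleR_conv_of_real flip: scaleC_of_real)

lemma bounded_bilinear_scaleC: "bounded_bilinear (scaleC :: complex \<Rightarrow> 'a::complex_inner \<Rightarrow> 'a)"
proof
  show "\<exists>K. \<forall>c. \<forall>x :: 'a. norm (c *\<^sub>C x) \<le> norm c * norm x * K"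
    by (intro exI[of _ 1]) (simp add: norm_scaleC)
qed (simp_all add: scaleC_add_left scaleC_add_right scaleC_scaleC scaleR_conv_of_real mult.commute
       flip: scaleC_of_real)

interpretation cinner: bounded_bilinear "cinner :: 'a::complex_inner \<Rightarrow> 'a \<Rightarrow> complex"
  by (rule bounded_bilinear_cinner)

interpretation scaleC: bounded_bilinear "scaleC :: complex \<Rightarrow> 'a::complex_inner \<Rightarrow> 'a"
  by (rule bounded_bilinear_scaleC)

lemma scaleC_one [simp]: "1 *\<^sub>C x = (x :: 'a::complex_inner)"
  using scaleC_of_real[of 1 x] by simp

lemma cinner_eq_imp_eq: "(\<And>v. cinner v x = cinner v y) \<Longrightarrow> x = (y :: 'a::complex_inner)"
proof -
  assume *: "\<And>v. cinner v x = cinner v y"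
  have "cinner (x - y) (x - y) = 0" using *[of "x - y"] by (simp add: cinner.diff_right)
  then show "x = y" by (simp add: cinner_self)
qed

section \<open>Orthogonal projections and the Riesz representation theorem\<close>

lemma parallelogram_midpoint:
  "(norm (a - b))\<^sup>2 = 2 * (norm a)\<^sup>2 + 2 * (norm b)\<^sup>2 - 4 * (norm ((1/2) *\<^sub>R (a + b)))\<^sup>2"
  for a b :: "'a::real_inner"
  by (simp add: power2_norm_eq_inner inner_add_left inner_add_right inner_diff_left inner_diff_right
      inner_commute algebra_simps)

text \<open>By the parallelogram law a minimizing sequence for the distance from \<open>x\<close> to \<open>S\<close> is Cauchy; its
  limit is the projection.\<close>

lemma orthogonal_decomposition_exists:
  fixes S :: "'a::{real_inner, complete_space} set"
  assumes S: "subspace S" "closed S"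
  shows "\<exists>y\<in>S. \<forall>s\<in>S. inner (x - y) s = 0"
proof -
  define d where "d = Inf ((\<lambda>s. norm (x - s)) ` S)"
  have ne: "S \<noteq> {}" using S(1) subspace_0 by blast
  have bdd: "bdd_below ((\<lambda>s. norm (x - s)) ` S)" by (rule bdd_belowI[of _ 0]) auto
  have d_le: "d \<le> norm (x - s)" if "s \<in> S" for s
    unfolding d_def using that bdd by (auto intro: cInf_lower)
  have d0: "0 \<le> d" unfolding d_def using ne by (intro cInf_greatest) auto
  have "\<exists>s\<in>S. norm (x - s) < d + 1 / real (Suc n)" for n
  proof -
    have "d < d + 1 / real (Suc n)" by simp
    then show ?thesis unfolding d_def using cInf_lessD[of "(\<lambda>s. norm (x - s)) ` S"] ne by (auto simp: )
  qed
  then obtain s where s: "\<And>n. s n \<in> S" "\<And>n. norm (x - s n) < d + 1 / real (Suc n)" by metis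
  have lim: "(\<lambda>n. norm (x - s n)) \<longlonglongrightarrow> d"
  proof (rule tendsto_sandwich)
    show "\<forall>\<^sub>F n in sequentially. d \<le> norm (x - s n)" using d_le s by auto
    show "\<forall>\<^sub>F n in sequentially. norm (x - s n) \<le> d + 1 / real (Suc n)" using s(2) by (intro always_eventually allI less_imp_le)
    show "(\<lambda>n. d + 1 / real (Suc n)) \<longlonglongrightarrow> d" using LIMSEQ_Suc[OF lim_1_over_n] tendsto_add[of "\<lambda>_. d" d _ "\<lambda>n. 1 / real (Suc n)" 0] by simp
  qed simp
  have sq: "(\<lambda>n. (norm (x - s n))\<^sup>2) \<longlonglongrightarrow> d\<^sup>2" by (intro tendsto_power lim)
  have gap: "(norm (s m - s n))\<^sup>2 \<le> 2 * (norm (x - s m))\<^sup>2 + 2 * (norm (x - s n))\<^sup>2 - 4 * d\<^sup>2" for m n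
  proof -
    have mid: "(1/2) *\<^sub>R ((x - s m) + (x - s n)) = x - (1/2) *\<^sub>R (s m + s n)"
      by (simp add: algebra_simps flip: scaleR_left.add)
    have "(1/2) *\<^sub>R (s m + s n) \<in> S" by (intro subspace_scale subspace_add S s)
    then have "d\<^sup>2 \<le> (norm ((1/2) *\<^sub>R ((x - s m) + (x - s n))))\<^sup>2"
      unfolding mid using d_le d0 by (intro power_mono) auto
    moreover have "norm (s m - s n) = norm ((x - s m) - (x - s n))" by (simp add: norm_minus_commute)
    ultimately show ?thesis using parallelogram_midpoint[of "x - s m" "x - s n"] by simp
  qed
  have "Cauchy s"
  proof (rule metric_CauchyI)
    fix e :: real assume e: "0 < e"
    have "\<forall>\<^sub>F n in sequentially. (norm (x - s n))\<^sup>2 < d\<^sup>2 + e\<^sup>2 / 4"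
      by (rule order_tendstoD(2)[OF sq]) (use e in simp)
    then obtain N where N: "\<And>n. n \<ge> N \<Longrightarrow> (norm (x - s n))\<^sup>2 < d\<^sup>2 + e\<^sup>2 / 4"
      by (auto simp: eventually_sequentially)
    show "\<exists>M. \<forall>m\<ge>M. \<forall>n\<ge>M. dist (s m) (s n) < e"
    proof (intro exI allI impI)
      fix m n assume mn: "N \<le> m" "N \<le> n"
      have "(norm (s m - s n))\<^sup>2 < e\<^sup>2" using gap[of m n] N[OF mn(1)] N[OF mn(2)] by linarith
      then show "dist (s m) (s n) < e" using e by (simp add: dist_norm power_less_imp_less_base)
    qed
  qed
  then obtain y where y: "s \<longlonglongrightarrow> y" by (meson Cauchy_convergent convergent_def)
  have yS: "y \<in> S" using closed_sequentially[OF S(2)] s y by blast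
  have "(\<lambda>n. norm (x - s n)) \<longlonglongrightarrow> norm (x - y)" by (intro tendsto_intros y)
  then have yd: "norm (x - y) = d" using lim LIMSEQ_unique by blast
  have "inner (x - y) t = 0" if t: "t \<in> S" for t
  proof (rule ccontr)
    assume ne0: "inner (x - y) t \<noteq> 0"
    then have t0: "inner t t > 0" by auto
    \<comment> \<open>the minimum of \<open>r \<mapsto> norm (x - y - r t)\<close> would otherwise lie strictly below \<open>d\<close>\<close>
    define r where "r = inner (x - y) t / inner t t"
    have "y + r *\<^sub>R t \<in> S" by (intro subspace_add subspace_scale S yS t)
    then have "(norm (x - y))\<^sup>2 \<le> (norm (x - (y + r *\<^sub>R t)))\<^sup>2" using d_le yd by (intro power_mono) auto
    also have "\<dots> = (norm (x - y))\<^sup>2 - 2 * r * inner (x - y) t + r\<^sup>2 * inner t t"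
      unfolding power2_norm_eq_inner
      by (simp add: inner_add_left inner_add_right inner_diff_left inner_diff_right
          inner_commute algebra_simps power2_eq_square)
    also have "\<dots> = (norm (x - y))\<^sup>2 - (inner (x - y) t)\<^sup>2 / inner t t"
      using t0 by (simp add: r_def field_simps power2_eq_square)
    finally have "(inner (x - y) t)\<^sup>2 / inner t t \<le> 0" by simp
    then show False using t0 ne0 by (simp add: divide_le_0_iff)
  qed
  then show ?thesis using yS by blast
qed

lemma subspace_closure:
  fixes S :: "'a::real_normed_vector set"
  assumes "subspace S" shows "subspace (closure S)"
proof (rule subspaceI)
  show "0 \<in> closure S" using assms subspace_0 closure_subset by blast
next
  fix x y assume "x \<in> closure S" "y \<in> closure S"
  then obtain a b where "\<And>n. a n \<in> S" "a \<longlonglongrightarrow> x" "\<And>n. b n \<in> S" "b \<longlonglongrightarrow> y"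
    unfolding closure_sequential by metis
  then show "x + y \<in> closure S"
    unfolding closure_sequential using assms
    by (intro exI[of _ "\<lambda>n. a n + b n"]) (auto intro: tendsto_add subspace_add)
next
  fix x c assume "x \<in> closure S"
  then obtain a where "\<And>n. a n \<in> S" "a \<longlonglongrightarrow> x"
    unfolding closure_sequential by metis
  then show "c *\<^sub>R x \<in> closure S"
    unfolding closure_sequential using assms
    by (intro exI[of _ "\<lambda>n. c *\<^sub>R a n"]) (auto intro: tendsto_intros subspace_scale)
qed

lemma dense_if_no_orthogonal_vector:
  fixes S :: "'a::{real_inner, complete_space} set"
  assumes "subspace S" and "\<And>x. (\<And>s. s \<in> S \<Longrightarrow> inner x s = 0) \<Longrightarrow> x = 0"
  shows "closure S = UNIV"
proof -
  have "x \<in> closure S" for x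
  proof -
    obtain y where y: "y \<in> closure S" "\<And>s. s \<in> closure S \<Longrightarrow> inner (x - y) s = 0"
      using orthogonal_decomposition_exists[of "closure S" x] subspace_closure[OF assms(1)] by auto
    then have "x - y = 0" using closure_subset by (intro assms(2)) blast
    then show ?thesis using y by simp
  qed
  then show ?thesis by blast
qed

lemma riesz_real:
  fixes f :: "'a::{real_inner, complete_space} \<Rightarrow> real"
  assumes f: "bounded_linear f"
  shows "\<exists>z. \<forall>x. f x = inner x z"
proof (cases "\<forall>x. f x = 0")
  case True
  then show ?thesis by (intro exI[of _ 0]) simp
next
  case False
  interpret bounded_linear f by (rule f)
  define S where "S = {x. f x = 0}"
  have S: "subspace S" by (auto simp: S_def subspace_def add scaleR zero)
  have "closed S" unfolding S_def
    by (intro closed_Collect_eq continuous_intros continuous_on)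
  obtain v where v: "f v \<noteq> 0" using False by blast
  obtain y where y: "y \<in> S" "\<And>s. s \<in> S \<Longrightarrow> inner (v - y) s = 0"
    using orthogonal_decomposition_exists[OF S \<open>closed S\<close>] by blast
  define w where "w = v - y"
  have fw: "f w = f v" using y by (simp add: w_def diff S_def)
  have w0: "inner w w > 0" using fw v zero by auto
  have "f x = inner x ((f w / inner w w) *\<^sub>R w)" for x
  proof -
    have "f (x - (f x / f w) *\<^sub>R w) = 0" using fw v by (simp add: diff scaleR)
    then have "inner w (x - (f x / f w) *\<^sub>R w) = 0" using y(2) by (simp add: w_def S_def)
    then show ?thesis using w0 fw v by (simp add: inner_diff_right field_simps inner_commute)
  qed
  then show ?thesis by blast
qed

text \<open>A complex-linear functional is determined by its real part: \<open>Im (f x) = - Re (f (\<i> x))\<close>.\<close>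

lemma riesz:
  fixes f :: "'a::chilbert_space \<Rightarrow> complex"
  assumes f: "bounded_linear f" and clinear: "\<And>c x. f (c *\<^sub>C x) = c * f x"
  shows "\<exists>z. \<forall>x. f x = cinner x z"
proof -
  have "bounded_linear (\<lambda>x. Re (f x))" using bounded_linear_compose[OF bounded_linear_Re f] .
  then obtain z where z: "\<And>x. Re (f x) = inner x z" using riesz_real by blast
  have "f x = cinner x z" for x
  proof (rule complex_eqI)
    show "Re (f x) = Re (cinner x z)" by (simp add: z Re_cinner)
    have "Re (f (\<i> *\<^sub>C x)) = Re (cinner (\<i> *\<^sub>C x) z)" by (simp only: z Re_cinner)
    then show "Im (f x) = Im (cinner x z)" by (simp add: clinear cinner_scaleC_left)
  qed
  then show ?thesis by blast
qed

text \<open>An operator prescribed on a total family extends to the whole space as soon as it multiplies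
  all inner products of the family by one constant: the closure of the span of the
  pairs (source, target) is then the graph of the extension.  The creators, which scale inner products
  by \<open>\<parallel>f\<parallel>\<^sup>2\<close>, and the operator \<open>u \<otimes> I\<close> are obtained in this way.\<close>

lemma bounded_extension_from_total_family:
  fixes s :: "'i \<Rightarrow> 'a::real_inner" and g :: "'i \<Rightarrow> 'b::{real_inner, complete_space}"
  assumes total: "closure (span (range s)) = UNIV"
    and inner_g: "\<And>i k. inner (g i) (g k) = C * inner (s i) (s k)" and C: "0 \<le> C"
  shows "\<exists>X :: 'a \<Rightarrow>\<^sub>L 'b. (\<forall>i. X (s i) = g i) \<and> (\<forall>a. norm (X a) = sqrt C * norm a)"
proof -
  define \<Gamma> where "\<Gamma> = span (range (\<lambda>i. (s i, g i)))"
  \<comment> \<open>both sides are bilinear, so it suffices to compare them on the generators\<close>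
  have "inner (snd p) (snd q) = C * inner (fst p) (fst q)" if "p \<in> \<Gamma>" "q \<in> \<Gamma>" for p q
    using that(1) unfolding \<Gamma>_def
  proof (induction p rule: span_induct_alt)
    case base
    show ?case by simp
  next
    case (step c p p')
    then obtain i where p: "p = (s i, g i)" by auto
    have "inner (g i) (snd q) = C * inner (s i) (fst q)"
      using that(2) unfolding \<Gamma>_def
    proof (induction q rule: span_induct_alt)
      case base
      show ?case by simp
    next
      case (step c' q q')
      then show ?case by (auto simp: inner_add_right inner_g algebra_simps)
    qed
    then show ?case using step p by (simp add: inner_add_left algebra_simps)
  qed
  from this[of p p for p] have "(norm (snd p))\<^sup>2 = C * (norm (fst p))\<^sup>2" if "p \<in> \<Gamma>" for p
    using that by (simp add: power2_norm_eq_inner)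
  then have nrm: "norm (snd p) = sqrt C * norm (fst p)" if "p \<in> \<Gamma>" for p
    using that by (metis norm_ge_zero real_sqrt_mult real_sqrt_abs abs_norm_cancel)
  have sub: "subspace \<Gamma>" unfolding \<Gamma>_def by (rule subspace_span)
  have fstG: "fst ` \<Gamma> = span (range s)"
    unfolding \<Gamma>_def
    using linear_span_image[of "fst :: 'a \<times> 'b \<Rightarrow> 'a" "range (\<lambda>i. (s i, g i))"]
    by (simp add: linear_fst image_image)
  have ex: "\<exists>b. (a, b) \<in> closure \<Gamma>" for a
  proof -
    have "a \<in> closure (fst ` \<Gamma>)" using total fstG by simp
    then obtain x where x: "\<And>n. x n \<in> fst ` \<Gamma>" "x \<longlonglongrightarrow> a" unfolding closure_sequential by blast
    then have "\<forall>n. \<exists>q. q \<in> \<Gamma> \<and> x n = fst q" by blast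
    from choice[OF this] obtain p where p: "\<And>n. p n \<in> \<Gamma>" "\<And>n. x n = fst (p n)" by blast
    have cf: "Cauchy (\<lambda>n. fst (p n))" using LIMSEQ_imp_Cauchy[OF x(2)] by (simp flip: p(2))
    have "Cauchy (\<lambda>n. snd (p n))"
    proof (rule CauchyI)
      fix e :: real assume "0 < e"
      have C1: "0 < sqrt C + 1" by (rule add_nonneg_pos) (simp_all add: C)
      then have "0 < e / (sqrt C + 1)" using \<open>0 < e\<close> by (rule divide_pos_pos[rotated])
      then obtain N where N: "\<And>m n. m \<ge> N \<Longrightarrow> n \<ge> N \<Longrightarrow> norm (fst (p m) - fst (p n)) < e / (sqrt C + 1)"
        using cf unfolding Cauchy_iff by blast
      have "norm (snd (p m) - snd (p n)) < e" if "m \<ge> N" "n \<ge> N" for m n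
      proof -
        have "norm (snd (p m) - snd (p n)) = sqrt C * norm (fst (p m) - fst (p n))"
          using nrm[OF subspace_diff[OF sub p(1) p(1)], of m n] by simp
        also have "\<dots> \<le> (sqrt C + 1) * norm (fst (p m) - fst (p n))" by (intro mult_right_mono) auto
        also have "\<dots> < (sqrt C + 1) * (e / (sqrt C + 1))"
          using N[OF that] C1 by (intro mult_strict_left_mono)
        also have "\<dots> = e" using C1 by simp
        finally show ?thesis .
      qed
      then show "\<exists>M. \<forall>m\<ge>M. \<forall>n\<ge>M. norm (snd (p m) - snd (p n)) < e" by blast
    qed
    then obtain b where b: "(\<lambda>n. snd (p n)) \<longlonglongrightarrow> b" by (meson Cauchy_convergent convergent_def)
    have "p \<longlonglongrightarrow> (a, b)" using tendsto_Pair[OF x(2)[unfolded p(2)] b] by simp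
    then show ?thesis using p(1) unfolding closure_sequential by blast
  qed
  have cl: "norm (snd p) = sqrt C * norm (fst p)" if "p \<in> closure \<Gamma>" for p
  proof -
    obtain q where q: "\<And>n. q n \<in> \<Gamma>" "q \<longlonglongrightarrow> p" using \<open>p \<in> closure \<Gamma>\<close> unfolding closure_sequential by blast
    have "(\<lambda>n. norm (snd (q n))) \<longlonglongrightarrow> norm (snd p)" "(\<lambda>n. sqrt C * norm (fst (q n))) \<longlonglongrightarrow> sqrt C * norm (fst p)"
      by (intro tendsto_intros q(2))+
    then show ?thesis using nrm[OF q(1)] LIMSEQ_unique by auto
  qed
  have subc: "subspace (closure \<Gamma>)" by (rule subspace_closure[OF sub])
  obtain X where X: "\<And>a. (a, X a) \<in> closure \<Gamma>" using ex by metis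
  have uniq: "b = X a" if "(a, b) \<in> closure \<Gamma>" for a b
    using cl[OF subspace_diff[OF subc that X[of a]]] by simp
  have "bounded_linear X"
  proof (rule bounded_linear_intro)
    show "X (a + b) = X a + X b" for a b using uniq[of "a + b"] subspace_add[OF subc X[of a] X[of b]] by simp
    show "X (r *\<^sub>R a) = r *\<^sub>R X a" for r a using uniq[of "r *\<^sub>R a"] subspace_scale[OF subc X[of a], of r] by simp
    show "norm (X a) \<le> norm a * sqrt C" for a using cl[OF X[of a]] by (simp add: mult.commute)
  qed
  moreover have "X (s i) = g i" for i
  proof -
    have "(s i, g i) \<in> \<Gamma>" unfolding \<Gamma>_def by (rule span_base) auto
    then have "(s i, g i) \<in> closure \<Gamma>" using closure_subset by blast
    then show ?thesis using uniq by simp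
  qed
  moreover have "norm (X a) = sqrt C * norm a" for a using cl[OF X[of a]] by simp
  ultimately show ?thesis by (intro exI[of _ "Blinfun X"]) (simp add: bounded_linear_Blinfun_apply)
qed

lemma blinfun_eq_on_total_set:
  fixes X Y :: "'a::real_normed_vector \<Rightarrow>\<^sub>L 'b::real_normed_vector"
  assumes total: "closure (span S) = UNIV" and eq: "\<And>s. s \<in> S \<Longrightarrow> X s = Y s"
  shows "X = Y"
proof -
  let ?N = "{v. X v = Y v}"
  have "subspace ?N" by (auto simp: subspace_def blinfun.add_right blinfun.scaleR_right)
  moreover have "closed ?N" by (intro closed_Collect_eq continuous_intros)
  ultimately have "closure (span S) \<subseteq> ?N" using eq by (intro closure_minimal span_minimal) auto
  then show ?thesis using total by (intro blinfun_eqI) auto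
qed

section \<open>Operators\<close>

lemma bounded_operatorsD: "x \<in> bounded_operators \<Longrightarrow> x (c *\<^sub>C v) = c *\<^sub>C x v"
  by (simp add: bounded_operators_def)

lemma op_scaleC_apply [simp]: "op_scaleC c x v = c *\<^sub>C x v"
  unfolding op_scaleC_def
  by (subst bounded_linear_Blinfun_apply)
    (auto intro: bounded_linear_compose[OF scaleC.bounded_linear_right blinfun.bounded_linear_right])

lemma op_adjoint_exists:
  assumes x: "x \<in> bounded_operators"
  shows "\<exists>y :: 'f::chilbert_space \<Rightarrow>\<^sub>L 'f. \<forall>u v. cinner (x u) v = cinner u (y v)"
proof -
  have "\<exists>z. \<forall>u. cinner (x u) v = cinner u z" for v
    by (rule riesz) (auto intro: bounded_linear_compose[OF cinner.bounded_linear_left blinfun.bounded_linear_right]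
        simp: bounded_operatorsD[OF x] cinner_scaleC_left)
  then obtain y where y: "\<And>u v. cinner (x u) v = cinner u (y v)" by metis
  have "bounded_linear y"
  proof (rule bounded_linear_intro)
    show "y (a + b) = y a + y b" for a b
      by (rule cinner_eq_imp_eq) (simp add: cinner_add_right flip: y)
    show "y (r *\<^sub>R a) = r *\<^sub>R y a" for r a
      by (rule cinner_eq_imp_eq) (simp add: cinner.scaleR_right flip: y)
    show "norm (y a) \<le> norm a * norm x" for a
    proof -
      have "(norm (y a))\<^sup>2 = cmod (cinner (x (y a)) a)" by (simp add: y cinner_self norm_power)
      also have "\<dots> \<le> norm (x (y a)) * norm a" by (rule norm_cinner_le)
      also have "\<dots> \<le> (norm x * norm (y a)) * norm a" by (intro mult_right_mono norm_blinfun) auto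
      finally show ?thesis by (cases "y a = 0") (auto simp: power2_eq_square algebra_simps)
    qed
  qed
  then show ?thesis using y by (intro exI[of _ "Blinfun y"]) (simp add: bounded_linear_Blinfun_apply)
qed

lemma op_adjoint_unique:
  fixes x y :: "'f::chilbert_space \<Rightarrow>\<^sub>L 'f"
  assumes "\<And>u v. cinner (x u) v = cinner u (y v)"
  shows "op_adjoint x = y"
  unfolding op_adjoint_def
proof (rule the_equality)
  show "\<forall>u v. cinner (x u) v = cinner u (y v)" using assms by blast
  fix z :: "'f \<Rightarrow>\<^sub>L 'f" assume "\<forall>u v. cinner (x u) v = cinner u (z v)"
  then show "z = y" by (intro blinfun_eqI cinner_eq_imp_eq) (simp flip: assms)
qed

lemma cinner_op_adjoint: "x \<in> bounded_operators \<Longrightarrow> cinner (x u) v = cinner u (op_adjoint x v)"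
proof -
  assume "x \<in> bounded_operators"
  then obtain y :: "'a \<Rightarrow>\<^sub>L 'a" where y: "\<And>u v. cinner (x u) v = cinner u (y v)"
    using op_adjoint_exists by blast
  show ?thesis by (simp add: y op_adjoint_unique[OF y])
qed

lemma cinner_op_adjoint': "x \<in> bounded_operators \<Longrightarrow> cinner (op_adjoint x u) v = cinner u (x v)"
  by (subst (1 2) cinner_commute) (simp add: cinner_op_adjoint)

lemma op_adjoint_bounded_operators: "x \<in> bounded_operators \<Longrightarrow> op_adjoint x \<in> bounded_operators"
proof -
  assume x: "x \<in> bounded_operators"
  have "op_adjoint x (c *\<^sub>C v) = c *\<^sub>C op_adjoint x v" for c v
    by (rule cinner_eq_imp_eq) (simp add: cinner_scaleC_right flip: cinner_op_adjoint[OF x])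
  then show ?thesis by (simp add: bounded_operators_def)
qed

lemma op_adjoint_involution: "x \<in> bounded_operators \<Longrightarrow> op_adjoint (op_adjoint x) = x"
  by (rule op_adjoint_unique) (simp add: cinner_op_adjoint')

lemma bounded_operators_add: "x \<in> bounded_operators \<Longrightarrow> y \<in> bounded_operators \<Longrightarrow> x + y \<in> bounded_operators"
  by (simp add: bounded_operators_def blinfun.add_left scaleC_add_right)

lemma bounded_operators_compose: "x \<in> bounded_operators \<Longrightarrow> y \<in> bounded_operators \<Longrightarrow> x o\<^sub>L y \<in> bounded_operators"
  by (simp add: bounded_operators_def)

lemma bounded_operators_scaleC: "x \<in> bounded_operators \<Longrightarrow> op_scaleC c x \<in> bounded_operators"
  by (simp add: bounded_operators_def scaleC_scaleC mult.commute)

lemma bounded_operators_id: "id_blinfun \<in> bounded_operators"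
  by (simp add: bounded_operators_def)

lemma op_adjoint_add: "x \<in> bounded_operators \<Longrightarrow> y \<in> bounded_operators \<Longrightarrow>
  op_adjoint (x + y) = op_adjoint x + op_adjoint y"
  by (rule op_adjoint_unique) (simp add: blinfun.add_left cinner_add_left cinner_add_right cinner_op_adjoint)

lemma op_adjoint_compose: "x \<in> bounded_operators \<Longrightarrow> y \<in> bounded_operators \<Longrightarrow>
  op_adjoint (x o\<^sub>L y) = op_adjoint y o\<^sub>L op_adjoint x"
  by (rule op_adjoint_unique) (simp add: cinner_op_adjoint)

lemma op_adjoint_scaleC: "x \<in> bounded_operators \<Longrightarrow> op_adjoint (op_scaleC c x) = op_scaleC (cnj c) (op_adjoint x)"
  by (rule op_adjoint_unique) (simp add: cinner_scaleC_left cinner_scaleC_right cinner_op_adjoint)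

lemma op_adjoint_id: "op_adjoint id_blinfun = (id_blinfun :: 'f::chilbert_space \<Rightarrow>\<^sub>L 'f)"
  by (rule op_adjoint_unique) simp

lemma norm_op_adjoint_le: "x \<in> bounded_operators \<Longrightarrow> norm (op_adjoint x) \<le> norm x"
proof (rule norm_blinfun_bound)
  fix v assume x: "x \<in> bounded_operators"
  have "(norm (op_adjoint x v))\<^sup>2 = cmod (cinner (x (op_adjoint x v)) v)"
    by (simp add: cinner_op_adjoint[OF x] cinner_self norm_power)
  also have "\<dots> \<le> norm (x (op_adjoint x v)) * norm v" by (rule norm_cinner_le)
  also have "\<dots> \<le> (norm x * norm (op_adjoint x v)) * norm v" by (intro mult_right_mono norm_blinfun) auto
  finally show "norm (op_adjoint x v) \<le> norm x * norm v"
    by (cases "op_adjoint x v = 0") (auto simp: power2_eq_square algebra_simps)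
qed simp

lemma op_scaleC_of_real: "op_scaleC (of_real r) x = r *\<^sub>R x"
  by (rule blinfun_eqI) (simp add: scaleC_of_real scaleR_blinfun.rep_eq)

lemma op_scaleC_add_right: "op_scaleC c (x + y) = op_scaleC c x + op_scaleC c y"
  by (rule blinfun_eqI) (simp add: scaleC_add_right blinfun.add_left)

lemma op_scaleC_scaleC: "op_scaleC c (op_scaleC d x) = op_scaleC (c * d) x"
  by (rule blinfun_eqI) (simp add: scaleC_scaleC)

lemma norm_op_scaleC_le: "norm (op_scaleC c x) \<le> cmod c * norm x"
  by (rule norm_blinfun_bound)
    (auto simp: norm_scaleC mult.assoc intro!: mult_left_mono norm_blinfun)

lemma bounded_linear_op_scaleC: "bounded_linear (\<lambda>x. op_scaleC c x)"
proof (rule bounded_linear_intro)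
  show "op_scaleC c (r *\<^sub>R x) = r *\<^sub>R op_scaleC c x" for r x
    by (simp add: op_scaleC_scaleC mult.commute flip: op_scaleC_of_real)
  show "norm (op_scaleC c x) \<le> norm x * cmod c" for x
    using norm_op_scaleC_le by (simp add: mult.commute)
qed (rule op_scaleC_add_right)

lemma closed_bounded_operators: "closed (bounded_operators :: ('f::chilbert_space \<Rightarrow>\<^sub>L 'f) set)"
proof -
  have "bounded_operators = (\<Inter>c. \<Inter>v. {x :: 'f \<Rightarrow>\<^sub>L 'f. x (c *\<^sub>C v) = c *\<^sub>C x v})"
    by (auto simp: bounded_operators_def)
  also have "closed \<dots>"
    by (intro closed_INT ballI closed_Collect_eq continuous_intros
        linear_continuous_on[OF bounded_linear_compose[OF scaleC.bounded_linear_right]]) auto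
  finally show ?thesis .
qed

section \<open>States of C*-algebras\<close>

lemma blinfun_compose_assoc: "(x o\<^sub>L y) o\<^sub>L z = x o\<^sub>L (y o\<^sub>L z)"
  by (rule blinfun_eqI) simp

lemma id_blinfun_compose [simp]: "id_blinfun o\<^sub>L x = x" "x o\<^sub>L id_blinfun = x"
  by (auto intro: blinfun_eqI)

lemma
  assumes "unital_cstar_algebra \<AA>"
  shows cstar_bounded: "x \<in> \<AA> \<Longrightarrow> x \<in> bounded_operators"
    and cstar_id: "id_blinfun \<in> \<AA>"
    and cstar_add: "x \<in> \<AA> \<Longrightarrow> y \<in> \<AA> \<Longrightarrow> x + y \<in> \<AA>"
    and cstar_scaleC: "x \<in> \<AA> \<Longrightarrow> op_scaleC c x \<in> \<AA>"
    and cstar_compose: "x \<in> \<AA> \<Longrightarrow> y \<in> \<AA> \<Longrightarrow> x o\<^sub>L y \<in> \<AA>"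
    and cstar_adjoint: "x \<in> \<AA> \<Longrightarrow> op_adjoint x \<in> \<AA>"
    and cstar_closed: "closed \<AA>"
  using assms by (auto simp: unital_cstar_algebra_def)

lemma cstar_scaleR: "unital_cstar_algebra \<AA> \<Longrightarrow> x \<in> \<AA> \<Longrightarrow> r *\<^sub>R x \<in> \<AA>"
  by (simp add: cstar_scaleC flip: op_scaleC_of_real)

lemma cstar_subspace: "unital_cstar_algebra \<AA> \<Longrightarrow> subspace \<AA>"
  using cstar_scaleR[OF _ cstar_id, of \<AA> 0]
  by (auto intro!: subspaceI cstar_add cstar_scaleR)

text \<open>The root is \<open>y = 1 - Y\<close>, where \<open>Y = (h + Y\<^sup>2)/2\<close>.  The right side is a contraction of the set of
  selfadjoint \<open>Y\<close> with \<open>\<parallel>Y\<parallel> \<le> \<rho>\<close>, where \<open>\<rho> < 1\<close> is the smaller solution of \<open>\<rho> = (\<parallel>h\<parallel> + \<rho>\<^sup>2)/2\<close>.\<close>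

lemma one_minus_small_is_square:
  fixes h :: "'f::chilbert_space \<Rightarrow>\<^sub>L 'f"
  assumes \<AA>: "unital_cstar_algebra \<AA>" and h: "h \<in> \<AA>" "op_adjoint h = h" "norm h < 1"
  shows "\<exists>y\<in>\<AA>. op_adjoint y = y \<and> y o\<^sub>L y = id_blinfun - h"
proof -
  interpret comp: bounded_bilinear "(o\<^sub>L) :: ('f \<Rightarrow>\<^sub>L 'f) \<Rightarrow> ('f \<Rightarrow>\<^sub>L 'f) \<Rightarrow> 'f \<Rightarrow>\<^sub>L 'f"
    by (rule bounded_bilinear_blinfun_compose)
  define \<rho> where "\<rho> = 1 - sqrt (1 - norm h)"
  have \<rho>: "0 \<le> \<rho>" "\<rho> < 1" using h(3) by (auto simp: \<rho>_def)
  have \<rho>_eq: "(1/2) * (norm h + \<rho> * \<rho>) = \<rho>"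
  proof -
    have "sqrt (1 - norm h) * sqrt (1 - norm h) = 1 - norm h" using h(3) by simp
    then show ?thesis by (simp add: \<rho>_def algebra_simps)
  qed
  define S where "S = {Y \<in> \<AA>. (\<forall>u v. cinner (Y u) v = cinner u (Y v)) \<and> norm Y \<le> \<rho>}"
  define F where "F Y = (1/2) *\<^sub>R (h + (Y o\<^sub>L Y))" for Y
  have hs: "cinner (h u) v = cinner u (h v)" for u v
    using cinner_op_adjoint[OF cstar_bounded[OF \<AA> h(1)], of u v] h(2) by simp
  have "closed S"
  proof -
    have "S = \<AA> \<inter> (\<Inter>u. \<Inter>v. {Y. cinner (blinfun_apply Y u) v = cinner u (Y v)}) \<inter> {Y. norm Y \<le> \<rho>}"
      by (auto simp: S_def)
    also have "closed \<dots>"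
      by (intro closed_Int cstar_closed[OF \<AA>] closed_INT ballI closed_Collect_eq closed_Collect_le
          continuous_intros cinner.continuous_on)
    finally show ?thesis .
  qed
  then have "uniform_space_class.complete S" by (simp add: complete_eq_closed)
  moreover have "S \<noteq> {}"
    using \<rho>(1) subspace_0[OF cstar_subspace[OF \<AA>]] by (auto simp: S_def cinner.zero_left cinner.zero_right)
  moreover have "F ` S \<subseteq> S"
  proof (intro image_subsetI)
    fix Y assume Y: "Y \<in> S"
    have "norm (F Y) \<le> (1/2) * (norm h + norm (Y o\<^sub>L Y))"
      unfolding F_def by (simp add: norm_triangle_ineq)
    also have "\<dots> \<le> (1/2) * (norm h + \<rho> * \<rho>)"
      using Y \<rho> by (intro mult_left_mono add_left_mono order_trans[OF norm_blinfun_compose] mult_mono) (auto simp: S_def)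
    finally have "norm (F Y) \<le> \<rho>" by (simp only: \<rho>_eq)
    moreover have "F Y \<in> \<AA>"
      using Y by (auto simp: F_def S_def intro!: cstar_scaleR[OF \<AA>] cstar_add[OF \<AA>] cstar_compose[OF \<AA>] h)
    moreover have "cinner (F Y u) v = cinner u (F Y v)" for u v
      using Y by (auto simp: F_def S_def blinfun.add_left blinfun.scaleR_left cinner.scaleR_left cinner.scaleR_right
        cinner_add_left cinner_add_right hs)
    ultimately show "F Y \<in> S" by (auto simp: S_def)
  qed
  moreover have "dist (F Y) (F Z) \<le> \<rho> * dist Y Z" if "Y \<in> S" "Z \<in> S" for Y Z
  proof -
    have "F Y - F Z = (1/2) *\<^sub>R (((Y - Z) o\<^sub>L Y) + (Z o\<^sub>L (Y - Z)))"
      by (simp add: F_def comp.diff_left comp.diff_right flip: scaleR_diff_right)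
    then have "norm (F Y - F Z) = (1/2) * norm (((Y - Z) o\<^sub>L Y) + (Z o\<^sub>L (Y - Z)))" by simp
    also have "\<dots> \<le> (1/2) * (norm (Y - Z) * \<rho> + \<rho> * norm (Y - Z))"
      using that \<rho>
      by (intro mult_left_mono order_trans[OF norm_triangle_ineq] add_mono order_trans[OF norm_blinfun_compose] mult_mono)
         (auto simp: S_def)
    finally show ?thesis by (simp add: dist_norm)
  qed
  ultimately have "\<exists>!Y\<in>S. F Y = Y" by (intro Banach_fix[OF _ _ \<rho>]) auto
  then obtain Y where Y: "Y \<in> S" "F Y = Y" by blast
  have "2 *\<^sub>R F Y = h + (Y o\<^sub>L Y)" by (simp add: F_def)
  then have "h + (Y o\<^sub>L Y) = 2 *\<^sub>R Y" by (simp add: Y(2))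
  then have YY: "Y o\<^sub>L Y = Y + Y - h" by (simp add: scaleR_2 algebra_simps)
  have sq: "(id_blinfun - Y) o\<^sub>L (id_blinfun - Y) = id_blinfun - h"
    by (simp add: comp.diff_left comp.diff_right YY algebra_simps)
  have "id_blinfun - Y \<in> \<AA>" using Y subspace_diff[OF cstar_subspace[OF \<AA>] cstar_id[OF \<AA>]] by (auto simp: S_def)
  moreover have "op_adjoint (id_blinfun - Y) = id_blinfun - Y"
    using Y by (intro op_adjoint_unique) (auto simp: S_def blinfun.diff_left cinner.diff_left cinner.diff_right)
  ultimately show ?thesis using sq by blast
qed

lemma
  assumes "\<phi> \<in> states \<AA>"
  shows state_add: "x \<in> \<AA> \<Longrightarrow> y \<in> \<AA> \<Longrightarrow> \<phi> (x + y) = \<phi> x + \<phi> y"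
    and state_scaleC: "x \<in> \<AA> \<Longrightarrow> \<phi> (op_scaleC c x) = c * \<phi> x"
    and state_nonneg: "x \<in> \<AA> \<Longrightarrow> \<phi> (op_adjoint x o\<^sub>L x) \<in> \<real>\<^sub>\<ge>\<^sub>0"
    and state_id: "\<phi> id_blinfun = 1"
  using assms by (auto simp: states_def)

text \<open>The positivity of \<open>\<phi>((x + c)\<^sup>* (x + c))\<close>.  The values \<open>c = 1\<close> and \<open>c = \<i>\<close> show that \<open>\<phi>\<close> is hermitian, and
  \<open>c = - \<phi>(x)\<close> gives the Cauchy-Schwarz inequality.\<close>

lemma state_shift_nonneg:
  fixes \<AA> :: "('f::chilbert_space \<Rightarrow>\<^sub>L 'f) set"
  assumes \<AA>: "unital_cstar_algebra \<AA>" and \<phi>: "\<phi> \<in> states \<AA>" and x: "x \<in> \<AA>"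
  shows "\<phi> (op_adjoint x o\<^sub>L x) + c * \<phi> (op_adjoint x) + cnj c * \<phi> x + c * cnj c \<in> \<real>\<^sub>\<ge>\<^sub>0"
proof -
  define z where "z = x + op_scaleC c id_blinfun"
  have xb: "x \<in> bounded_operators" using cstar_bounded[OF \<AA> x] .
  have z: "z \<in> \<AA>" unfolding z_def by (intro cstar_add cstar_scaleC cstar_id \<AA> x)
  have az: "op_adjoint z = op_adjoint x + op_scaleC (cnj c) id_blinfun"
    unfolding z_def by (simp add: op_adjoint_add op_adjoint_scaleC xb bounded_operators_id bounded_operators_scaleC op_adjoint_id)
  have "op_adjoint z o\<^sub>L z = ((op_adjoint x o\<^sub>L x) + op_scaleC c (op_adjoint x))
      + (op_scaleC (cnj c) x + op_scaleC (c * cnj c) id_blinfun)"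
    unfolding az unfolding z_def
    by (intro blinfun_eqI)
      (simp add: blinfun.add_left blinfun.add_right scaleC_add_right scaleC_scaleC mult.commute
        bounded_operatorsD[OF op_adjoint_bounded_operators[OF xb]])
  then have "\<phi> (op_adjoint z o\<^sub>L z) = \<phi> (op_adjoint x o\<^sub>L x) + c * \<phi> (op_adjoint x) + (cnj c * \<phi> x + c * cnj c * \<phi> id_blinfun)"
    using x \<AA> by (simp add: state_add[OF \<phi>] state_scaleC[OF \<phi>] cstar_add cstar_scaleC cstar_id cstar_compose cstar_adjoint)
  then show ?thesis using state_nonneg[OF \<phi> z] by (simp add: state_id[OF \<phi>] add.assoc)
qed

lemma state_adjoint:
  assumes \<AA>: "unital_cstar_algebra \<AA>" and \<phi>: "\<phi> \<in> states \<AA>" and x: "x \<in> \<AA>"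
  shows "\<phi> (op_adjoint x) = cnj (\<phi> x)"
proof -
  have "Im (\<phi> (op_adjoint x o\<^sub>L x)) = 0"
    using state_nonneg[OF \<phi> x] by (simp add: complex_nonneg_Reals_iff)
  then show ?thesis
    using state_shift_nonneg[OF \<AA> \<phi> x, of 1] state_shift_nonneg[OF \<AA> \<phi> x, of \<i>]
    by (auto simp: complex_nonneg_Reals_iff complex_eq_iff)
qed

lemma state_cauchy_schwarz:
  assumes \<AA>: "unital_cstar_algebra \<AA>" and \<phi>: "\<phi> \<in> states \<AA>" and x: "x \<in> \<AA>"
  shows "(cmod (\<phi> x))\<^sup>2 \<le> Re (\<phi> (op_adjoint x o\<^sub>L x))"
proof -
  have "\<phi> (op_adjoint x o\<^sub>L x) - \<phi> x * cnj (\<phi> x) \<in> \<real>\<^sub>\<ge>\<^sub>0"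
    using state_shift_nonneg[OF \<AA> \<phi> x, of "- \<phi> x"] by (simp add: state_adjoint[OF \<AA> \<phi> x] algebra_simps)
  then show ?thesis
    by (simp add: complex_nonneg_Reals_iff complex_mult_cnj cmod_power2)
qed

lemma norm_adjoint_compose_le: "x \<in> bounded_operators \<Longrightarrow> norm (op_adjoint x o\<^sub>L x) \<le> (norm x)\<^sup>2"
  unfolding power2_eq_square
  by (intro order_trans[OF norm_blinfun_compose] mult_right_mono norm_op_adjoint_le) auto

text \<open>Positivity is only known on elements of the form \<open>y\<^sup>* y\<close>; it yields a bound because
  \<open>c 1 - x\<^sup>* x\<close> is of this form whenever \<open>c\<close> exceeds \<open>\<parallel>x\<parallel>\<^sup>2\<close>.\<close>

lemma state_norm_le:
  assumes \<AA>: "unital_cstar_algebra \<AA>" and \<phi>: "\<phi> \<in> states \<AA>" and x: "x \<in> \<AA>"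
  shows "cmod (\<phi> x) \<le> norm x"
proof -
  let ?p = "op_adjoint x o\<^sub>L x"
  have xb: "x \<in> bounded_operators" using cstar_bounded[OF \<AA> x] .
  have p: "?p \<in> \<AA>" "op_adjoint ?p = ?p"
    by (auto simp: op_adjoint_compose op_adjoint_bounded_operators op_adjoint_involution xb intro!: cstar_compose cstar_adjoint \<AA> x)
  have "Re (\<phi> ?p) \<le> (norm x)\<^sup>2"
  proof (rule field_le_epsilon)
    fix e :: real assume e: "0 < e"
    define c where "c = (norm x)\<^sup>2 + e"
    have c: "0 < c" using e by (simp add: c_def add_nonneg_pos)
    let ?h = "op_scaleC (of_real (1 / c)) ?p"
    have "norm ?h \<le> (1 / c) * norm ?p" using norm_op_scaleC_le[of "of_real (1 / c)" ?p] c by (simp add: norm_divide)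
    also have "\<dots> \<le> (1 / c) * (norm x)\<^sup>2" using c norm_adjoint_compose_le[OF xb] by (intro mult_left_mono) auto
    also have "\<dots> < 1" using c e by (simp add: field_simps c_def)
    finally have hn: "norm ?h < 1" .
    have h: "?h \<in> \<AA>" by (intro cstar_scaleC \<AA> p)
    have ha: "op_adjoint ?h = ?h"
      using op_adjoint_scaleC[OF cstar_bounded[OF \<AA> p(1)], of "of_real (1 / c)"] p(2) by simp
    obtain y where y: "y \<in> \<AA>" "op_adjoint y = y" "y o\<^sub>L y = id_blinfun - ?h"
      using one_minus_small_is_square[OF \<AA> h ha hn] by blast
    have "(y o\<^sub>L y) + ?h = id_blinfun" by (simp add: y(3))
    then have "\<phi> (y o\<^sub>L y) + \<phi> ?h = 1"
      using state_add[OF \<phi> cstar_compose[OF \<AA> y(1) y(1)] h] state_id[OF \<phi>] by simp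
    moreover have "0 \<le> Re (\<phi> (y o\<^sub>L y))"
      using state_nonneg[OF \<phi> y(1)] by (simp add: y(2) complex_nonneg_Reals_iff)
    moreover have "\<phi> ?h = of_real (1 / c) * \<phi> ?p" by (rule state_scaleC[OF \<phi> p(1)])
    ultimately have "Re (\<phi> (y o\<^sub>L y)) + Re (of_real (1 / c) * \<phi> ?p) = 1" "0 \<le> Re (\<phi> (y o\<^sub>L y))"
      by (metis plus_complex.sel(1) one_complex.sel(1))+
    then have "(1 / c) * Re (\<phi> ?p) \<le> 1" by simp
    then show "Re (\<phi> ?p) \<le> (norm x)\<^sup>2 + e" using c by (simp add: field_simps c_def)
  qed
  then have "(cmod (\<phi> x))\<^sup>2 \<le> (norm x)\<^sup>2" using state_cauchy_schwarz[OF \<AA> \<phi> x] by linarith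
  then show ?thesis by (rule power2_le_imp_le) simp
qed

lemma state_diff:
  assumes \<AA>: "unital_cstar_algebra \<AA>" and \<phi>: "\<phi> \<in> states \<AA>" and x: "x \<in> \<AA>" "y \<in> \<AA>"
  shows "\<phi> (x - y) = \<phi> x - \<phi> y"
proof -
  have "x - y \<in> \<AA>" by (rule subspace_diff[OF cstar_subspace[OF \<AA>] x])
  from state_add[OF \<phi> this x(2)] show ?thesis by simp
qed

lemma vector_state:
  assumes \<AA>: "unital_cstar_algebra \<AA>" and v: "norm v = 1"
  shows "(\<lambda>x. cinner (blinfun_apply x v) v) \<in> states \<AA>"
proof -
  have "cinner ((op_adjoint x o\<^sub>L x) v) v \<in> \<real>\<^sub>\<ge>\<^sub>0" if "x \<in> \<AA>" for x
    by (simp add: cinner_op_adjoint' cstar_bounded[OF \<AA> that] cinner_self complex_nonneg_Reals_iff)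
  then show ?thesis
    by (auto simp: states_def blinfun.add_left cinner_add_left cinner_scaleC_left cinner_self v)
qed

lemma
  assumes "automorphism \<AA> \<alpha>"
  shows automorphism_mem: "x \<in> \<AA> \<Longrightarrow> \<alpha> x \<in> \<AA>"
    and automorphism_add: "x \<in> \<AA> \<Longrightarrow> y \<in> \<AA> \<Longrightarrow> \<alpha> (x + y) = \<alpha> x + \<alpha> y"
    and automorphism_scaleC: "x \<in> \<AA> \<Longrightarrow> \<alpha> (op_scaleC c x) = op_scaleC c (\<alpha> x)"
    and automorphism_compose: "x \<in> \<AA> \<Longrightarrow> y \<in> \<AA> \<Longrightarrow> \<alpha> (x o\<^sub>L y) = \<alpha> x o\<^sub>L \<alpha> y"
    and automorphism_adjoint: "x \<in> \<AA> \<Longrightarrow> \<alpha> (op_adjoint x) = op_adjoint (\<alpha> x)"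
  using assms by (auto simp: automorphism_def linear_on_algebra_def bij_betw_def)

lemma automorphism_id:
  assumes \<AA>: "unital_cstar_algebra \<AA>" and \<alpha>: "automorphism \<AA> \<alpha>"
  shows "\<alpha> id_blinfun = id_blinfun"
proof -
  obtain e where e: "e \<in> \<AA>" "\<alpha> e = id_blinfun"
    using \<alpha> cstar_id[OF \<AA>] unfolding automorphism_def bij_betw_def by (metis imageE)
  show ?thesis using automorphism_compose[OF \<alpha> e(1) cstar_id[OF \<AA>]] e(2) by simp
qed

text \<open>The composition of \<open>\<alpha>\<close> with the vector state of \<open>v\<close> is a state, whose value at \<open>x\<^sup>* x\<close> is
  \<open>\<parallel>\<alpha>(x) v\<parallel>\<^sup>2\<close>.\<close>

lemma automorphism_norm_le:
  fixes \<AA> :: "('f::chilbert_space \<Rightarrow>\<^sub>L 'f) set"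
  assumes \<AA>: "unital_cstar_algebra \<AA>" and \<alpha>: "automorphism \<AA> \<alpha>" and x: "x \<in> \<AA>"
  shows "norm (\<alpha> x) \<le> norm x"
proof (rule norm_blinfun_bound)
  fix v :: 'f
  have unit: "norm (\<alpha> x v) \<le> norm x" if v: "norm v = 1" for v
  proof -
    let ?\<phi> = "\<lambda>x. cinner (blinfun_apply (\<alpha> x) v) v"
    note vs = vector_state[OF \<AA> v]
    have "?\<phi> \<in> states \<AA>"
      unfolding states_def mem_Collect_eq
    proof (intro conjI ballI allI)
      show "?\<phi> (op_adjoint x o\<^sub>L x) \<in> \<real>\<^sub>\<ge>\<^sub>0" if "x \<in> \<AA>" for x
        using state_nonneg[OF vs automorphism_mem[OF \<alpha> that]]
        by (simp add: automorphism_compose[OF \<alpha>] automorphism_adjoint[OF \<alpha>] that cstar_adjoint[OF \<AA>])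
    qed (simp_all add: automorphism_add[OF \<alpha>] automorphism_scaleC[OF \<alpha>] automorphism_id[OF \<AA> \<alpha>]
        blinfun.add_left cinner_add_left cinner_scaleC_left cinner_self v)
    from state_norm_le[OF \<AA> this cstar_compose[OF \<AA> cstar_adjoint[OF \<AA> x] x]]
    have "cmod (?\<phi> (op_adjoint x o\<^sub>L x)) \<le> (norm x)\<^sup>2"
      using norm_adjoint_compose_le[OF cstar_bounded[OF \<AA> x]] by linarith
    moreover have "?\<phi> (op_adjoint x o\<^sub>L x) = of_real ((norm (\<alpha> x v))\<^sup>2)"
      by (simp add: automorphism_compose[OF \<alpha>] automorphism_adjoint[OF \<alpha>] x cstar_adjoint[OF \<AA>]
          cinner_op_adjoint' cstar_bounded[OF \<AA> automorphism_mem[OF \<alpha> x]] cinner_self)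
    ultimately have "(norm (\<alpha> x v))\<^sup>2 \<le> (norm x)\<^sup>2" by (simp add: norm_power)
    then show ?thesis by (rule power2_le_imp_le) simp
  qed
  show "norm (\<alpha> x v) \<le> norm x * norm v"
  proof (cases "v = 0")
    case False
    have "norm (\<alpha> x (inverse (norm v) *\<^sub>R v)) \<le> norm x" using False by (intro unit) simp
    then show ?thesis using False by (simp add: blinfun.scaleR_right field_simps)
  qed simp
qed simp

section \<open>Generated C*-algebras\<close>

lemma unital_cstar_bounded_operators: "unital_cstar_algebra bounded_operators"
  unfolding unital_cstar_algebra_def
  by (auto simp: bounded_operators_id bounded_operators_add bounded_operators_scaleC bounded_operators_compose
      op_adjoint_bounded_operators closed_bounded_operators)

lemma
  assumes "S \<subseteq> bounded_operators"
  shows generated_cstar_algebra_unital: "unital_cstar_algebra (generated_cstar_algebra S)"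
    and generated_cstar_algebra_base: "S \<subseteq> generated_cstar_algebra S"
proof -
  have "generated_cstar_algebra S \<subseteq> bounded_operators"
    unfolding generated_cstar_algebra_def using assms unital_cstar_bounded_operators by blast
  then show "unital_cstar_algebra (generated_cstar_algebra S)"
    unfolding unital_cstar_algebra_def
    by (auto simp: generated_cstar_algebra_def intro!: closed_Inter
        intro: cstar_id cstar_add cstar_scaleC cstar_compose cstar_adjoint cstar_closed)
  show "S \<subseteq> generated_cstar_algebra S" by (auto simp: generated_cstar_algebra_def)
qed

text \<open>Since generators enter on the left only, induction over this set never meets a product
  of two general elements.\<close>

inductive_set operator_polynomials :: "('f::chilbert_space \<Rightarrow>\<^sub>L 'f) set \<Rightarrow> ('f \<Rightarrow>\<^sub>L 'f) set" for S where
  id: "id_blinfun \<in> operator_polynomials S"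
| left_mult: "s \<in> S \<Longrightarrow> x \<in> operator_polynomials S \<Longrightarrow> s o\<^sub>L x \<in> operator_polynomials S"
| add: "x \<in> operator_polynomials S \<Longrightarrow> y \<in> operator_polynomials S \<Longrightarrow> x + y \<in> operator_polynomials S"
| scaleC: "x \<in> operator_polynomials S \<Longrightarrow> op_scaleC c x \<in> operator_polynomials S"

lemma operator_polynomials_compose:
  "x \<in> operator_polynomials S \<Longrightarrow> y \<in> operator_polynomials S \<Longrightarrow> x o\<^sub>L y \<in> operator_polynomials S"
proof (induction x rule: operator_polynomials.induct)
  case (add x z)
  then show ?case
    by (simp add: bounded_bilinear.add_left[OF bounded_bilinear_blinfun_compose] operator_polynomials.add)
next
  case (scaleC x c)
  have "op_scaleC c x o\<^sub>L y = op_scaleC c (x o\<^sub>L y)" by (rule blinfun_eqI) simp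
  then show ?case using scaleC by (simp add: operator_polynomials.scaleC)
qed (simp_all add: blinfun_compose_assoc operator_polynomials.left_mult)

lemma operator_polynomials_adjoint:
  assumes S: "S \<subseteq> bounded_operators" and adj: "\<And>x. x \<in> S \<Longrightarrow> op_adjoint x = x"
    and x: "x \<in> operator_polynomials S"
  shows "x \<in> bounded_operators" "op_adjoint x \<in> operator_polynomials S"
proof -
  have "x \<in> bounded_operators \<and> op_adjoint x \<in> operator_polynomials S"
    using x
  proof induction
    case (left_mult s x)
    have "s o\<^sub>L id_blinfun \<in> operator_polynomials S"
      by (intro operator_polynomials.left_mult operator_polynomials.id left_mult)
    then have "op_adjoint x o\<^sub>L s \<in> operator_polynomials S"
      using operator_polynomials_compose[of "op_adjoint x" S s] left_mult by simp
    moreover have "s \<in> bounded_operators" using left_mult S by blast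
    ultimately show ?case
      using left_mult by (simp add: bounded_operators_compose op_adjoint_compose adj)
  qed (auto simp: op_adjoint_id op_adjoint_add op_adjoint_scaleC bounded_operators_id bounded_operators_add
      bounded_operators_scaleC intro: operator_polynomials.intros)
  then show "x \<in> bounded_operators" "op_adjoint x \<in> operator_polynomials S" by auto
qed

text \<open>The closure of the polynomials is itself a C*-algebra containing \<open>S\<close>.\<close>

lemma generated_cstar_algebra_subset_closure:
  fixes S :: "('f::chilbert_space \<Rightarrow>\<^sub>L 'f) set"
  assumes S: "S \<subseteq> bounded_operators" and adj: "\<And>x. x \<in> S \<Longrightarrow> op_adjoint x = x"
  shows "generated_cstar_algebra S \<subseteq> closure (operator_polynomials S)"
proof -
  define P where "P = operator_polynomials S"
  interpret comp: bounded_bilinear "(o\<^sub>L) :: ('f \<Rightarrow>\<^sub>L 'f) \<Rightarrow> ('f \<Rightarrow>\<^sub>L 'f) \<Rightarrow> 'f \<Rightarrow>\<^sub>L 'f"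
    by (rule bounded_bilinear_blinfun_compose)
  note P_scaleC = operator_polynomials.scaleC[of _ S, folded P_def]
  note P_comp = operator_polynomials_compose[of _ S, folded P_def]
  have P_adj: "op_adjoint x \<in> P" if "x \<in> P" for x
    using operator_polynomials_adjoint(2)[OF S adj] that unfolding P_def by blast
  have P_bd: "P \<subseteq> bounded_operators" using operator_polynomials_adjoint(1)[OF S adj] by (auto simp: P_def)
  then have cP_bd: "closure P \<subseteq> bounded_operators" by (intro closure_minimal closed_bounded_operators)
  have sub: "subspace P"
  proof (rule subspaceI)
    show "0 \<in> P"
      using P_scaleC[OF operator_polynomials.id[of S, folded P_def], of 0] op_scaleC_of_real[of 0 "id_blinfun :: 'f \<Rightarrow>\<^sub>L 'f"] by simp
    show "r *\<^sub>R x \<in> P" if "x \<in> P" for r x using P_scaleC[OF that, of "of_real r"] by (simp add: op_scaleC_of_real)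
  qed (simp add: P_def operator_polynomials.add)
  have "unital_cstar_algebra (closure P)"
    unfolding unital_cstar_algebra_def
  proof (intro conjI ballI allI)
    show "id_blinfun \<in> closure P"
      using operator_polynomials.id[of S] closure_subset unfolding P_def by blast
    show "x + y \<in> closure P" if "x \<in> closure P" "y \<in> closure P" for x y
      using that by (rule subspace_add[OF subspace_closure[OF sub]])
    show "op_scaleC c x \<in> closure P" if "x \<in> closure P" for c x
    proof -
      have "(\<lambda>x. op_scaleC c x) ` closure P \<subseteq> closure P"
        using P_scaleC closure_subset
        by (intro image_closure_subset linear_continuous_on bounded_linear_op_scaleC) auto
      then show ?thesis using that by blast
    qed
    show "x o\<^sub>L y \<in> closure P" if "x \<in> closure P" "y \<in> closure P" for x y
    proof -
      have *: "x o\<^sub>L y \<in> closure P" if "x \<in> P" "y \<in> closure P" for x y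
      proof -
        have "(\<lambda>y. x o\<^sub>L y) ` closure P \<subseteq> closure P"
          using P_comp \<open>x \<in> P\<close> closure_subset
          by (intro image_closure_subset linear_continuous_on comp.bounded_linear_right) auto
        then show ?thesis using that by blast
      qed
      have "(\<lambda>x. x o\<^sub>L y) ` closure P \<subseteq> closure P"
        using * \<open>y \<in> closure P\<close>
        by (intro image_closure_subset linear_continuous_on comp.bounded_linear_left) auto
      then show ?thesis using that by blast
    qed
    show "op_adjoint x \<in> closure P" if "x \<in> closure P" for x
    proof -
      obtain p where p: "\<And>n. p n \<in> P" "p \<longlonglongrightarrow> x" using \<open>x \<in> closure P\<close> unfolding closure_sequential by blast
      have xb: "x \<in> bounded_operators" using that cP_bd by blast
      have "norm (op_adjoint (p n) - op_adjoint x) \<le> norm (p n - x)" for n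
      proof -
        have pb: "p n \<in> bounded_operators" using p(1) P_bd by blast
        have mb: "op_scaleC (-1) x \<in> bounded_operators" by (rule bounded_operators_scaleC[OF xb])
        have "op_scaleC (-1) y = - y" for y :: "'f \<Rightarrow>\<^sub>L 'f"
          using op_scaleC_of_real[of "-1" y] by simp
        then have "op_adjoint (p n - x) = op_adjoint (p n) - op_adjoint x"
          using op_adjoint_add[OF pb mb] op_adjoint_scaleC[OF xb, of "-1"] by simp
        moreover have "p n - x \<in> bounded_operators"
          using subspace_diff[OF cstar_subspace[OF unital_cstar_bounded_operators] pb xb] .
        ultimately show ?thesis using norm_op_adjoint_le by metis
      qed
      moreover have "(\<lambda>n. norm (p n - x)) \<longlonglongrightarrow> 0" using p(2) by (simp add: LIM_zero tendsto_norm_zero)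
      ultimately have "(\<lambda>n. op_adjoint (p n) - op_adjoint x) \<longlonglongrightarrow> 0"
        by (rule Lim_null_comparison[OF always_eventually[OF allI]])
      then have "(\<lambda>n. op_adjoint (p n)) \<longlonglongrightarrow> op_adjoint x" by (rule LIM_zero_cancel)
      then show ?thesis using P_adj[OF p(1)] unfolding closure_sequential
        by (intro exI[of _ "\<lambda>n. op_adjoint (p n)"]) auto
    qed
  qed (use cP_bd in auto)
  moreover have "S \<subseteq> closure P"
  proof
    fix x assume "x \<in> S"
    then have "x \<in> P"
      using operator_polynomials.left_mult[OF _ operator_polynomials.id, of x S] by (simp add: P_def)
    then show "x \<in> closure P" using closure_subset by blast
  qed
  ultimately show ?thesis unfolding generated_cstar_algebra_def P_def by blast
qed

section \<open>Sequences that vanish in mean\<close>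

definition mean_null :: "(nat \<Rightarrow> 'v::real_normed_vector) \<Rightarrow> bool" where
  "mean_null a \<longleftrightarrow> (\<lambda>N. (\<Sum>k<N. norm (a k)) / real N) \<longlonglongrightarrow> 0"

lemma mean_null_scale:
  assumes a: "mean_null a" and le: "\<And>k. norm (b k) \<le> C * norm (a k)"
  shows "mean_null b"
proof -
  have "(\<lambda>N. C * ((\<Sum>k<N. norm (a k)) / real N)) \<longlonglongrightarrow> C * 0"
    by (intro tendsto_mult tendsto_const a[unfolded mean_null_def])
  then have lim: "(\<lambda>N. (\<Sum>k<N. C * norm (a k)) / real N) \<longlonglongrightarrow> 0" by (simp add: sum_distrib_left)
  show ?thesis unfolding mean_null_def
    by (rule tendsto_sandwich[OF _ _ tendsto_const lim])
      (auto intro!: always_eventually divide_right_mono sum_mono sum_nonneg divide_nonneg_nonneg le)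
qed

lemma mean_null_dominated:
  assumes a: "mean_null a" and le: "\<And>k. norm (b k) \<le> norm (a k)"
  shows "mean_null b"
  by (rule mean_null_scale[OF a, of _ 1]) (simp add: le)

lemma mean_null_add:
  assumes "mean_null a" "mean_null b"
  shows "mean_null (\<lambda>k. a k + b k)"
proof -
  have "(\<lambda>N. (\<Sum>k<N. norm (a k)) / real N + (\<Sum>k<N. norm (b k)) / real N) \<longlonglongrightarrow> 0 + 0"
    using assms unfolding mean_null_def by (rule tendsto_add)
  then have "mean_null (\<lambda>k. norm (a k) + norm (b k))"
    by (simp add: mean_null_def sum.distrib add_divide_distrib)
  then show ?thesis by (rule mean_null_dominated) (simp add: norm_triangle_ineq)
qed

lemma mean_null_zero [simp]: "mean_null (\<lambda>k. 0)"
  by (simp add: mean_null_def)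

lemma mean_null_uniform_limit:
  assumes "\<And>e. 0 < e \<Longrightarrow> \<exists>b :: nat \<Rightarrow> real. mean_null b \<and> (\<forall>k. norm (a k) \<le> norm (b k) + e)"
  shows "mean_null a"
  unfolding mean_null_def
proof (rule LIMSEQ_I)
  fix e :: real assume e: "0 < e"
  obtain b :: "nat \<Rightarrow> real" where b: "mean_null b" "\<And>k. norm (a k) \<le> norm (b k) + e / 2" using assms[of "e / 2"] e by auto
  have "\<forall>\<^sub>F N in sequentially. (\<Sum>k<N. norm (b k)) / real N < e / 2"
    using b(1) e unfolding mean_null_def by (intro order_tendstoD(2)) auto
  then obtain N0 where N0: "\<And>N. N \<ge> N0 \<Longrightarrow> (\<Sum>k<N. norm (b k)) / real N < e / 2"
    by (auto simp: eventually_sequentially)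
  have "norm ((\<Sum>k<N. norm (a k)) / real N - 0) < e" if N: "N \<ge> N0" for N
  proof -
    have "(\<Sum>k<N. norm (a k)) / real N \<le> (\<Sum>k<N. norm (b k) + e / 2) / real N"
      by (intro divide_right_mono sum_mono b) auto
    also have "\<dots> = (\<Sum>k<N. norm (b k)) / real N + (real N * (e / 2)) / real N"
      by (simp add: sum.distrib add_divide_distrib)
    also have "\<dots> \<le> (\<Sum>k<N. norm (b k)) / real N + e / 2" using e by (cases "N = 0") auto
    also have "\<dots> < e" using N0[OF N] by linarith
    finally show ?thesis by (simp add: sum_nonneg abs_of_nonneg)
  qed
  then show "\<exists>no. \<forall>n\<ge>no. norm ((\<Sum>k<n. norm (a k)) / real n - 0) < e" by blast
qed

lemma mean_null_if_tendsto_0: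
  assumes a: "a \<longlonglongrightarrow> 0" shows "mean_null a"
proof (rule mean_null_uniform_limit)
  fix e :: real assume "0 < e"
  then obtain n where n: "\<And>k. k \<ge> n \<Longrightarrow> norm (a k) < e" using LIMSEQ_D[OF a] by auto
  define b where "b k = (if k < n then norm (a k) else 0)" for k
  have "(\<Sum>k<N. norm (b k)) \<le> (\<Sum>k<n. norm (a k))" for N
  proof -
    have "(\<Sum>k<N. norm (b k)) = (\<Sum>k\<in>{..<N} \<inter> {..<n}. norm (a k))"
      by (rule sum.mono_neutral_cong_right) (auto simp: b_def)
    also have "\<dots> \<le> (\<Sum>k<n. norm (a k))" by (rule sum_mono2) auto
    finally show ?thesis .
  qed
  then have "norm ((\<Sum>k<N. norm (b k)) / real N) \<le> (\<Sum>k<n. norm (a k)) / real N" for N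
    by (auto simp: sum_nonneg divide_right_mono)
  moreover have "(\<lambda>N. (\<Sum>k<n. norm (a k)) / real N) \<longlonglongrightarrow> 0"
    using lim_const_over_n by blast
  ultimately have "mean_null b" unfolding mean_null_def
    by (rule Lim_null_comparison[OF always_eventually[OF allI]])
  moreover have "\<forall>k. norm (a k) \<le> norm (b k) + e" using n \<open>0 < e\<close> by (auto simp: b_def not_less less_imp_le)
  ultimately show "\<exists>b :: nat \<Rightarrow> real. mean_null b \<and> (\<forall>k. norm (a k) \<le> norm (b k) + e)" by blast
qed

lemma mean_null_imp_tendsto_0:
  assumes a: "mean_null a" shows "(\<lambda>N. (1 / real N) *\<^sub>R (\<Sum>k<N. a k)) \<longlonglongrightarrow> 0"
proof (rule Lim_null_comparison[OF always_eventually[OF allI]])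
  show "(\<lambda>N. (\<Sum>k<N. norm (a k)) / real N) \<longlonglongrightarrow> 0" using a by (simp add: mean_null_def)
  show "norm ((1 / real N) *\<^sub>R (\<Sum>k<N. a k)) \<le> (\<Sum>k<N. norm (a k)) / real N" for N
    by (simp add: divide_right_mono norm_sum)
qed

text \<open>Mixing is thus reduced to vanishing in mean along subsequences, so that the arguments
  about linear combinations and limits are carried out for means only.\<close>

lemma tendsto_0_iff_mean_null_subseq:
  fixes a :: "nat \<Rightarrow> 'v::real_normed_vector"
  shows "a \<longlonglongrightarrow> 0 \<longleftrightarrow> (\<forall>r :: nat \<Rightarrow> nat. strict_mono r \<longrightarrow> mean_null (\<lambda>k. a (r k)))"
proof
  assume "a \<longlonglongrightarrow> 0"
  then show "\<forall>r :: nat \<Rightarrow> nat. strict_mono r \<longrightarrow> mean_null (\<lambda>k. a (r k))"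
    by (auto intro!: mean_null_if_tendsto_0 simp: LIMSEQ_subseq_LIMSEQ[unfolded o_def])
next
  assume *: "\<forall>r :: nat \<Rightarrow> nat. strict_mono r \<longrightarrow> mean_null (\<lambda>k. a (r k))"
  show "a \<longlonglongrightarrow> 0"
  proof (rule ccontr)
    assume "\<not> a \<longlonglongrightarrow> 0"
    then obtain e where e: "0 < e" "\<And>m. \<exists>n\<ge>m. \<not> norm (a n) < e"
      by (auto simp: LIMSEQ_iff)
    \<comment> \<open>the averages along an enumeration of this set stay above \<open>e\<close>\<close>
    then have "infinite {n. e \<le> norm (a n)}"
      by (auto simp: infinite_nat_iff_unbounded_le not_less)
    then obtain r :: "nat \<Rightarrow> nat" where r: "strict_mono r" "\<And>n. e \<le> norm (a (r n))"
      using infinite_enumerate by blast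
    have "e \<le> (\<Sum>k<N. norm (a (r k))) / real N" if "N \<ge> 1" for N
    proof -
      have "real N * e = (\<Sum>k<N. e)" by simp
      also have "\<dots> \<le> (\<Sum>k<N. norm (a (r k)))" by (intro sum_mono r)
      finally show ?thesis using that by (simp add: pos_le_divide_eq mult.commute)
    qed
    then have "\<forall>\<^sub>F N in sequentially. e \<le> (\<Sum>k<N. norm (a (r k))) / real N"
      by (rule eventually_sequentiallyI)
    moreover have "(\<lambda>N. (\<Sum>k<N. norm (a (r k))) / real N) \<longlonglongrightarrow> 0" using * r(1) by (simp add: mean_null_def)
    ultimately have "e \<le> 0" using tendsto_lowerbound sequentially_bot by blast
    then show False using e by simp
  qed
qed

text \<open>The bound is \<open>|a| \<le> a\<^sup>2 / e + e\<close>.\<close>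

lemma mean_null_if_square:
  fixes a :: "nat \<Rightarrow> real"
  assumes "mean_null (\<lambda>k. (a k)\<^sup>2)" shows "mean_null a"
proof (rule mean_null_uniform_limit)
  fix e :: real assume e: "0 < e"
  have "mean_null (\<lambda>k. (a k)\<^sup>2 / e)"
    by (rule mean_null_scale[OF assms, of _ "1 / e"]) (use e in auto)
  moreover have "norm (a k) \<le> norm ((a k)\<^sup>2 / e) + e" for k
  proof (cases "\<bar>a k\<bar> \<le> e")
    case False
    then have "\<bar>a k\<bar> * e \<le> \<bar>a k\<bar> * \<bar>a k\<bar>" by (intro mult_left_mono) auto
    then have "\<bar>a k\<bar> \<le> (a k)\<^sup>2 / e" using e by (simp add: pos_le_divide_eq power2_eq_square abs_mult_self_eq)
    then show ?thesis using e by simp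
  qed (simp add: add_increasing)
  ultimately show "\<exists>b :: nat \<Rightarrow> real. mean_null b \<and> (\<forall>k. norm (a k) \<le> norm (b k) + e)" by blast
qed

text \<open>The averages over \<open>1, \<dots>, n\<close> and over \<open>0, \<dots>, n - 1\<close> differ by \<open>(|a\<^sub>n| - |a\<^sub>0|) / n\<close>.\<close>

lemma mean_null_from_one:
  fixes a :: "nat \<Rightarrow> 'v::real_normed_vector"
  assumes bd: "\<And>k. norm (a k) \<le> C"
  shows "mean_null a \<longleftrightarrow> (\<lambda>n. (\<Sum>k=1..n. norm (a k)) / real n) \<longlonglongrightarrow> 0"
proof -
  have eq: "(\<Sum>k=1..n. norm (a k)) / real n - (\<Sum>k<n. norm (a k)) / real n = (norm (a n) - norm (a 0)) / real n" for n
  proof -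
    have "(\<Sum>k=1..n. norm (a k)) = (\<Sum>k<n. norm (a (Suc k)))"
      by (rule sum.reindex_bij_witness[of _ Suc "\<lambda>k. k - 1"]) auto
    also have "\<dots> - (\<Sum>k<n. norm (a k)) = norm (a n) - norm (a 0)"
      using sum_lessThan_telescope[of "\<lambda>k. norm (a k)" n] by (simp only: sum_subtractf)
    finally show ?thesis by (simp flip: diff_divide_distrib)
  qed
  have "norm ((norm (a n) - norm (a 0)) / real n) \<le> (2 * C) / real n" for n
  proof -
    have "\<bar>norm (a n) - norm (a 0)\<bar> \<le> 2 * C"
      using bd[of n] bd[of 0] norm_ge_zero[of "a n"] norm_ge_zero[of "a 0"] by linarith
    then show ?thesis by (simp add: divide_right_mono)
  qed
  then have "(\<lambda>n. (norm (a n) - norm (a 0)) / real n) \<longlonglongrightarrow> 0"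
    by (rule Lim_null_comparison[OF always_eventually[OF allI]]) (rule lim_const_over_n)
  then have "(\<lambda>n. (\<Sum>k=1..n. norm (a k)) / real n - (\<Sum>k<n. norm (a k)) / real n) \<longlonglongrightarrow> 0" (is ?diff) by (simp only: eq)
  show ?thesis unfolding mean_null_def
    using Lim_transform[OF _ \<open>?diff\<close>] Lim_transform2[OF _ \<open>?diff\<close>] by blast
qed

lemma mean_null_linear_total:
  fixes b :: "nat \<Rightarrow> 'a::real_normed_vector \<Rightarrow> 'v::real_normed_vector"
  assumes total: "closure (span X) = UNIV"
    and linear: "\<And>k. linear (b k)" and bound: "\<And>k x. norm (b k x) \<le> C * norm x"
    and null: "\<And>x. x \<in> X \<Longrightarrow> mean_null (\<lambda>k. b k x)"
  shows "mean_null (\<lambda>k. b k x)"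
proof -
  let ?N = "{x. mean_null (\<lambda>k. b k x)}"
  have C: "norm (b k x) \<le> \<bar>C\<bar> * norm x" for k x
    using bound[of k x] mult_right_mono[OF abs_ge_self[of C] norm_ge_zero[of x]] by linarith
  have "subspace ?N"
  proof (rule subspaceI)
    show "0 \<in> ?N" by (simp add: linear_0[OF linear])
    show "x + y \<in> ?N" if "x \<in> ?N" "y \<in> ?N" for x y
      using that by (simp add: linear_add[OF linear] mean_null_add)
    show "r *\<^sub>R x \<in> ?N" if "x \<in> ?N" for r x
      using that by (auto simp: linear_scale[OF linear] intro: mean_null_scale[where C = "\<bar>r\<bar>"])
  qed
  then have span: "span X \<subseteq> ?N" using null by (intro span_minimal) auto
  show ?thesis
  proof (rule mean_null_uniform_limit)
    fix e :: real assume e: "0 < e"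
    have "x \<in> closure (span X)" using total by simp
    then obtain y where y: "y \<in> span X" "dist y x < e / (\<bar>C\<bar> + 1)"
      using e unfolding closure_approachable by (metis abs_ge_zero add_nonneg_pos divide_pos_pos zero_less_one)
    have "norm (b k x) \<le> norm (norm (b k y)) + e" for k
    proof -
      have "b k x = b k y + b k (x - y)" by (simp add: linear_diff[OF linear])
      then have "norm (b k x) \<le> norm (b k y) + norm (b k (x - y))" by (metis norm_triangle_ineq)
      moreover have "norm (b k (x - y)) \<le> (\<bar>C\<bar> + 1) * (e / (\<bar>C\<bar> + 1))"
        using y(2) by (intro order_trans[OF C] mult_mono) (auto simp: dist_norm norm_minus_commute)
      ultimately show ?thesis by (simp add: add_nonneg_eq_0_iff)
    qed
    moreover have "mean_null (\<lambda>k. norm (b k y))" using span y(1) by (auto simp: mean_null_def)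
    ultimately show "\<exists>a :: nat \<Rightarrow> real. mean_null a \<and> (\<forall>k. norm (b k x) \<le> norm (a k) + e)" by blast
  qed
qed

text \<open>For fixed \<open>j\<close> every value of the distance \<open>|i - j|\<close> occurs at most twice.\<close>

lemma double_mean_tendsto_0:
  fixes a :: "nat \<Rightarrow> nat \<Rightarrow> real" and \<delta> :: "nat \<Rightarrow> real"
  assumes \<delta>: "mean_null \<delta>" and a0: "\<And>i j. 0 \<le> a i j"
    and le: "\<And>i j. i \<le> j \<Longrightarrow> a i j \<le> \<delta> (j - i)" "\<And>i j. i \<le> j \<Longrightarrow> a j i \<le> \<delta> (j - i)"
  shows "(\<lambda>N. (\<Sum>i<N. \<Sum>j<N. a i j) / (real N)\<^sup>2) \<longlonglongrightarrow> 0"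
proof -
  have row: "(\<Sum>i<N. a j i) \<le> 2 * (\<Sum>n<N. norm (\<delta> n))" if j: "j < N" for j N
  proof -
    have "(\<Sum>i<N. a j i) = (\<Sum>i\<le>j. a j i) + (\<Sum>i\<in>{j<..<N}. a j i)"
      using j by (subst sum.union_disjoint[symmetric]) (auto intro!: sum.cong)
    also have "(\<Sum>i\<le>j. a j i) \<le> (\<Sum>i\<le>j. norm (\<delta> (j - i)))"
      by (intro sum_mono order_trans[OF le(2)]) auto
    also have "\<dots> = (\<Sum>n\<le>j. norm (\<delta> n))"
      by (rule sum.reindex_bij_witness[of _ "\<lambda>n. j - n" "\<lambda>i. j - i"]) auto
    also have "\<dots> \<le> (\<Sum>n<N. norm (\<delta> n))" using j by (intro sum_mono2) auto
    also have "(\<Sum>i\<in>{j<..<N}. a j i) \<le> (\<Sum>i\<in>{j<..<N}. norm (\<delta> (i - j)))"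
      by (intro sum_mono order_trans[OF le(1)]) auto
    also have "\<dots> = (\<Sum>n\<in>{1..<N - j}. norm (\<delta> n))"
      by (rule sum.reindex_bij_witness[of _ "\<lambda>n. n + j" "\<lambda>i. i - j"]) auto
    also have "\<dots> \<le> (\<Sum>n<N. norm (\<delta> n))" by (intro sum_mono2) auto
    finally show ?thesis by simp
  qed
  have bound: "norm ((\<Sum>i<N. \<Sum>j<N. a i j) / (real N)\<^sup>2) \<le> 2 * ((\<Sum>n<N. norm (\<delta> n)) / real N)" for N
  proof -
    have "(\<Sum>i<N. \<Sum>j<N. a i j) \<le> (\<Sum>i<N. 2 * (\<Sum>n<N. norm (\<delta> n)))"
      by (intro sum_mono row) auto
    also have "\<dots> = real N * (2 * (\<Sum>n<N. norm (\<delta> n)))" by simp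
    finally have "(\<Sum>i<N. \<Sum>j<N. a i j) / (real N)\<^sup>2 \<le> real N * (2 * (\<Sum>n<N. norm (\<delta> n))) / (real N)\<^sup>2"
      by (intro divide_right_mono) auto
    also have "\<dots> = 2 * ((\<Sum>n<N. norm (\<delta> n)) / real N)" by (simp add: power2_eq_square)
    finally show ?thesis by (simp add: a0 sum_nonneg)
  qed
  have "(\<lambda>N. 2 * ((\<Sum>n<N. norm (\<delta> n)) / real N)) \<longlonglongrightarrow> 2 * 0"
    using \<delta> unfolding mean_null_def by (intro tendsto_intros)
  then show ?thesis
    using Lim_null_comparison[OF always_eventually[OF allI[OF bound]]] by simp
qed

section \<open>Positive kernels and the Schur product\<close>

definition kernel_form :: "nat \<Rightarrow> (nat \<Rightarrow> nat \<Rightarrow> complex) \<Rightarrow> (nat \<Rightarrow> complex) \<Rightarrow> real" where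
  "kernel_form n K c = Re (\<Sum>i<n. \<Sum>j<n. c i * cnj (c j) * K i j)"

lemma kernel_form_add: "kernel_form n (\<lambda>i j. K i j + L i j) c = kernel_form n K c + kernel_form n L c"
  by (simp add: kernel_form_def algebra_simps sum.distrib)

lemma kernel_form_diff: "kernel_form n (\<lambda>i j. K i j - L i j) c = kernel_form n K c - kernel_form n L c"
  by (simp add: kernel_form_def algebra_simps sum_subtractf)

lemma kernel_form_cmult: "kernel_form n (\<lambda>i j. of_real r * K i j) c = r * kernel_form n K c"
proof -
  have "(\<Sum>i<n. \<Sum>j<n. c i * cnj (c j) * (of_real r * K i j)) = of_real r * (\<Sum>i<n. \<Sum>j<n. c i * cnj (c j) * K i j)"
    by (simp add: sum_distrib_left mult_ac)
  then show ?thesis by (simp add: kernel_form_def)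
qed

lemma kernel_form_cong: "(\<And>i j. i < n \<Longrightarrow> j < n \<Longrightarrow> K i j = L i j) \<Longrightarrow> kernel_form n K c = kernel_form n L c"
  by (simp add: kernel_form_def)

lemma kernel_form_cnj: "kernel_form n (\<lambda>i j. cnj (K i j)) c = kernel_form n K (\<lambda>i. cnj (c i))"
proof -
  have "(\<Sum>i<n. \<Sum>j<n. c i * cnj (c j) * cnj (K i j)) = cnj (\<Sum>i<n. \<Sum>j<n. cnj (c i) * cnj (cnj (c j)) * K i j)"
    by simp
  then show ?thesis by (simp only: kernel_form_def cnj.sel)
qed

lemma kernel_form_le: "(\<And>i. i < n \<Longrightarrow> cmod (c i) \<le> 1) \<Longrightarrow> kernel_form n K c \<le> (\<Sum>i<n. \<Sum>j<n. cmod (K i j))"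
proof -
  assume c: "\<And>i. i < n \<Longrightarrow> cmod (c i) \<le> 1"
  have "kernel_form n K c \<le> cmod (\<Sum>i<n. \<Sum>j<n. c i * cnj (c j) * K i j)"
    unfolding kernel_form_def by (rule complex_Re_le_cmod)
  also have "\<dots> \<le> (\<Sum>i<n. \<Sum>j<n. cmod (c i * cnj (c j) * K i j))"
    by (intro order_trans[OF norm_sum] sum_mono norm_sum)
  also have "\<dots> \<le> (\<Sum>i<n. \<Sum>j<n. cmod (K i j))"
    using c by (intro sum_mono) (auto simp: norm_mult intro!: mult_left_le_one_le mult_le_one)
  finally show ?thesis .
qed

lemma sum_cinner_sum:
  fixes h :: "nat \<Rightarrow> 'h::complex_inner"
  shows "cinner (\<Sum>i<n. c i *\<^sub>C h i) (\<Sum>j<n. d j *\<^sub>C k j) = (\<Sum>i<n. \<Sum>j<n. c i * cnj (d j) * cinner (h i) (k j))"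
  by (subst cinner.sum_left)
    (simp add: cinner.sum_right cinner_scaleC_left cinner_scaleC_right mult_ac sum_distrib_left)

lemma kernel_form_gram:
  fixes h :: "nat \<Rightarrow> 'h::complex_inner"
  shows "kernel_form n (\<lambda>i j. cinner (h i) (h j)) c = (norm (\<Sum>i<n. c i *\<^sub>C h i))\<^sup>2"
  unfolding kernel_form_def sum_cinner_sum[symmetric] by (simp add: cinner_self)

definition positive_kernel :: "nat \<Rightarrow> (nat \<Rightarrow> nat \<Rightarrow> complex) \<Rightarrow> bool" where
  "positive_kernel n K \<longleftrightarrow> (\<forall>c. 0 \<le> kernel_form n K c)"

lemma positive_kernel_gram: "positive_kernel n (\<lambda>i j. cinner (h i) (h j))"
  by (simp add: positive_kernel_def kernel_form_gram)

lemma positive_kernel_cnj: "positive_kernel n K \<Longrightarrow> positive_kernel n (\<lambda>i j. cnj (K i j))"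
  by (simp add: positive_kernel_def kernel_form_cnj)

text \<open>The Schur product theorem.  Splitting off the component of all vectors along the last one
  replaces the Gram factor by a rank one kernel, for which the claim is obvious, plus the
  Gram kernel of a family whose last vector is zero.\<close>

lemma positive_kernel_times_gram:
  fixes h :: "nat \<Rightarrow> 'h::complex_inner"
  assumes "positive_kernel n K"
  shows "positive_kernel n (\<lambda>i j. K i j * cinner (h i) (h j))"
  using assms
proof (induction n arbitrary: h)
  case 0
  then show ?case by (simp add: positive_kernel_def kernel_form_def)
next
  case (Suc n)
  have "positive_kernel n K"
    unfolding positive_kernel_def
  proof
    fix c
    have "kernel_form (Suc n) K (\<lambda>i. if i < n then c i else 0) = kernel_form n K c"
      by (simp add: kernel_form_def)
    then show "0 \<le> kernel_form n K c" using Suc.prems by (metis positive_kernel_def)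
  qed
  note IH = Suc.IH[OF this]
  define e where "e = sgn (h n)"
  define h' where "h' i = h i - cinner (h i) e *\<^sub>C e" for i
  have e: "cinner x e * cinner e e = cinner x e" for x
    by (cases "h n = 0") (auto simp: e_def cinner_self norm_sgn cinner.zero_right)
  have h'n: "h' n = 0"
  proof -
    have "cinner (h n) e = of_real (norm (h n))"
      by (cases "h n = 0") (simp_all add: e_def sgn_div_norm cinner.scaleR_right cinner_self scaleR_conv_of_real power2_eq_square)
    then show ?thesis by (cases "h n = 0") (simp_all add: h'_def e_def sgn_div_norm scaleC_of_real scaleC.zero_right)
  qed
  have split: "cinner (h i) (h j) = cinner (h i) e * cnj (cinner (h j) e) + cinner (h' i) (h' j)" for i j
  proof -
    have "cinner e (h j) = cnj (cinner (h j) e)" by (rule cinner_commute)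
    then show ?thesis
      using e[of "h i"]
      by (auto simp: h'_def cinner.diff_left cinner.diff_right cinner_scaleC_left cinner_scaleC_right algebra_simps)
  qed
  show ?case
    unfolding positive_kernel_def
  proof
    fix c
    have "kernel_form (Suc n) (\<lambda>i j. K i j * cinner (h i) (h j)) c
        = kernel_form (Suc n) (\<lambda>i j. K i j * (cinner (h i) e * cnj (cinner (h j) e))) c
        + kernel_form (Suc n) (\<lambda>i j. K i j * cinner (h' i) (h' j)) c"
      by (simp only: split distrib_left kernel_form_add)
    moreover have "kernel_form (Suc n) (\<lambda>i j. K i j * (cinner (h i) e * cnj (cinner (h j) e))) c
        = kernel_form (Suc n) K (\<lambda>i. c i * cinner (h i) e)"
      unfolding kernel_form_def by (intro arg_cong[where f = Re] sum.cong refl) (simp add: mult_ac)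
    moreover have "kernel_form (Suc n) (\<lambda>i j. K i j * cinner (h' i) (h' j)) c
        = kernel_form n (\<lambda>i j. K i j * cinner (h' i) (h' j)) c"
      by (simp add: kernel_form_def h'n cinner.zero_left cinner.zero_right)
    ultimately show "0 \<le> kernel_form (Suc n) (\<lambda>i j. K i j * cinner (h i) (h j)) c"
      using Suc.prems IH[of h'] by (simp add: positive_kernel_def)
  qed
qed

section \<open>A mean ergodic theorem for stationary kernels\<close>

text \<open>The image of the polynomial \<open>\<Sum>\<^sub>i p\<^sub>i X\<^sup>i\<close> under the linear map that sends \<open>X\<^sup>i\<close> to \<open>a\<^sub>i\<close>.\<close>

definition poly_combination :: "(nat \<Rightarrow> 'v::real_vector) \<Rightarrow> real poly \<Rightarrow> 'v" where
  "poly_combination a p = (\<Sum>i\<le>degree p. coeff p i *\<^sub>R a i)"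

lemma poly_combination_altdef:
  assumes "degree p < n"
  shows "poly_combination a p = (\<Sum>i<n. coeff p i *\<^sub>R a i)"
  unfolding poly_combination_def using assms
  by (intro sum.mono_neutral_left) (auto simp: coeff_eq_0)

lemma poly_combination_add: "poly_combination a (p + q) = poly_combination a p + poly_combination a q"
proof -
  define n where "n = Suc (max (degree p) (degree q))"
  have n: "degree p < n" "degree q < n" "degree (p + q) < n"
    using degree_add_le_max[of p q] by (auto simp: n_def)
  show ?thesis
    by (simp add: poly_combination_altdef[OF n(1)] poly_combination_altdef[OF n(2)]
        poly_combination_altdef[OF n(3)] scaleR_add_left sum.distrib)
qed

lemma poly_combination_smult: "poly_combination a (smult c p) = c *\<^sub>R poly_combination a p"
  using degree_smult_le[of c p]
  by (simp add: poly_combination_altdef[of _ "Suc (degree p)"] scaleR_sum_right del: sum.lessThan_Suc)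

lemma poly_combination_shift: "poly_combination a (pCons 0 p) = poly_combination (\<lambda>i. a (Suc i)) p"
proof -
  have d: "degree (pCons 0 p) < Suc (Suc (degree p))" "degree p < Suc (degree p)"
    using degree_pCons_le[of 0 p] by auto
  show ?thesis
    unfolding poly_combination_altdef[OF d(1)] poly_combination_altdef[OF d(2)]
    by (subst sum.lessThan_Suc_shift) simp
qed

lemma poly_combination_pointwise_add:
  "poly_combination (\<lambda>i. a i + b i) p = poly_combination a p + poly_combination b p"
  by (simp add: poly_combination_def scaleR_add_right sum.distrib)

lemma poly_combination_pointwise_scale:
  "poly_combination (\<lambda>i. c * a i) p = (c :: real) * poly_combination a p"
  by (simp add: poly_combination_def sum_distrib_left mult_ac)

definition average_poly :: "nat \<Rightarrow> real poly" where
  "average_poly N = smult (1 / real N) (\<Sum>k<N. monom 1 k)"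

lemma poly_combination_sum_monom: "poly_combination a (\<Sum>k<N. monom 1 k) = (\<Sum>k<N. a k)"
proof (induction N)
  case (Suc N)
  have "poly_combination a (monom 1 N) = a N"
    by (simp add: poly_combination_def degree_monom_eq if_distrib[of "\<lambda>c. c *\<^sub>R _"] cong: if_cong)
  then show ?case by (simp add: Suc poly_combination_add)
qed (simp add: poly_combination_def)

lemma poly_combination_average: "poly_combination a (average_poly N) = (1 / real N) *\<^sub>R (\<Sum>k<N. a k)"
  by (simp add: average_poly_def poly_combination_smult poly_combination_sum_monom)

text \<open>The mean ergodic theorem in the form of a Cauchy property, for multiplication by \<open>X\<close> as an
  isometry of a semi-inner product space of polynomials.  The average \<open>A\<^sub>N\<close> has nearly the smallest
  norm among polynomials \<open>p\<close> with \<open>p(1) = 1\<close>: for such \<open>p\<close> the difference \<open>A\<^sub>N p - A\<^sub>N\<close> is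
  \<open>(X\<^sup>N - 1) r / N\<close> with \<open>p - 1 = (X - 1) r\<close>.  By the parallelogram law nearly minimal elements of
  this affine space are close to each other.\<close>

lemma average_poly_Cauchy:
  fixes s :: "real poly \<Rightarrow> real"
  assumes nonneg: "\<And>p. 0 \<le> s p"
    and triangle: "\<And>p q. s (p + q) \<le> s p + s q"
    and scale: "\<And>c p. s (smult c p) = \<bar>c\<bar> * s p"
    and parallelogram: "\<And>p q. (s (p + q))\<^sup>2 + (s (p - q))\<^sup>2 = 2 * (s p)\<^sup>2 + 2 * (s q)\<^sup>2"
    and shift: "\<And>p. s (pCons 0 p) = s p"
    and e: "0 < e"
  shows "\<exists>N0. \<forall>N\<ge>N0. \<forall>M\<ge>N0. s (average_poly N - average_poly M) < e"
proof -
  have s0: "s 0 = 0" using scale[of 0 0] by simp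
  define P where "P = {p :: real poly. poly p 1 = 1}"
  define d where "d = Inf ((\<lambda>p. (s p)\<^sup>2) ` P)"
  have "1 \<in> P" by (simp add: P_def)
  then have ne: "(\<lambda>p. (s p)\<^sup>2) ` P \<noteq> {}" by blast
  have d_le: "d \<le> (s p)\<^sup>2" if "p \<in> P" for p
    unfolding d_def using that by (intro cInf_lower bdd_belowI[of _ 0]) auto
  have "\<exists>z\<in>(\<lambda>p. (s p)\<^sup>2) ` P. z < d + e\<^sup>2 / 4"
    using cInf_lessD[OF ne, of "d + e\<^sup>2 / 4"] e by (simp add: d_def)
  then obtain p where p: "p \<in> P" "(s p)\<^sup>2 < d + e\<^sup>2 / 4" by blast
  have "poly (p - 1) 1 = 0" using p(1) by (simp add: P_def)
  then have "[:-1, 1:] dvd p - 1" by (simp only: poly_eq_0_iff_dvd)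
  then obtain r where r: "p - 1 = [:-1, 1:] * r" by (rule dvdE)
  have shift_k: "s (monom 1 k * q) = s q" for k q
  proof (induction k)
    case (Suc k)
    have "monom 1 (Suc k) * q = pCons 0 (monom 1 k * q)" by (simp add: monom_Suc)
    then show ?case by (simp only: shift Suc)
  qed (simp add: monom_0)
  have sum_le: "s (\<Sum>k<N. monom 1 k * q) \<le> real N * s q" for N q
  proof (induction N)
    case (Suc N)
    have "s (\<Sum>k<Suc N. monom 1 k * q) \<le> s (\<Sum>k<N. monom 1 k * q) + s (monom 1 N * q)"
      using triangle by simp
    then have "s (\<Sum>k<Suc N. monom 1 k * q) \<le> real N * s q + s q" using Suc shift_k[of N q] by linarith
    then show ?case by (simp add: distrib_right add.commute)
  qed (simp add: s0)
  have avg_le: "s (average_poly N * q) \<le> s q" for N q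
  proof -
    have "s (average_poly N * q) = (1 / real N) * s (\<Sum>k<N. monom 1 k * q)"
      by (simp add: average_poly_def scale sum_distrib_right)
    also have "\<dots> \<le> (1 / real N) * (real N * s q)" by (intro mult_left_mono sum_le) auto
    also have "\<dots> \<le> s q" using nonneg by (cases "N = 0") auto
    finally show ?thesis .
  qed
  have minus: "s (- q) = s q" for q using scale[of "-1" q] by simp
  have telescope: "(\<Sum>k<N. monom 1 k) * [:-1, 1:] = monom (1 :: real) N - 1" for N
  proof (induction N)
    case (Suc N)
    have X: "q * [:-1, 1:] = pCons 0 q - q" for q :: "real poly" by simp
    have "pCons 0 (p + q) = pCons 0 p + pCons 0 q" for p q :: "real poly" by simp
    then show ?case using Suc unfolding X by (simp add: monom_Suc algebra_simps del: add_pCons)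
  qed (simp add: monom_0)
  have avg_diff: "s (average_poly N * (p - 1)) \<le> 2 * s r / real N" for N
  proof -
    have "average_poly N * (p - 1) = smult (1 / real N) ((monom 1 N - 1) * r)"
      unfolding r average_poly_def mult_smult_left mult.assoc[symmetric] telescope ..
    also have "s \<dots> = (1 / real N) * s (monom 1 N * r + (- r))" by (simp add: scale algebra_simps)
    also have "\<dots> \<le> (1 / real N) * (s (monom 1 N * r) + s (- r))" by (intro mult_left_mono triangle) auto
    finally show ?thesis by (simp add: shift_k minus)
  qed
  have avg: "s (average_poly N) \<le> s p + 2 * s r / real N" for N
  proof -
    have "average_poly N = average_poly N * p + (- (average_poly N * (p - 1)))" by (simp add: algebra_simps)
    then have "s (average_poly N) \<le> s (average_poly N * p) + s (average_poly N * (p - 1))"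
      using triangle minus by metis
    then show ?thesis using avg_le[of N p] avg_diff[of N] by linarith
  qed
  have "(\<lambda>N. (s p + 2 * s r / real N)\<^sup>2) \<longlonglongrightarrow> (s p + 0)\<^sup>2"
    by (intro tendsto_intros lim_const_over_n)
  then have "\<forall>\<^sub>F N in sequentially. (s p + 2 * s r / real N)\<^sup>2 < d + e\<^sup>2 / 4"
    using p(2) by (intro order_tendstoD(2)) auto
  then obtain N0 where N0: "\<And>N. N \<ge> N0 \<Longrightarrow> (s p + 2 * s r / real N)\<^sup>2 < d + e\<^sup>2 / 4"
    by (auto simp: eventually_sequentially)
  have avg2: "(s (average_poly N))\<^sup>2 < d + e\<^sup>2 / 4" if "N \<ge> N0" for N
    using N0[OF that] power_mono[OF avg[of N] nonneg, of 2] by linarith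
  have P_avg: "average_poly N \<in> P" if "N \<ge> 1" for N
    using that by (simp add: P_def average_poly_def poly_sum poly_monom)
  have "s (average_poly N - average_poly M) < e" if N: "N \<ge> max 1 N0" and M: "M \<ge> max 1 N0" for N M
  proof -
    define m where "m = smult (1/2) (average_poly N + average_poly M)"
    have "m \<in> P" using P_avg[of N] P_avg[of M] N M by (simp add: P_def m_def)
    then have "d \<le> (s m)\<^sup>2" by (rule d_le)
    also have "s m = (1/2) * s (average_poly N + average_poly M)" by (simp add: m_def scale)
    finally have "4 * d \<le> (s (average_poly N + average_poly M))\<^sup>2" by (simp add: power_divide)
    moreover have "(s (average_poly N + average_poly M))\<^sup>2 + (s (average_poly N - average_poly M))\<^sup>2
       < 4 * d + e\<^sup>2"
      unfolding parallelogram using avg2[of N] avg2[of M] N M by simp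
    ultimately have "(s (average_poly N - average_poly M))\<^sup>2 < e\<^sup>2" by linarith
    then show ?thesis using e by (simp add: power_less_imp_less_base)
  qed
  then show ?thesis by blast
qed

text \<open>The semi-inner product \<open>B p q = \<Sum>\<^sub>i\<^sub>j p\<^sub>i q\<^sub>j Re K\<^sub>i\<^sub>j\<close> is invariant under multiplication by \<open>X\<close>, and its
  seminorm dominates the norm of \<open>\<Sum>\<^sub>i p\<^sub>i x\<^sub>i\<close>; hence the Cauchy property of the polynomials \<open>A\<^sub>N\<close> carries over to
  the averages of \<open>x\<close>.\<close>

lemma averages_converge_if_dominated_by_stationary_kernel:
  fixes x :: "nat \<Rightarrow> 'v::banach" and K :: "nat \<Rightarrow> nat \<Rightarrow> complex"
  assumes pos: "\<And>n. positive_kernel n K"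
    and hermitian: "\<And>i j. K j i = cnj (K i j)"
    and stationary: "\<And>i j. K (Suc i) (Suc j) = K i j"
    and dominated: "\<And>n c. (norm (\<Sum>i<n. c i *\<^sub>R x i))\<^sup>2 \<le> kernel_form n K (\<lambda>i. of_real (c i))"
  shows "convergent (\<lambda>N. (1 / real N) *\<^sub>R (\<Sum>k<N. x k))"
proof -
  define B where "B p q = poly_combination (\<lambda>i. poly_combination (\<lambda>j. Re (K i j)) q) p" for p q
  define s where "s p = sqrt (B p p)" for p
  have B_form: "B p p = kernel_form n K (\<lambda>i. of_real (coeff p i))" if "degree p < n" for p n
    unfolding B_def poly_combination_altdef[OF that] kernel_form_def
    by (simp add: Re_sum sum_distrib_left mult_ac)
  have B_nonneg: "0 \<le> B p p" for p
    using pos[of "Suc (degree p)"] by (simp add: B_form[of p "Suc (degree p)"] positive_kernel_def)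
  have B_add: "B (p + p') q = B p q + B p' q" "B p (q + q') = B p q + B p q'" for p p' q q'
    by (simp_all add: B_def poly_combination_add poly_combination_pointwise_add)
  have B_smult: "B (smult c p) q = c * B p q" "B p (smult c q) = c * B p q" for c p q
    by (simp_all add: B_def poly_combination_smult poly_combination_pointwise_scale)
  have B_sym: "B p q = B q p" for p q
  proof -
    define n where "n = Suc (max (degree p) (degree q))"
    have n: "degree p < n" "degree q < n" by (auto simp: n_def)
    have "B p q = (\<Sum>i<n. \<Sum>j<n. coeff p i * (coeff q j * Re (K i j)))"
      by (simp add: B_def poly_combination_altdef[OF n(1)] poly_combination_altdef[OF n(2)] sum_distrib_left)
    also have "\<dots> = (\<Sum>j<n. \<Sum>i<n. coeff p i * (coeff q j * Re (K i j)))" by (rule sum.swap)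
    also have "\<dots> = (\<Sum>j<n. \<Sum>i<n. coeff q j * (coeff p i * Re (K j i)))"
    proof (intro sum.cong refl)
      show "coeff p i * (coeff q j * Re (K i j)) = coeff q j * (coeff p i * Re (K j i))" for i j
        by (subst hermitian) simp
    qed
    also have "\<dots> = B q p"
      by (simp add: B_def poly_combination_altdef[OF n(1)] poly_combination_altdef[OF n(2)] sum_distrib_left)
    finally show ?thesis .
  qed
  have B_minus: "B p (- q) = - B p q" "B (- p) q = - B p q" for p q
    using B_smult(2)[of p "-1" q] B_smult(1)[of "-1" p q] by simp_all
  have s2: "(s p)\<^sup>2 = B p p" for p using B_nonneg by (simp add: s_def)
  have B_square: "B (smult a p + smult b q) (smult a p + smult b q) = a\<^sup>2 * B p p + 2 * a * b * B p q + b\<^sup>2 * B q q" for a b p q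
    using B_sym[of q p] by (simp add: B_add B_smult power2_eq_square algebra_simps)
  have cs: "B p q \<le> s p * s q" for p q
  proof (cases "s p * s q = 0")
    case True
    \<comment> \<open>if \<open>B q q = 0\<close>, then \<open>B p p + 2 t B p q\<close> is nonnegative for all \<open>t\<close>\<close>
    have zero: "B p q \<le> 0" if "s q = 0" for p q
    proof (rule ccontr)
      assume b: "\<not> B p q \<le> 0"
      define t where "t = - (B p p + 1) / B p q"
      have "t * B p q = - (B p p + 1)" using b by (simp add: t_def)
      moreover have "B q q = 0" using s2[of q] that by simp
      moreover have "0 \<le> B (smult 1 p + smult t q) (smult 1 p + smult t q)" by (rule B_nonneg)
      ultimately have "0 \<le> B p p + 2 * (- (B p p + 1))"
        by (simp only: B_square) simp
      then show False using B_nonneg[of p] by simp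
    qed
    show ?thesis using True zero[of q p] zero[of p q] B_sym[of p q] by auto
  next
    case False
    then have st: "0 < s p" "0 < s q" using B_nonneg by (auto simp: s_def order_less_le)
    have "0 \<le> B (smult (s q) p + smult (- s p) q) (smult (s q) p + smult (- s p) q)" by (rule B_nonneg)
    also have "\<dots> = 2 * (s p * s q) * (s p * s q - B p q)"
      unfolding B_square unfolding s2[symmetric] by (simp only: power2_eq_square) (simp add: algebra_simps)
    finally have "0 \<le> s p * s q - B p q" using mult_pos_pos[OF st] by (subst (asm) zero_le_mult_iff) auto
    then show ?thesis by simp
  qed
  have cauchy: "\<exists>N0. \<forall>N\<ge>N0. \<forall>M\<ge>N0. s (average_poly N - average_poly M) < e" if e: "0 < e" for e
  proof (rule average_poly_Cauchy[OF _ _ _ _ _ e])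
    show "0 \<le> s p" for p using B_nonneg by (simp add: s_def)
    show "s (p + q) \<le> s p + s q" for p q
    proof (rule power2_le_imp_le)
      have "(s (p + q))\<^sup>2 = (s p)\<^sup>2 + 2 * B p q + (s q)\<^sup>2" using B_sym[of p q] by (simp add: s2 B_add)
      also have "\<dots> \<le> (s p + s q)\<^sup>2" using cs[of p q] by (simp add: power2_sum)
      finally show "(s (p + q))\<^sup>2 \<le> (s p + s q)\<^sup>2" .
    qed (use B_nonneg in \<open>simp add: s_def\<close>)
    show "s (smult c p) = \<bar>c\<bar> * s p" for c p
      unfolding s_def B_smult by (simp add: real_sqrt_mult flip: mult.assoc)
    show "(s (p + q))\<^sup>2 + (s (p - q))\<^sup>2 = 2 * (s p)\<^sup>2 + 2 * (s q)\<^sup>2" for p q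
      unfolding s2 diff_conv_add_uminus B_add B_minus by simp
    show "s (pCons 0 p) = s p" for p
      by (simp add: s_def B_def poly_combination_shift stationary)
  qed
  have norm_le: "norm (poly_combination x p) \<le> s p" for p
  proof (rule power2_le_imp_le)
    show "(norm (poly_combination x p))\<^sup>2 \<le> (s p)\<^sup>2"
      unfolding s2 B_form[of p "Suc (degree p)", OF lessI]
      unfolding poly_combination_altdef[of p "Suc (degree p)", OF lessI] by (rule dominated)
  qed (use B_nonneg in \<open>simp add: s_def\<close>)
  have "Cauchy (\<lambda>N. (1 / real N) *\<^sub>R (\<Sum>k<N. x k))"
  proof (rule CauchyI)
    fix e :: real assume "0 < e"
    then obtain N0 where N0: "\<And>N M. N \<ge> N0 \<Longrightarrow> M \<ge> N0 \<Longrightarrow> s (average_poly N - average_poly M) < e"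
      using cauchy by blast
    have "(1 / real N) *\<^sub>R (\<Sum>k<N. x k) - (1 / real M) *\<^sub>R (\<Sum>k<M. x k) = poly_combination x (average_poly N - average_poly M)" for N M
      using poly_combination_add[of x "average_poly N" "smult (-1) (average_poly M)"]
      by (simp only: poly_combination_smult poly_combination_average) simp
    then show "\<exists>M. \<forall>m\<ge>M. \<forall>n\<ge>M. norm ((1 / real m) *\<^sub>R (\<Sum>k<m. x k) - (1 / real n) *\<^sub>R (\<Sum>k<n. x k)) < e"
      using N0 norm_le by (metis order_le_less_trans)
  qed
  then show ?thesis by (simp add: Cauchy_convergent_iff)
qed

section \<open>Creators and annihilators on the full Fock space\<close>

locale full_fock_space =
  fixes word :: "'h::chilbert_space list \<Rightarrow> 'f::chilbert_space"
  assumes fock: "is_full_fock_space word"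
begin

lemma cinner_word_Nil [simp]: "cinner (word []) (word []) = 1"
  using fock by (auto simp: is_full_fock_space_def)

lemma cinner_word_length: "length fs \<noteq> length gs \<Longrightarrow> cinner (word fs) (word gs) = 0"
  using fock by (auto simp: is_full_fock_space_def)

lemma cinner_word_Cons [simp]:
  "cinner (word (f # fs)) (word (g # gs)) = cinner f g * cinner (word fs) (word gs)"
proof (cases "length fs = length gs")
  case True
  have same_length: "cinner (word xs) (word ys) = (\<Prod>i<length xs. cinner (xs ! i) (ys ! i))"
    if "length xs = length ys" for xs ys
    using fock that by (simp add: is_full_fock_space_def)
  have "cinner (word (f # fs)) (word (g # gs))
      = (\<Prod>i<Suc (length fs). cinner ((f # fs) ! i) ((g # gs) ! i))"
    using same_length[of "f # fs" "g # gs"] True by simp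
  also have "\<dots> = cinner f g * (\<Prod>i<length fs. cinner (fs ! i) (gs ! i))"
    by (subst prod.lessThan_Suc_shift) simp
  also have "(\<Prod>i<length fs. cinner (fs ! i) (gs ! i)) = cinner (word fs) (word gs)"
    using same_length[OF True] by simp
  finally show ?thesis .
qed (simp add: cinner_word_length)

lemma norm_vacuum: "norm (word []) = 1"
proof -
  have "complex_of_real ((norm (word []))\<^sup>2) = of_real (1\<^sup>2)" by (simp only: cinner_self[symmetric]) simp
  then have "(norm (word []))\<^sup>2 = 1\<^sup>2" using of_real_eq_iff by blast
  then show ?thesis by (rule power2_eq_imp_eq) simp_all
qed

lemma total_words: "closure (span (range (\<lambda>(c, fs). c *\<^sub>C word fs))) = UNIV"
proof -
  have "range (\<lambda>(c, fs). c *\<^sub>C word fs) = {c *\<^sub>C x |c x. x \<in> range word}" by auto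
  then show ?thesis using fock by (simp add: is_full_fock_space_def cspan_def)
qed

lemma eq_if_cinner_words: "(\<And>hs. cinner x (word hs) = cinner y (word hs)) \<Longrightarrow> x = y"
proof -
  assume *: "\<And>hs. cinner x (word hs) = cinner y (word hs)"
  let ?N = "{v. cinner x v = cinner y v}"
  have "subspace ?N" by (auto simp: subspace_def cinner.zero_right cinner.add_right cinner.scaleR_right)
  moreover have "closed ?N" by (intro closed_Collect_eq cinner.continuous_on continuous_intros)
  ultimately have "closure (span (range (\<lambda>(c, fs). c *\<^sub>C word fs))) \<subseteq> ?N"
    by (intro closure_minimal span_minimal) (auto simp: cinner_scaleC_right *)
  then have "cinner x v = cinner y v" for v using total_words by auto
  then show "x = y" by (intro cinner_eq_imp_eq) (metis cinner_commute)
qed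

lemma bounded_operators_eqI:
  assumes "x \<in> bounded_operators" "y \<in> bounded_operators" "\<And>fs. x (word fs) = y (word fs)"
  shows "x = y"
  using assms by (intro blinfun_eq_on_total_set[OF total_words]) (auto simp: bounded_operatorsD)

lemma creator_exists: "\<exists>x. x \<in> bounded_operators \<and> (\<forall>fs. blinfun_apply x (word fs) = word (f # fs))"
proof -
  define s where "s = (\<lambda>(c, fs). c *\<^sub>C word fs)"
  define g where "g = (\<lambda>(c, fs). c *\<^sub>C word (f # fs))"
  have "inner (g i) (g k) = (norm f)\<^sup>2 * inner (s i) (s k)" for i k
  proof -
    obtain c fs d gs where ik: "i = (c, fs)" "k = (d, gs)" by fastforce
    have "cinner (g i) (g k) = of_real ((norm f)\<^sup>2) * cinner (s i) (s k)"
      by (simp add: s_def g_def ik cinner_scaleC_left cinner_scaleC_right cinner_self mult_ac)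
    then have "Re (cinner (g i) (g k)) = Re (of_real ((norm f)\<^sup>2) * cinner (s i) (s k))" by (rule arg_cong)
    then show ?thesis by (simp only: Re_cinner Re_complex_of_real times_complex.sel(1) Im_complex_of_real mult_zero_left diff_zero)
  qed
  then have "\<exists>X :: 'f \<Rightarrow>\<^sub>L 'f. (\<forall>i. X (s i) = g i) \<and> (\<forall>a. norm (X a) = sqrt ((norm f)\<^sup>2) * norm a)"
    using total_words by (intro bounded_extension_from_total_family[of s g "(norm f)\<^sup>2"]) (simp_all add: s_def)
  then obtain X :: "'f \<Rightarrow>\<^sub>L 'f" where X: "\<And>c fs. X (c *\<^sub>C word fs) = c *\<^sub>C word (f # fs)"
    by (metis (mono_tags, lifting) case_prod_conv s_def g_def)
  have "X o\<^sub>L op_scaleC c id_blinfun = op_scaleC c X" for c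
    by (rule blinfun_eq_on_total_set[OF total_words]) (auto simp: X scaleC_scaleC)
  then have "X (c *\<^sub>C v) = c *\<^sub>C X v" for c v
    by (metis blinfun_apply_blinfun_compose op_scaleC_apply blinfun_apply_id_blinfun id_apply)
  then have "X \<in> bounded_operators" by (simp add: bounded_operators_def)
  moreover have "X (word fs) = word (f # fs)" for fs using X[of 1 fs] by simp
  ultimately show ?thesis by blast
qed

lemma creator_props: "creator word f \<in> bounded_operators \<and> (\<forall>fs. creator word f (word fs) = word (f # fs))"
  unfolding creator_def
proof (rule theI')
  show "\<exists>!x. x \<in> bounded_operators \<and> (\<forall>fs. blinfun_apply x (word fs) = word (f # fs))"
    using creator_exists[of f] by (auto intro: bounded_operators_eqI)
qed

lemma creator_bounded: "creator word f \<in> bounded_operators"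
  and creator_word [simp]: "creator word f (word fs) = word (f # fs)"
  using creator_props by auto

lemma annihilator_bounded: "annihilator word f \<in> bounded_operators"
  unfolding annihilator_def by (rule op_adjoint_bounded_operators[OF creator_bounded])

lemma cinner_annihilator: "cinner (annihilator word f u) v = cinner u (creator word f v)"
  unfolding annihilator_def by (rule cinner_op_adjoint'[OF creator_bounded])

lemma annihilator_word_Cons: "annihilator word g (word (f # fs)) = cinner f g *\<^sub>C word fs"
  by (rule eq_if_cinner_words) (simp add: cinner_annihilator cinner_scaleC_left)

lemma annihilator_vacuum [simp]: "annihilator word g (word []) = 0"
  by (rule eq_if_cinner_words) (simp add: cinner_annihilator cinner_word_length cinner.zero_left)

text \<open>The free analogue of the canonical commutation relations; used from left to right it brings every
  product of creators and annihilators into normal order.\<close>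

lemma annihilator_creator: "annihilator word g o\<^sub>L creator word f = op_scaleC (cinner f g) id_blinfun"
  by (rule bounded_operators_eqI)
    (simp_all add: bounded_operators_compose annihilator_bounded creator_bounded
      bounded_operators_scaleC bounded_operators_id annihilator_word_Cons)

lemma cinner_creator: "cinner (creator word f u) (creator word g v) = cinner f g * cinner u v"
proof -
  have "cinner (creator word f u) (creator word g v) = cinner ((annihilator word g o\<^sub>L creator word f) u) v"
    by (simp add: cinner_annihilator)
  then show ?thesis by (simp only: annihilator_creator) (simp add: cinner_scaleC_left)
qed

lemma field_op_bounded: "field_op word f \<in> bounded_operators"
  unfolding field_op_def by (intro bounded_operators_add annihilator_bounded creator_bounded)

lemma field_op_selfadjoint: "op_adjoint (field_op word f) = field_op word f"
  unfolding field_op_def op_adjoint_add[OF annihilator_bounded creator_bounded]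
  by (simp add: annihilator_def op_adjoint_involution creator_bounded add.commute)

primrec creators :: "'h list \<Rightarrow> 'f \<Rightarrow>\<^sub>L 'f" where
  "creators [] = id_blinfun"
| "creators (f # fs) = creator word f o\<^sub>L creators fs"

primrec annihilators :: "'h list \<Rightarrow> 'f \<Rightarrow>\<^sub>L 'f" where
  "annihilators [] = id_blinfun"
| "annihilators (g # gs) = annihilator word g o\<^sub>L annihilators gs"

lemma creators_append: "creators (fs @ gs) = creators fs o\<^sub>L creators gs"
  by (induction fs) (auto simp: blinfun_compose_assoc)

lemma creators_word: "creators fs (word hs) = word (fs @ hs)"
  by (induction fs) auto

lemma cinner_creators:
  "length fs = length gs \<Longrightarrow> cinner (creators fs u) (creators gs v) = cinner (word fs) (word gs) * cinner u v"
  by (induction fs gs rule: list_induct2) (auto simp: cinner_creator)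

lemma cinner_annihilators: "cinner (annihilators gs u) v = cinner u (creators (rev gs) v)"
  by (induction gs arbitrary: v) (auto simp: cinner_annihilator creators_append)

lemma annihilators_vacuum: "gs \<noteq> [] \<Longrightarrow> annihilators gs (word []) = 0"
proof (induction gs)
  case (Cons g gs)
  then show ?case by (cases gs) (auto simp: blinfun.zero_right)
qed simp

lemma cinner_word_rev:
  "length fs = length gs \<Longrightarrow> cinner (word (rev fs)) (word (rev gs)) = cinner (word fs) (word gs)"
proof (induction fs gs rule: list_induct2)
  case (Cons f fs g gs)
  have "cinner (word (rev (f # fs))) (word (rev (g # gs)))
      = cinner (creators (rev fs) (word [f])) (creators (rev gs) (word [g]))"
    by (simp add: creators_word)
  then show ?case using Cons by (simp add: cinner_creators)
qed simp

section \<open>The norm of a sum of normally ordered products\<close>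

text \<open>A sum \<open>\<Sum>\<^sub>i c\<^sub>i a\<^sup>+(F\<^sub>i) a(G\<^sub>i)\<close> acts like an operator of finite rank, so that its norm is at most the
  Hilbert-Schmidt norm.  The estimate first compares the Gram kernel of the vectors \<open>a(G\<^sub>i) v\<close> with the
  conjugate of the Gram kernel of the \<open>G\<^sub>i\<close>; multiplication by the Gram kernel of the \<open>F\<^sub>i\<close>
  preserves this comparison by the Schur product theorem.\<close>

lemma norm_sum_annihilators_le:
  assumes len: "\<And>i. length (Gs i) = l"
  shows "(norm (\<Sum>i<n. d i *\<^sub>C annihilators (Gs i) v))\<^sup>2
    \<le> (norm v)\<^sup>2 * kernel_form n (\<lambda>i j. cnj (cinner (word (Gs i)) (word (Gs j)))) d"
proof -
  define x where "x = (\<Sum>i<n. d i *\<^sub>C annihilators (Gs i) v)"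
  define y where "y = (\<Sum>i<n. cnj (d i) *\<^sub>C creators (rev (Gs i)) x)"
  let ?k = "kernel_form n (\<lambda>i j. cnj (cinner (word (Gs i)) (word (Gs j)))) d"
  have "(norm y)\<^sup>2 = kernel_form n (\<lambda>i j. cinner (creators (rev (Gs i)) x) (creators (rev (Gs j)) x)) (\<lambda>i. cnj (d i))"
    unfolding y_def by (rule kernel_form_gram[symmetric])
  also have "\<dots> = kernel_form n (\<lambda>i j. of_real ((norm x)\<^sup>2) * cinner (word (Gs i)) (word (Gs j))) (\<lambda>i. cnj (d i))"
    by (rule kernel_form_cong) (simp add: cinner_creators len cinner_word_rev cinner_self)
  also have "\<dots> = (norm x)\<^sup>2 * ?k" unfolding kernel_form_cmult kernel_form_cnj ..
  finally have y: "(norm y)\<^sup>2 = (norm x)\<^sup>2 * ?k" .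
  have "cinner x x = cinner v y"
    by (subst (1) x_def) (simp add: y_def cinner.sum_left cinner.sum_right cinner_scaleC_left cinner_scaleC_right cinner_annihilators)
  then have "(norm x)\<^sup>2 \<le> norm v * norm y"
    using norm_cinner_le[of v y] by (simp add: cinner_self norm_power flip: \<open>cinner x x = cinner v y\<close>)
  then have "((norm x)\<^sup>2)\<^sup>2 \<le> (norm v * norm y)\<^sup>2" by (intro power_mono) auto
  also have "\<dots> = (norm x)\<^sup>2 * ((norm v)\<^sup>2 * ?k)" by (simp add: power_mult_distrib y mult_ac)
  finally have "(norm x)\<^sup>2 * (norm x)\<^sup>2 \<le> (norm x)\<^sup>2 * ((norm v)\<^sup>2 * ?k)" by (simp only: power2_eq_square)
  then have "(norm x)\<^sup>2 \<le> (norm v)\<^sup>2 * ?k"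
  proof (cases "x = 0")
    case True
    have "0 \<le> ?k"
      using positive_kernel_cnj[OF positive_kernel_gram[of n "\<lambda>i. word (Gs i)"]] by (simp add: positive_kernel_def)
    then show ?thesis using True by simp
  next
    case False
    then have "0 < (norm x)\<^sup>2" by simp
    then show ?thesis using \<open>(norm x)\<^sup>2 * (norm x)\<^sup>2 \<le> (norm x)\<^sup>2 * ((norm v)\<^sup>2 * ?k)\<close>
      by (rule mult_left_le_imp_le[rotated])
  qed
  then show ?thesis by (simp add: x_def)
qed

lemma norm_sum_normal_ordered_le:
  assumes lenF: "\<And>i. length (F i) = k" and lenG: "\<And>i. length (Gs i) = l"
  shows "(norm (\<Sum>i<n. op_scaleC (c i) (creators (F i) o\<^sub>L annihilators (Gs i))))\<^sup>2
    \<le> kernel_form n (\<lambda>i j. cnj (cinner (word (Gs i)) (word (Gs j))) * cinner (word (F i)) (word (F j))) c"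
    (is "(norm ?X)\<^sup>2 \<le> ?k")
proof -
  have bound: "(norm (?X v))\<^sup>2 \<le> (norm v)\<^sup>2 * ?k" for v
  proof -
    define u where "u i = annihilators (Gs i) v" for i
    define K where "K i j = of_real ((norm v)\<^sup>2) * cnj (cinner (word (Gs i)) (word (Gs j))) - cinner (u i) (u j)" for i j
    have "positive_kernel n K"
      unfolding positive_kernel_def
    proof
      fix d
      have "kernel_form n K d = (norm v)\<^sup>2 * kernel_form n (\<lambda>i j. cnj (cinner (word (Gs i)) (word (Gs j)))) d
          - (norm (\<Sum>i<n. d i *\<^sub>C u i))\<^sup>2"
        unfolding K_def kernel_form_diff kernel_form_gram kernel_form_cmult ..
      then show "0 \<le> kernel_form n K d"
        using norm_sum_annihilators_le[of Gs l d v n, OF lenG] by (simp add: u_def)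
    qed
    then have "positive_kernel n (\<lambda>i j. K i j * cinner (word (F i)) (word (F j)))"
      by (rule positive_kernel_times_gram)
    then have "0 \<le> kernel_form n (\<lambda>i j. K i j * cinner (word (F i)) (word (F j))) c"
      by (simp add: positive_kernel_def)
    also have "\<dots> = kernel_form n (\<lambda>i j. of_real ((norm v)\<^sup>2) * (cnj (cinner (word (Gs i)) (word (Gs j))) * cinner (word (F i)) (word (F j)))
       - cinner (creators (F i) (u i)) (creators (F j) (u j))) c"
      by (rule kernel_form_cong) (simp add: K_def cinner_creators lenF algebra_simps)
    also have "\<dots> = (norm v)\<^sup>2 * ?k - (norm (\<Sum>i<n. c i *\<^sub>C creators (F i) (u i)))\<^sup>2"
      unfolding kernel_form_diff kernel_form_gram kernel_form_cmult ..
    also have "(\<Sum>i<n. c i *\<^sub>C creators (F i) (u i)) = ?X v"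
      by (simp add: blinfun.sum_left u_def)
    finally show ?thesis by simp
  qed
  have k0: "0 \<le> ?k"
    using positive_kernel_times_gram[OF positive_kernel_cnj[OF positive_kernel_gram[of n "\<lambda>i. word (Gs i)"]], of "\<lambda>i. word (F i)"]
    by (simp add: positive_kernel_def)
  have "norm ?X \<le> sqrt ?k"
  proof (rule norm_blinfun_bound)
    show "norm (?X v) \<le> sqrt ?k * norm v" for v
      by (rule power2_le_imp_le) (use bound[of v] k0 in \<open>auto simp: power_mult_distrib mult.commute\<close>)
  qed (use k0 in simp)
  then have "(norm ?X)\<^sup>2 \<le> (sqrt ?k)\<^sup>2" by (intro power_mono) auto
  then show ?thesis using k0 by simp
qed

end

section \<open>Orbits of products of fields\<close>

locale fock_isometry = full_fock_space word
  for word :: "'h::chilbert_space list \<Rightarrow> 'f::chilbert_space" +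
  fixes U :: "'h \<Rightarrow> 'h"
  assumes isometry: "cinner (U f) (U g) = cinner f g"
begin

abbreviation orbit :: "'h list \<Rightarrow> nat \<Rightarrow> 'h list" where
  "orbit fs k \<equiv> map (U ^^ k) fs"

lemma isometry_power: "cinner ((U ^^ k) f) ((U ^^ k) g) = cinner f g"
  by (induction k) (auto simp: isometry)

lemma cinner_word_map: "cinner (word (orbit fs k)) (word (orbit gs k)) = cinner (word fs) (word gs)"
proof (cases "length fs = length gs")
  case True
  then show ?thesis by (induction fs gs rule: list_induct2) (auto simp: isometry_power)
qed (simp add: cinner_word_length)

lemma cinner_word_orbit_Suc:
  "cinner (word (orbit fs (Suc i))) (word (orbit gs (Suc j))) = cinner (word (orbit fs i)) (word (orbit gs j))"
  using cinner_word_map[of 1 "orbit fs i" "orbit gs j"] by (simp add: o_def)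

definition normal_ordered :: "'h list \<Rightarrow> 'h list \<Rightarrow> nat \<Rightarrow> 'f \<Rightarrow>\<^sub>L 'f" where
  "normal_ordered fs gs k = creators (orbit fs k) o\<^sub>L annihilators (orbit gs k)"

text \<open>Along an orbit the contractions produced by normal ordering do not depend on the time; hence the
  coefficients in these linear combinations may be taken constant.\<close>

inductive normal_orderable :: "(nat \<Rightarrow> 'f \<Rightarrow>\<^sub>L 'f) \<Rightarrow> bool" where
  base: "normal_orderable (normal_ordered fs gs)"
| add: "normal_orderable x \<Longrightarrow> normal_orderable y \<Longrightarrow> normal_orderable (\<lambda>k. x k + y k)"
| scale: "normal_orderable x \<Longrightarrow> normal_orderable (\<lambda>k. op_scaleC c (x k))"

lemma normal_orderable_field:
  assumes "normal_orderable x"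
  shows "normal_orderable (\<lambda>k. field_op word ((U ^^ k) h) o\<^sub>L x k)"
  using assms
proof induction
  case (base fs gs)
  have "normal_orderable (\<lambda>k. annihilator word ((U ^^ k) h) o\<^sub>L normal_ordered fs gs k)"
  proof (cases fs)
    case Nil
    then have "(\<lambda>k. annihilator word ((U ^^ k) h) o\<^sub>L normal_ordered fs gs k) = normal_ordered [] (h # gs)"
      by (auto simp: normal_ordered_def)
    then show ?thesis by (simp add: normal_orderable.base)
  next
    case (Cons f fs')
    have "annihilator word ((U ^^ k) h) o\<^sub>L normal_ordered fs gs k = op_scaleC (cinner f h) (normal_ordered fs' gs k)" for k
    proof -
      have "annihilator word ((U ^^ k) h) o\<^sub>L normal_ordered fs gs k
          = ((annihilator word ((U ^^ k) h) o\<^sub>L creator word ((U ^^ k) f)) o\<^sub>L creators (orbit fs' k)) o\<^sub>L annihilators (orbit gs k)"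
        by (simp add: Cons normal_ordered_def blinfun_compose_assoc)
      then show ?thesis
        by (simp only: annihilator_creator isometry_power) (auto simp: normal_ordered_def intro: blinfun_eqI)
    qed
    then show ?thesis by (simp add: normal_orderable.base normal_orderable.scale)
  qed
  moreover have "(\<lambda>k. creator word ((U ^^ k) h) o\<^sub>L normal_ordered fs gs k) = normal_ordered (h # fs) gs"
    by (auto simp: normal_ordered_def blinfun_compose_assoc)
  then have "normal_orderable (\<lambda>k. creator word ((U ^^ k) h) o\<^sub>L normal_ordered fs gs k)"
    by (simp add: normal_orderable.base)
  ultimately have "normal_orderable (\<lambda>k. (annihilator word ((U ^^ k) h) o\<^sub>L normal_ordered fs gs k)
      + (creator word ((U ^^ k) h) o\<^sub>L normal_ordered fs gs k))"
    by (rule normal_orderable.add)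
  then show ?case
    by (simp add: field_op_def bounded_bilinear.add_left[OF bounded_bilinear_blinfun_compose])
next
  case (add x y)
  then show ?case
    by (simp add: bounded_bilinear.add_right[OF bounded_bilinear_blinfun_compose] normal_orderable.add)
next
  case (scale x c)
  have "field_op word ((U ^^ k) h) o\<^sub>L op_scaleC c (x k) = op_scaleC c (field_op word ((U ^^ k) h) o\<^sub>L x k)" for k
    by (rule blinfun_eqI) (simp add: bounded_operatorsD[OF field_op_bounded])
  then show ?case using scale by (simp add: normal_orderable.scale)
qed

text \<open>Annihilators kill the vacuum, and the vacuum expectation of a product of creators is an inner product
  of words, which the isometry preserves.\<close>

lemma normal_orderable_vacuum_constant:
  "normal_orderable x \<Longrightarrow> vacuum_state word (x k) = vacuum_state word (x 0)"
proof (induction rule: normal_orderable.induct)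
  case (base fs gs)
  show ?case
  proof (cases "gs = []")
    case True
    then show ?thesis
      using cinner_word_map[of k fs "[]"] by (simp add: vacuum_state_def normal_ordered_def creators_word)
  next
    case False
    then show ?thesis by (simp add: vacuum_state_def normal_ordered_def annihilators_vacuum blinfun.zero_right)
  qed
qed (simp_all add: vacuum_state_def blinfun.add_left cinner_add_left cinner_scaleC_left)

lemma normal_orderable_averages_converge:
  "normal_orderable x \<Longrightarrow> convergent (\<lambda>N. (1 / real N) *\<^sub>R (\<Sum>k<N. x k))"
proof (induction rule: normal_orderable.induct)
  case (base fs gs)
  define K where "K = (\<lambda>i j. cnj (cinner (word (orbit gs i)) (word (orbit gs j))) * cinner (word (orbit fs i)) (word (orbit fs j)))"
  show ?case
  proof (rule averages_converge_if_dominated_by_stationary_kernel)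
    show "positive_kernel n K" for n
      unfolding K_def by (rule positive_kernel_times_gram[OF positive_kernel_cnj[OF positive_kernel_gram]])
    show "K j i = cnj (K i j)" for i j
      by (simp add: K_def flip: cinner_commute)
    show "K (Suc i) (Suc j) = K i j" for i j by (simp only: K_def cinner_word_orbit_Suc)
    show "(norm (\<Sum>i<n. c i *\<^sub>R normal_ordered fs gs i))\<^sup>2 \<le> kernel_form n K (\<lambda>i. of_real (c i))" for n c
      using norm_sum_normal_ordered_le[of "orbit fs" "length fs" "orbit gs" "length gs" "\<lambda>i. of_real (c i)" n]
      by (simp add: op_scaleC_of_real normal_ordered_def K_def)
  qed
next
  case (add x y)
  then show ?case by (simp add: sum.distrib scaleR_add_right convergent_add)
next
  case (scale x c)
  then obtain z where "(\<lambda>N. (1 / real N) *\<^sub>R (\<Sum>k<N. x k)) \<longlonglongrightarrow> z" by (auto simp: convergent_def)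
  then have "(\<lambda>N. op_scaleC c ((1 / real N) *\<^sub>R (\<Sum>k<N. x k))) \<longlonglongrightarrow> op_scaleC c z"
    by (rule bounded_linear.tendsto[OF bounded_linear_op_scaleC])
  then show ?case
    unfolding convergent_def
    by (auto simp: linear_scale[OF bounded_linear.linear[OF bounded_linear_op_scaleC]]
        linear_sum[OF bounded_linear.linear[OF bounded_linear_op_scaleC]])
qed

text \<open>The double mean bounds the squared norm of any average of the vectors \<open>c\<^sub>k U\<^sup>r\<^sup>(\<^sup>k\<^sup>) h\<close> with
  \<open>|c\<^sub>k| \<le> 1\<close>.  The times \<open>r\<close> are all times for weak mixing, and an arbitrary subsequence for mixing.\<close>

definition correlations_vanish :: "(nat \<Rightarrow> nat) \<Rightarrow> bool" where
  "correlations_vanish r \<longleftrightarrow> (\<forall>h. (\<lambda>N. (\<Sum>i<N. \<Sum>j<N. cmod (cinner ((U ^^ r i) h) ((U ^^ r j) h))) / (real N)\<^sup>2) \<longlonglongrightarrow> 0)"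

lemma norm_cinner_word_orbit_le:
  "cmod (cinner (word (orbit fs i)) (word (orbit fs j))) \<le> (norm (word fs))\<^sup>2"
proof -
  have n: "norm (word (orbit fs k)) = norm (word fs)" for k
    using cinner_word_map[of k fs fs] unfolding cinner_self of_real_eq_iff by simp
  show ?thesis using norm_cinner_le[of "word (orbit fs i)" "word (orbit fs j)"] by (simp add: n power2_eq_square)
qed

lemma norm_cinner_word_orbit_Cons_le:
  "cmod (cinner (word (orbit (f # fs) i)) (word (orbit (f # fs) j)))
    \<le> (norm (word fs))\<^sup>2 * cmod (cinner ((U ^^ i) f) ((U ^^ j) f))"
  using mult_left_mono[OF norm_cinner_word_orbit_le[of i fs j] norm_ge_zero[of "cinner ((U ^^ i) f) ((U ^^ j) f)"]]
  by (simp add: norm_mult mult.commute)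

text \<open>A product other than \<open>1\<close> has a factor \<open>a\<^sup>+(f)\<close> or \<open>a(f)\<close>; the correlations of this \<open>f\<close> bound its kernel
  up to a constant factor.  Its vacuum expectation is zero.\<close>

lemma normal_orderable_weighted_averages:
  assumes "normal_orderable x" and r: "correlations_vanish r" and c: "\<And>k. cmod (c k) \<le> 1"
  shows "(\<lambda>N. (1 / real N) *\<^sub>R (\<Sum>k<N. op_scaleC (c k) (x (r k) - op_scaleC (vacuum_state word (x (r k))) id_blinfun))) \<longlonglongrightarrow> 0"
  using assms(1)
proof (induction rule: normal_orderable.induct)
  case (base fs gs)
  show ?case
  proof (cases "fs = [] \<and> gs = []")
    case True
    have "op_scaleC c (id_blinfun - op_scaleC 1 id_blinfun) = (0 :: 'f \<Rightarrow>\<^sub>L 'f)" for c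
      by (rule blinfun_eqI) (simp add: blinfun.diff_left scaleC.zero_right)
    then show ?thesis using True by (simp add: normal_ordered_def vacuum_state_def)
  next
    case False
    have vac: "vacuum_state word (normal_ordered fs gs k) = 0" for k
      using False
      by (cases "gs = []") (auto simp: vacuum_state_def normal_ordered_def creators_word cinner_word_length
          annihilators_vacuum blinfun.zero_right cinner.zero_left)
    have zero: "op_scaleC 0 id_blinfun = (0 :: 'f \<Rightarrow>\<^sub>L 'f)" by (rule blinfun_eqI) (simp add: scaleC.zero_left)
    define K where "K = (\<lambda>i j. cnj (cinner (word (orbit gs i)) (word (orbit gs j))) * cinner (word (orbit fs i)) (word (orbit fs j)))"
    have "\<exists>h C. \<forall>i j. cmod (K i j) \<le> C * cmod (cinner ((U ^^ i) h) ((U ^^ j) h))"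
    proof (cases fs)
      case (Cons f fs')
      have "cmod (K i j) \<le> (norm (word gs))\<^sup>2 * ((norm (word fs'))\<^sup>2 * cmod (cinner ((U ^^ i) f) ((U ^^ j) f)))" for i j
        unfolding K_def norm_mult complex_mod_cnj Cons
        by (intro mult_mono norm_cinner_word_orbit_le norm_cinner_word_orbit_Cons_le) auto
      then show ?thesis by (metis mult.assoc)
    next
      case Nil
      with False obtain g gs' where Cons: "gs = g # gs'" by (cases gs) auto
      have "cmod (K i j) \<le> (norm (word fs))\<^sup>2 * ((norm (word gs'))\<^sup>2 * cmod (cinner ((U ^^ i) g) ((U ^^ j) g)))" for i j
        unfolding K_def norm_mult complex_mod_cnj Cons mult.commute[of "cmod (cinner (word (orbit (g # gs') i)) _)"]
        by (intro mult_mono norm_cinner_word_orbit_le norm_cinner_word_orbit_Cons_le) auto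
      then show ?thesis by (metis mult.assoc)
    qed
    then obtain h C where hC: "\<And>i j. cmod (K i j) \<le> C * cmod (cinner ((U ^^ i) h) ((U ^^ j) h))" by blast
    let ?avg = "\<lambda>N. (1 / real N) *\<^sub>R (\<Sum>k<N. op_scaleC (c k) (normal_ordered fs gs (r k)))"
    let ?dd = "\<lambda>N. C * ((\<Sum>i<N. \<Sum>j<N. cmod (cinner ((U ^^ r i) h) ((U ^^ r j) h))) / (real N)\<^sup>2)"
    have "(norm (?avg N))\<^sup>2 \<le> ?dd N" for N
    proof -
      have "(norm (?avg N))\<^sup>2 = (norm (\<Sum>k<N. op_scaleC (c k) (normal_ordered fs gs (r k))))\<^sup>2 / (real N)\<^sup>2"
        by (simp add: power_divide)
      also have "\<dots> \<le> kernel_form N (\<lambda>i j. K (r i) (r j)) c / (real N)\<^sup>2"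
        using norm_sum_normal_ordered_le[of "\<lambda>i. orbit fs (r i)" "length fs" "\<lambda>i. orbit gs (r i)" "length gs" c N]
        by (intro divide_right_mono) (simp_all add: normal_ordered_def K_def)
      also have "\<dots> \<le> (\<Sum>i<N. \<Sum>j<N. cmod (K (r i) (r j))) / (real N)\<^sup>2"
        by (intro divide_right_mono kernel_form_le c) auto
      also have "\<dots> \<le> (\<Sum>i<N. \<Sum>j<N. C * cmod (cinner ((U ^^ r i) h) ((U ^^ r j) h))) / (real N)\<^sup>2"
        by (intro divide_right_mono sum_mono hC) auto
      finally show ?thesis by (simp add: sum_distrib_left)
    qed
    moreover have "?dd \<longlonglongrightarrow> C * 0"
      using r unfolding correlations_vanish_def by (intro tendsto_mult tendsto_const) blast
    ultimately have "(\<lambda>N. (norm (?avg N))\<^sup>2) \<longlonglongrightarrow> 0"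
      by (intro tendsto_sandwich[of "\<lambda>_. 0" "\<lambda>N. (norm (?avg N))\<^sup>2" _ ?dd]) auto
    then have "(\<lambda>N. sqrt ((norm (?avg N))\<^sup>2)) \<longlonglongrightarrow> sqrt 0" by (rule tendsto_real_sqrt)
    then have "(\<lambda>N. norm (?avg N)) \<longlonglongrightarrow> 0" by (simp only: real_sqrt_abs abs_norm_cancel real_sqrt_zero)
    then have "?avg \<longlonglongrightarrow> 0" by (rule tendsto_norm_zero_cancel)
    then show ?thesis by (simp add: vac zero)
  qed
next
  case (add x y)
  have "op_scaleC d (a + b - op_scaleC (vacuum_state word (a + b)) id_blinfun)
      = op_scaleC d (a - op_scaleC (vacuum_state word a) id_blinfun)
      + op_scaleC d (b - op_scaleC (vacuum_state word b) id_blinfun)" for a b :: "'f \<Rightarrow>\<^sub>L 'f" and d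
    by (rule blinfun_eqI)
      (simp add: vacuum_state_def blinfun.add_left blinfun.diff_left cinner_add_left scaleC_add_left
        scaleC_add_right scaleC.diff_right)
  then show ?case using tendsto_add[OF add.IH] by (simp add: sum.distrib scaleR_add_right)
next
  case (scale x d)
  have eq: "op_scaleC e (op_scaleC d a - op_scaleC (vacuum_state word (op_scaleC d a)) id_blinfun)
      = op_scaleC d (op_scaleC e (a - op_scaleC (vacuum_state word a) id_blinfun))" for a :: "'f \<Rightarrow>\<^sub>L 'f" and e
    by (rule blinfun_eqI)
      (simp add: vacuum_state_def blinfun.diff_left cinner_scaleC_left scaleC_scaleC scaleC.diff_right mult_ac)
  note lin = bounded_linear.linear[OF bounded_linear_op_scaleC[of d]]
  show ?case
    using bounded_linear.tendsto[OF bounded_linear_op_scaleC[of d] scale.IH]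
    by (simp add: eq linear_scale[OF lin] linear_sum[OF lin] linear_0[OF lin])
qed

end

section \<open>Ergodic behaviour of the field algebra\<close>

lemma norm_add_diff_le: "x = a + b - c \<Longrightarrow> norm x \<le> norm a + norm b + norm (c :: 'a::real_normed_vector)"
  using norm_triangle_ineq4[of "a + b" c] norm_triangle_ineq[of a b] by simp

text \<open>In the application \<open>S\<close> is the image of \<open>K\<^sub>\<real>\<close>, which \<open>U\<close> maps into itself.\<close>

locale field_dynamics = fock_isometry word U
  for word :: "'h::chilbert_space list \<Rightarrow> 'f::chilbert_space" and U :: "'h \<Rightarrow> 'h" +
  fixes S :: "'h set" and \<alpha> :: "('f \<Rightarrow>\<^sub>L 'f) \<Rightarrow> ('f \<Rightarrow>\<^sub>L 'f)"
  assumes U_S: "h \<in> S \<Longrightarrow> U h \<in> S"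
    and automorphism: "automorphism (generated_cstar_algebra (field_op word ` S)) \<alpha>"
    and \<alpha>_field: "h \<in> S \<Longrightarrow> \<alpha> (field_op word h) = field_op word (U h)"
begin

definition fields :: "('f \<Rightarrow>\<^sub>L 'f) set" where
  "fields = generated_cstar_algebra (field_op word ` S)"

lemma field_ops_bounded: "field_op word ` S \<subseteq> bounded_operators"
  using field_op_bounded by blast

lemma cstar: "unital_cstar_algebra fields"
  unfolding fields_def by (rule generated_cstar_algebra_unital[OF field_ops_bounded])

lemma field_op_mem: "h \<in> S \<Longrightarrow> field_op word h \<in> fields"
  unfolding fields_def using generated_cstar_algebra_base[OF field_ops_bounded] by blast

lemmas aut = automorphism[folded fields_def]

lemma power_mem: "x \<in> fields \<Longrightarrow> (\<alpha> ^^ k) x \<in> fields"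
  by (induction k) (auto intro: automorphism_mem[OF aut])

lemma power_add: "x \<in> fields \<Longrightarrow> y \<in> fields \<Longrightarrow> (\<alpha> ^^ k) (x + y) = (\<alpha> ^^ k) x + (\<alpha> ^^ k) y"
  by (induction k) (auto simp: automorphism_add[OF aut] power_mem)

lemma power_scaleC: "x \<in> fields \<Longrightarrow> (\<alpha> ^^ k) (op_scaleC c x) = op_scaleC c ((\<alpha> ^^ k) x)"
  by (induction k) (auto simp: automorphism_scaleC[OF aut] power_mem)

lemma power_norm_le: "x \<in> fields \<Longrightarrow> norm ((\<alpha> ^^ k) x) \<le> norm x"
proof (induction k)
  case (Suc k)
  then show ?case using automorphism_norm_le[OF cstar aut power_mem[of x k]] by simp
qed simp

lemma fields_diff: "x \<in> fields \<Longrightarrow> y \<in> fields \<Longrightarrow> x - y \<in> fields"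
  by (rule subspace_diff[OF cstar_subspace[OF cstar]])

lemma power_diff: "x \<in> fields \<Longrightarrow> y \<in> fields \<Longrightarrow> (\<alpha> ^^ k) (x - y) = (\<alpha> ^^ k) x - (\<alpha> ^^ k) y"
  using power_add[OF fields_diff, of x y y k] by (simp add: algebra_simps)

lemma power_compose: "x \<in> fields \<Longrightarrow> y \<in> fields \<Longrightarrow> (\<alpha> ^^ k) (x o\<^sub>L y) = (\<alpha> ^^ k) x o\<^sub>L (\<alpha> ^^ k) y"
  by (induction k) (auto simp: automorphism_compose[OF aut] power_mem)

lemma power_id: "(\<alpha> ^^ k) id_blinfun = id_blinfun"
  by (induction k) (auto simp: automorphism_id[OF cstar aut])

lemma power_field_op: "h \<in> S \<Longrightarrow> (\<alpha> ^^ k) (field_op word h) = field_op word ((U ^^ k) h)"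
proof (induction k)
  case (Suc k)
  have "(U ^^ k) h \<in> S" by (induction k) (auto intro: U_S Suc.prems)
  then show ?case using Suc by (simp add: \<alpha>_field)
qed simp

lemma normal_orderable_approximation:
  assumes x: "x \<in> fields" and e: "0 < e"
  shows "\<exists>y\<in>fields. normal_orderable (\<lambda>k. (\<alpha> ^^ k) y) \<and> norm (x - y) < e"
proof -
  have "y \<in> fields \<and> normal_orderable (\<lambda>k. (\<alpha> ^^ k) y)" if "y \<in> operator_polynomials (field_op word ` S)" for y
    using that
  proof induction
    case id
    have "(\<lambda>k. (\<alpha> ^^ k) id_blinfun) = normal_ordered [] []" by (auto simp: power_id normal_ordered_def)
    then show ?case by (simp add: normal_orderable.base cstar_id cstar)
  next
    case (left_mult s y)
    then obtain h where h: "h \<in> S" "s = field_op word h" by blast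
    then show ?case
      using left_mult normal_orderable_field[of "\<lambda>k. (\<alpha> ^^ k) y" h]
      by (simp add: power_compose power_field_op field_op_mem cstar_compose cstar)
  qed (simp_all add: power_add power_scaleC cstar_add cstar_scaleC cstar normal_orderable.add normal_orderable.scale)
  moreover have "x \<in> closure (operator_polynomials (field_op word ` S))"
    using x generated_cstar_algebra_subset_closure[OF field_ops_bounded] field_op_selfadjoint
    unfolding fields_def by blast
  then obtain y where "y \<in> operator_polynomials (field_op word ` S)" "dist y x < e"
    using e unfolding closure_approachable by blast
  moreover have "norm (x - y) < e" using \<open>dist y x < e\<close> by (simp add: dist_norm norm_minus_commute)
  ultimately show ?thesis by blast
qed

definition average :: "nat \<Rightarrow> ('f \<Rightarrow>\<^sub>L 'f) \<Rightarrow> 'f \<Rightarrow>\<^sub>L 'f" where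
  "average N x = (1 / real N) *\<^sub>R (\<Sum>k<N. (\<alpha> ^^ k) x)"

lemma average_mem: "x \<in> fields \<Longrightarrow> average N x \<in> fields"
  unfolding average_def
  by (intro cstar_scaleR[OF cstar] subspace_sum[OF cstar_subspace[OF cstar]] power_mem)

lemma average_diff: "x \<in> fields \<Longrightarrow> y \<in> fields \<Longrightarrow> average N (x - y) = average N x - average N y"
  by (simp add: average_def power_diff sum_subtractf scaleR_diff_right)

lemma average_norm_le:
  assumes x: "x \<in> fields" shows "norm (average N x) \<le> norm x"
proof -
  have "norm (\<Sum>k<N. (\<alpha> ^^ k) x) \<le> real N * norm x"
    by (rule order_trans[OF sum_norm_bound[of _ _ "norm x"]]) (auto intro: power_norm_le[OF x])
  then have "(1 / real N) * norm (\<Sum>k<N. (\<alpha> ^^ k) x) \<le> (1 / real N) * (real N * norm x)"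
    by (rule mult_left_mono) simp
  then have "norm (average N x) \<le> (1 / real N) * (real N * norm x)" by (simp only: average_def norm_scaleR) simp
  also have "\<dots> \<le> norm x" by (cases "N = 0") auto
  finally show ?thesis .
qed

lemma averages_converge:
  assumes x: "x \<in> fields" shows "convergent (\<lambda>N. average N x)"
proof -
  have "Cauchy (\<lambda>N. average N x)"
  proof (rule CauchyI)
    fix e :: real assume e: "0 < e"
    obtain y where y: "y \<in> fields" "normal_orderable (\<lambda>k. (\<alpha> ^^ k) y)" "norm (x - y) < e / 3"
      using normal_orderable_approximation[OF x, of "e / 3"] e by auto
    have "Cauchy (\<lambda>N. average N y)"
      using normal_orderable_averages_converge[OF y(2)] by (simp add: average_def Cauchy_convergent_iff)
    then obtain M where M: "\<And>m n. m \<ge> M \<Longrightarrow> n \<ge> M \<Longrightarrow> norm (average m y - average n y) < e / 3"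
      using CauchyD[of "\<lambda>N. average N y" "e / 3"] e by auto
    have close: "norm (average N x - average N y) < e / 3" for N
      using average_norm_le[OF fields_diff[OF x y(1)], of N] y(3) average_diff[OF x y(1), of N] by simp
    have "norm (average m x - average n x) < e" if "m \<ge> M" "n \<ge> M" for m n
    proof -
      have "average m x - average n x
          = (average m x - average m y) + (average m y - average n y) - (average n x - average n y)" by simp
      then have "norm (average m x - average n x)
          \<le> norm (average m x - average m y) + norm (average m y - average n y) + norm (average n x - average n y)"
        by (rule norm_add_diff_le)
      then show ?thesis using close[of m] close[of n] M[OF that] by linarith
    qed
    then show "\<exists>M. \<forall>m\<ge>M. \<forall>n\<ge>M. norm (average m x - average n x) < e" by blast
  qed
  then show ?thesis by (simp add: Cauchy_convergent_iff)
qed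

definition limit_average :: "('f \<Rightarrow>\<^sub>L 'f) \<Rightarrow> 'f \<Rightarrow>\<^sub>L 'f" where
  "limit_average x = lim (\<lambda>N. average N x)"

lemma limit_average: "x \<in> fields \<Longrightarrow> (\<lambda>N. average N x) \<longlonglongrightarrow> limit_average x"
  unfolding limit_average_def using averages_converge by (simp add: convergent_LIMSEQ_iff)

lemma limit_average_mem: "x \<in> fields \<Longrightarrow> limit_average x \<in> fields"
  using closed_sequentially[OF cstar_closed[OF cstar] _ limit_average] average_mem by blast

lemma state_sum:
  assumes \<phi>: "\<phi> \<in> states fields" and x: "\<And>k. x k \<in> fields"
  shows "\<phi> (\<Sum>k<N. x k) = (\<Sum>k<(N::nat). \<phi> (x k))"
proof (induction N)
  case 0
  then show ?case using state_diff[OF cstar \<phi> x x, of 0 0] by simp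
next
  case (Suc N)
  then show ?case
    using state_add[OF \<phi> subspace_sum[OF cstar_subspace[OF cstar], of "{..<N}" x] x[of N]] x by simp
qed

lemma state_average:
  assumes \<phi>: "\<phi> \<in> states fields" and x: "x \<in> fields"
  shows "\<phi> (average N x) = (\<Sum>k<N. \<phi> ((\<alpha> ^^ k) x)) / of_nat N"
proof -
  have sum: "(\<Sum>k<N. (\<alpha> ^^ k) x) \<in> fields" by (intro subspace_sum[OF cstar_subspace[OF cstar]] power_mem x)
  have "\<phi> (average N x) = of_real (1 / real N) * \<phi> (\<Sum>k<N. (\<alpha> ^^ k) x)"
    unfolding average_def op_scaleC_of_real[symmetric] by (rule state_scaleC[OF \<phi> sum])
  also have "\<phi> (\<Sum>k<N. (\<alpha> ^^ k) x) = (\<Sum>k<N. \<phi> ((\<alpha> ^^ k) x))" by (rule state_sum[OF \<phi> power_mem[OF x]])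
  finally show ?thesis by simp
qed

lemma uniquely_ergodic: "uniquely_ergodic_fixed_point fields \<alpha>"
  unfolding uniquely_ergodic_fixed_point_def
proof (intro exI[of _ limit_average] conjI ballI)
  show "limit_average ` fields \<subseteq> fields" using limit_average_mem by blast
  show "linear_on_algebra fields limit_average"
    unfolding linear_on_algebra_def
  proof (intro conjI ballI allI)
    fix x y c assume xy: "x \<in> fields"
    show "limit_average (x + y) = limit_average x + limit_average y" if y: "y \<in> fields"
    proof (rule LIMSEQ_unique)
      show "(\<lambda>N. average N (x + y)) \<longlonglongrightarrow> limit_average (x + y)"
        by (rule limit_average[OF cstar_add[OF cstar xy y]])
      have "average N (x + y) = average N x + average N y" for N
        by (simp add: average_def power_add xy y sum.distrib scaleR_add_right)
      then show "(\<lambda>N. average N (x + y)) \<longlonglongrightarrow> limit_average x + limit_average y"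
        using tendsto_add[OF limit_average[OF xy] limit_average[OF y]] by simp
    qed
    show "limit_average (op_scaleC c x) = op_scaleC c (limit_average x)"
    proof (rule LIMSEQ_unique)
      show "(\<lambda>N. average N (op_scaleC c x)) \<longlonglongrightarrow> limit_average (op_scaleC c x)"
        by (rule limit_average[OF cstar_scaleC[OF cstar xy]])
      note lin = bounded_linear.linear[OF bounded_linear_op_scaleC[of c]]
      have "average N (op_scaleC c x) = op_scaleC c (average N x)" for N
        by (simp add: average_def power_scaleC xy linear_scale[OF lin] linear_sum[OF lin])
      then show "(\<lambda>N. average N (op_scaleC c x)) \<longlonglongrightarrow> op_scaleC c (limit_average x)"
        using bounded_linear.tendsto[OF bounded_linear_op_scaleC limit_average[OF xy]] by simp
    qed
  qed
  fix x \<phi> assume x: "x \<in> fields" and \<phi>: "\<phi> \<in> states fields"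
  have "cmod (\<phi> (average N x) - \<phi> (limit_average x)) \<le> norm (average N x - limit_average x)" for N
    using state_norm_le[OF cstar \<phi> fields_diff[OF average_mem[OF x] limit_average_mem[OF x]]]
    by (simp add: state_diff[OF cstar \<phi> average_mem[OF x] limit_average_mem[OF x]])
  moreover have "(\<lambda>N. norm (average N x - limit_average x)) \<longlonglongrightarrow> 0"
    using limit_average[OF x] by (simp add: LIM_zero tendsto_norm_zero)
  ultimately have "(\<lambda>N. \<phi> (average N x) - \<phi> (limit_average x)) \<longlonglongrightarrow> 0"
    by (rule Lim_null_comparison[OF always_eventually[OF allI]])
  then have "(\<lambda>N. \<phi> (average N x)) \<longlonglongrightarrow> \<phi> (limit_average x)" by (rule LIM_zero_cancel)
  then show "(\<lambda>n. (\<Sum>k<n. \<phi> ((\<alpha> ^^ k) x)) / of_nat n) \<longlonglongrightarrow> \<phi> (limit_average x)"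
    by (simp only: state_average[OF \<phi> x])
qed

text \<open>The difference \<open>\<alpha>(A\<^sub>N x) - A\<^sub>N x = (\<alpha>\<^sup>N(x) - x) / N\<close> tends to zero.\<close>

lemma limit_average_fixed:
  assumes x: "x \<in> fields" shows "limit_average x \<in> fixed_point_algebra fields \<alpha>"
proof -
  let ?E = "limit_average x"
  note E = limit_average_mem[OF x]
  have sub: "subspace fields" by (rule cstar_subspace[OF cstar])
  have \<alpha>_avg: "\<alpha> (average N x) - average N x = (1 / real N) *\<^sub>R ((\<alpha> ^^ N) x - x)" for N
  proof -
    have \<alpha>_sum: "\<alpha> (\<Sum>k<N. (\<alpha> ^^ k) x) = (\<Sum>k<N. (\<alpha> ^^ Suc k) x)" for N
    proof (induction N)
      case 0
      show ?case using automorphism_add[OF aut subspace_0[OF sub] subspace_0[OF sub]] by simp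
    next
      case (Suc N)
      then show ?case
        using automorphism_add[OF aut subspace_sum[OF sub, of "{..<N}" "\<lambda>k. (\<alpha> ^^ k) x"] power_mem[OF x, of N]]
        by (simp add: power_mem[OF x])
    qed
    have "\<alpha> (average N x) = (1 / real N) *\<^sub>R \<alpha> (\<Sum>k<N. (\<alpha> ^^ k) x)"
      unfolding average_def op_scaleC_of_real[symmetric]
      by (rule automorphism_scaleC[OF aut]) (intro subspace_sum[OF sub] power_mem x)
    then have "\<alpha> (average N x) - average N x = (1 / real N) *\<^sub>R (\<Sum>k<N. (\<alpha> ^^ Suc k) x - (\<alpha> ^^ k) x)"
      by (simp only: average_def \<alpha>_sum sum_subtractf scaleR_diff_right)
    also have "(\<Sum>k<N. (\<alpha> ^^ Suc k) x - (\<alpha> ^^ k) x) = (\<alpha> ^^ N) x - (\<alpha> ^^ 0) x"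
      by (rule sum_lessThan_telescope)
    finally show ?thesis by simp
  qed
  have bound: "norm (\<alpha> ?E - ?E) \<le> 2 * norm (?E - average N x) + (2 * norm x) / real N" for N
  proof -
    note A = average_mem[OF x, of N]
    have "\<alpha> ?E - ?E = \<alpha> (?E - average N x) + (\<alpha> (average N x) - average N x) - (?E - average N x)"
      using automorphism_add[OF aut fields_diff[OF E A] A] by simp
    then have "norm (\<alpha> ?E - ?E) \<le> norm (\<alpha> (?E - average N x)) + norm (\<alpha> (average N x) - average N x) + norm (?E - average N x)"
      by (rule norm_add_diff_le)
    moreover have "norm (\<alpha> (?E - average N x)) \<le> norm (?E - average N x)"
      by (rule automorphism_norm_le[OF cstar aut fields_diff[OF E A]])
    moreover have "norm (\<alpha> (average N x) - average N x) \<le> (2 * norm x) / real N"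
    proof -
      have "norm ((\<alpha> ^^ N) x - x) \<le> 2 * norm x"
        using norm_triangle_ineq4[of "(\<alpha> ^^ N) x" x] power_norm_le[OF x, of N] by linarith
      then show ?thesis unfolding \<alpha>_avg by (simp add: divide_right_mono)
    qed
    ultimately show ?thesis by linarith
  qed
  have lim: "(\<lambda>N. 2 * norm (?E - average N x) + (2 * norm x) / real N) \<longlonglongrightarrow> 2 * norm (?E - ?E) + 0"
    by (intro tendsto_intros limit_average[OF x] lim_const_over_n)
  have "norm (\<alpha> ?E - ?E) \<le> 2 * norm (?E - ?E) + 0"
    by (rule tendsto_lowerbound[OF lim always_eventually[OF allI[OF bound]] sequentially_bot])
  then show ?thesis using E by (simp add: fixed_point_algebra_def)
qed

lemma vacuum_state: "vacuum_state word \<in> states fields"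
  using vector_state[OF cstar norm_vacuum] by (simp add: vacuum_state_def[abs_def])

lemma state_power_diff_le:
  assumes x: "x \<in> fields" and y: "y \<in> fields" and \<phi>: "\<phi> \<in> states fields"
  shows "cmod (\<phi> ((\<alpha> ^^ k) x) - \<phi> ((\<alpha> ^^ k) y)) \<le> norm (x - y)"
proof -
  have "\<phi> ((\<alpha> ^^ k) x) - \<phi> ((\<alpha> ^^ k) y) = \<phi> ((\<alpha> ^^ k) (x - y))"
    by (simp add: power_diff[OF x y] state_diff[OF cstar \<phi> power_mem[OF x] power_mem[OF y]])
  also have "cmod \<dots> \<le> norm ((\<alpha> ^^ k) (x - y))"
    by (rule state_norm_le[OF cstar \<phi> power_mem[OF fields_diff[OF x y]]])
  also have "\<dots> \<le> norm (x - y)" by (rule power_norm_le[OF fields_diff[OF x y]])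
  finally show ?thesis .
qed

lemma vacuum_invariant_power:
  assumes x: "x \<in> fields" shows "vacuum_state word ((\<alpha> ^^ k) x) = vacuum_state word x"
proof -
  let ?\<omega> = "vacuum_state word"
  have "cmod (?\<omega> ((\<alpha> ^^ k) x) - ?\<omega> x) \<le> 0"
  proof (rule field_le_epsilon)
    fix e :: real assume "0 < e"
    then obtain y where y: "y \<in> fields" "normal_orderable (\<lambda>k. (\<alpha> ^^ k) y)" "norm (x - y) < e / 2"
      using normal_orderable_approximation[OF x, of "e / 2"] by auto
    have "?\<omega> ((\<alpha> ^^ k) y) = ?\<omega> y" using normal_orderable_vacuum_constant[OF y(2), of k] by simp
    then have "?\<omega> ((\<alpha> ^^ k) x) - ?\<omega> x = (?\<omega> ((\<alpha> ^^ k) x) - ?\<omega> ((\<alpha> ^^ k) y)) - (?\<omega> ((\<alpha> ^^ 0) x) - ?\<omega> ((\<alpha> ^^ 0) y))"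
      by simp
    then have "cmod (?\<omega> ((\<alpha> ^^ k) x) - ?\<omega> x) \<le> cmod (?\<omega> ((\<alpha> ^^ k) x) - ?\<omega> ((\<alpha> ^^ k) y)) + cmod (?\<omega> ((\<alpha> ^^ 0) x) - ?\<omega> ((\<alpha> ^^ 0) y))"
      by (simp only: norm_triangle_ineq4)
    then show "cmod (?\<omega> ((\<alpha> ^^ k) x) - ?\<omega> x) \<le> 0 + e"
      using state_power_diff_le[OF x y(1) vacuum_state, of k] state_power_diff_le[OF x y(1) vacuum_state, of 0] y(3) by linarith
  qed
  then show ?thesis by simp
qed

text \<open>Weights of modulus at most one turn the averages of \<open>|\<phi>(\<alpha>\<^sup>k(x)) - \<omega>(x)|\<close> into values of \<open>\<phi>\<close> on
  weighted averages of operators, which are small in norm.\<close>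

lemma states_converge_in_mean:
  assumes r: "correlations_vanish r" and x: "x \<in> fields" and \<phi>: "\<phi> \<in> states fields"
  shows "mean_null (\<lambda>k. \<phi> ((\<alpha> ^^ r k) x) - vacuum_state word x)"
proof (rule mean_null_uniform_limit)
  fix e :: real assume "0 < e"
  let ?\<omega> = "vacuum_state word"
  obtain y where y: "y \<in> fields" "normal_orderable (\<lambda>k. (\<alpha> ^^ k) y)" "norm (x - y) < e / 2"
    using normal_orderable_approximation[OF x, of "e / 2"] \<open>0 < e\<close> by auto
  define z where "z k = (\<alpha> ^^ r k) y - op_scaleC (?\<omega> y) id_blinfun" for k
  have z: "z k \<in> fields" for k unfolding z_def by (intro fields_diff power_mem y cstar_scaleC cstar cstar_id)
  have \<phi>z: "\<phi> (z k) = \<phi> ((\<alpha> ^^ r k) y) - ?\<omega> y" for k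
    unfolding z_def using state_diff[OF cstar \<phi> power_mem[OF y(1), of "r k"] cstar_scaleC[OF cstar cstar_id[OF cstar], of "?\<omega> y"]]
      state_scaleC[OF \<phi> cstar_id[OF cstar], of "?\<omega> y"] by (simp add: state_id[OF \<phi>])
  obtain c where c: "\<And>k. cmod (c k) \<le> 1" and c\<phi>: "\<And>k. c k * \<phi> (z k) = of_real (cmod (\<phi> (z k)))"
    using phase_exists[of "\<phi> (z k)" for k] by metis
  have lim: "(\<lambda>N. (1 / real N) *\<^sub>R (\<Sum>k<N. op_scaleC (c k) (z k))) \<longlonglongrightarrow> 0"
    using normal_orderable_weighted_averages[OF y(2) r c] by (simp add: z_def vacuum_invariant_power[OF y(1)])
  have bound: "norm ((\<Sum>k<N. cmod (\<phi> (z k))) / real N) \<le> norm ((1 / real N) *\<^sub>R (\<Sum>k<N. op_scaleC (c k) (z k)))" for N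
  proof -
    have m: "op_scaleC (c k) (z k) \<in> fields" for k by (rule cstar_scaleC[OF cstar z])
    then have s: "(\<Sum>k<N. op_scaleC (c k) (z k)) \<in> fields" by (intro subspace_sum[OF cstar_subspace[OF cstar]])
    have "\<phi> (\<Sum>k<N. op_scaleC (c k) (z k)) = of_real (\<Sum>k<N. cmod (\<phi> (z k)))"
      by (simp add: state_sum[OF \<phi> m] state_scaleC[OF \<phi> z] c\<phi>)
    then have "cmod (of_real (\<Sum>k<N. cmod (\<phi> (z k)))) \<le> norm (\<Sum>k<N. op_scaleC (c k) (z k))"
      using state_norm_le[OF cstar \<phi> s] by metis
    then have "\<bar>\<Sum>k<N. cmod (\<phi> (z k))\<bar> \<le> norm (\<Sum>k<N. op_scaleC (c k) (z k))" by (simp only: norm_of_real)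
    then show ?thesis by (simp add: divide_right_mono)
  qed
  have "mean_null (\<lambda>k. cmod (\<phi> (z k)))"
    unfolding mean_null_def using Lim_null_comparison[OF always_eventually[OF allI[OF bound]]] tendsto_norm_zero[OF lim] by simp
  moreover have "norm (\<phi> ((\<alpha> ^^ r k) x) - ?\<omega> x) \<le> norm (cmod (\<phi> (z k))) + e" for k
  proof -
    have "\<phi> ((\<alpha> ^^ r k) x) - ?\<omega> x = \<phi> (z k) + (\<phi> ((\<alpha> ^^ r k) x) - \<phi> ((\<alpha> ^^ r k) y)) - (?\<omega> ((\<alpha> ^^ 0) x) - ?\<omega> ((\<alpha> ^^ 0) y))"
      by (simp add: \<phi>z)
    then have "cmod (\<phi> ((\<alpha> ^^ r k) x) - ?\<omega> x) \<le> cmod (\<phi> (z k)) + cmod (\<phi> ((\<alpha> ^^ r k) x) - \<phi> ((\<alpha> ^^ r k) y))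
        + cmod (?\<omega> ((\<alpha> ^^ 0) x) - ?\<omega> ((\<alpha> ^^ 0) y))"
      by (rule norm_add_diff_le)
    then show ?thesis
      using state_power_diff_le[OF x y(1) \<phi>, of "r k"] state_power_diff_le[OF x y(1) vacuum_state, of 0] y(3)
      unfolding real_norm_def abs_norm_cancel by linarith
  qed
  ultimately show "\<exists>b :: nat \<Rightarrow> real. mean_null b \<and> (\<forall>k. norm (\<phi> ((\<alpha> ^^ r k) x) - ?\<omega> x) \<le> norm (b k) + e)" by blast
qed

lemma cinner_power_diff: "i \<le> j \<Longrightarrow> cinner ((U ^^ j) h) ((U ^^ i) h) = cinner ((U ^^ (j - i)) h) h"
  using isometry_power[of i "(U ^^ (j - i)) h" h] by (simp flip: funpow_add comp_apply[of "U ^^ i"])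

lemma correlations_vanish_if_mean_null:
  assumes "\<And>h. mean_null (\<lambda>n. cinner ((U ^^ n) h) h)"
  shows "correlations_vanish (\<lambda>k. k)"
  unfolding correlations_vanish_def
proof
  fix h
  show "(\<lambda>N. (\<Sum>i<N. \<Sum>j<N. cmod (cinner ((U ^^ i) h) ((U ^^ j) h))) / (real N)\<^sup>2) \<longlonglongrightarrow> 0"
  proof (rule double_mean_tendsto_0)
    show "mean_null (\<lambda>n. cmod (cinner ((U ^^ n) h) h))" using assms[of h] by (simp add: mean_null_def)
    fix i j :: nat assume ij: "i \<le> j"
    show "cmod (cinner ((U ^^ j) h) ((U ^^ i) h)) \<le> cmod (cinner ((U ^^ (j - i)) h) h)"
      using cinner_power_diff[OF ij, of h] by simp
    then show "cmod (cinner ((U ^^ i) h) ((U ^^ j) h)) \<le> cmod (cinner ((U ^^ (j - i)) h) h)"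
      by (metis cinner_commute complex_mod_cnj)
  qed simp
qed

text \<open>For strictly increasing \<open>r\<close> the gaps \<open>r\<^sub>j - r\<^sub>i\<close> are at least \<open>j - i\<close>, so the correlations are dominated
  by a function of \<open>j - i\<close>, the supremum \<open>\<delta>\<close> of the tail.\<close>

lemma correlations_vanish_if_tendsto:
  assumes lim: "\<And>h. (\<lambda>n. cinner ((U ^^ n) h) h) \<longlonglongrightarrow> 0" and r: "strict_mono r"
  shows "correlations_vanish r"
  unfolding correlations_vanish_def
proof
  fix h
  define \<gamma> where "\<gamma> n = cmod (cinner ((U ^^ n) h) h)" for n
  define \<delta> where "\<delta> n = (SUP m\<in>{n..}. \<gamma> m)" for n
  have "\<gamma> n \<le> (norm h)\<^sup>2" for n
  proof -
    have "norm ((U ^^ n) h) = norm h"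
      using isometry_power[of n h h] unfolding cinner_self of_real_eq_iff by simp
    then show ?thesis using norm_cinner_le[of "(U ^^ n) h" h] by (simp add: \<gamma>_def power2_eq_square)
  qed
  then have bdd: "bdd_above (\<gamma> ` {n..})" for n by (intro bdd_aboveI[of _ "(norm h)\<^sup>2"]) auto
  have le: "\<gamma> m \<le> \<delta> n" if "n \<le> m" for m n unfolding \<delta>_def using that by (intro cSUP_upper bdd) auto
  have "\<delta> \<longlonglongrightarrow> 0"
  proof (rule LIMSEQ_I)
    fix e :: real assume e: "0 < e"
    obtain n where n: "\<And>m. m \<ge> n \<Longrightarrow> \<gamma> m < e / 2"
      using LIMSEQ_D[OF lim[of h], of "e / 2"] e by (auto simp: \<gamma>_def)
    have "norm (\<delta> k - 0) < e" if "k \<ge> n" for k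
    proof -
      have "\<delta> k \<le> e / 2" unfolding \<delta>_def using n that by (intro cSUP_least) (auto intro: less_imp_le)
      moreover have "0 \<le> \<delta> k" using le[of k k] by (simp add: \<gamma>_def) (metis norm_ge_zero order_trans)
      ultimately show ?thesis using e by simp
    qed
    then show "\<exists>no. \<forall>k\<ge>no. norm (\<delta> k - 0) < e" by blast
  qed
  then have \<delta>: "mean_null \<delta>" by (rule mean_null_if_tendsto_0)
  have gap: "j - i \<le> r j - r i" "r i \<le> r j" if ij: "i \<le> j" for i j
  proof -
    have "r i + d \<le> r (i + d)" for d
    proof (induction d)
      case (Suc d)
      have "r (i + d) < r (i + Suc d)" using r by (auto simp: strict_mono_def)
      then show ?case using Suc by linarith
    qed simp
    from this[of "j - i"] show "j - i \<le> r j - r i" "r i \<le> r j" using ij by auto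
  qed
  show "(\<lambda>N. (\<Sum>i<N. \<Sum>j<N. cmod (cinner ((U ^^ r i) h) ((U ^^ r j) h))) / (real N)\<^sup>2) \<longlonglongrightarrow> 0"
  proof (rule double_mean_tendsto_0[OF \<delta>])
    fix i j :: nat assume ij: "i \<le> j"
    show "cmod (cinner ((U ^^ r j) h) ((U ^^ r i) h)) \<le> \<delta> (j - i)"
      using cinner_power_diff[OF gap(2)[OF ij], of h] le[OF gap(1)[OF ij]] by (simp add: \<gamma>_def)
    then show "cmod (cinner ((U ^^ r i) h) ((U ^^ r j) h)) \<le> \<delta> (j - i)"
      by (metis cinner_commute complex_mod_cnj)
  qed simp
qed

lemma state_scalar: "\<phi> \<in> states fields \<Longrightarrow> \<phi> (op_scaleC c id_blinfun) = c"
  using state_scaleC[OF _ cstar_id[OF cstar], of \<phi> c] by (simp add: state_id)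

lemma uniquely_weak_mixing_if:
  assumes "\<And>h. mean_null (\<lambda>n. cinner ((U ^^ n) h) h)"
  shows "uniquely_weak_mixing fields \<alpha>"
  unfolding uniquely_weak_mixing_def Let_def
  using states_converge_in_mean[OF correlations_vanish_if_mean_null[OF assms]]
  by (intro bexI[OF _ vacuum_state]) (simp add: state_scalar mean_null_def)

lemma unique_invariant_state_if:
  assumes "\<And>h. mean_null (\<lambda>n. cinner ((U ^^ n) h) h)"
  shows "is_unique_invariant_state fields \<alpha> (vacuum_state word)"
  unfolding is_unique_invariant_state_def
proof (intro conjI ballI impI)
  show "vacuum_state word (\<alpha> x) = vacuum_state word x" if "x \<in> fields" for x
    using vacuum_invariant_power[OF that, of 1] by simp
  fix \<phi> x assume \<phi>: "\<phi> \<in> states fields" and inv: "\<forall>x\<in>fields. \<phi> (\<alpha> x) = \<phi> x" and x: "x \<in> fields"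
  have "\<phi> ((\<alpha> ^^ k) x) = \<phi> x" for k
    by (induction k) (auto simp: inv power_mem[OF x])
  then have "mean_null (\<lambda>k. \<phi> x - vacuum_state word x)"
    using states_converge_in_mean[OF correlations_vanish_if_mean_null[OF assms] x \<phi>] by simp
  then have "(\<lambda>N. (1 / real N) *\<^sub>R (\<Sum>k<N. \<phi> x - vacuum_state word x)) \<longlonglongrightarrow> 0"
    by (rule mean_null_imp_tendsto_0)
  moreover have "\<forall>\<^sub>F N in sequentially. (1 / real N) *\<^sub>R (\<Sum>k<N. \<phi> x - vacuum_state word x) = \<phi> x - vacuum_state word x"
    using eventually_gt_at_top[of 0] by eventually_elim (simp add: scaleR_conv_of_real)
  ultimately have "(\<lambda>N :: nat. \<phi> x - vacuum_state word x) \<longlonglongrightarrow> 0" by (rule Lim_transform_eventually)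
  then show "\<phi> x = vacuum_state word x" by (simp add: LIMSEQ_const_iff)
qed (rule vacuum_state)

lemma uniquely_mixing_if:
  assumes "\<And>h. (\<lambda>n. cinner ((U ^^ n) h) h) \<longlonglongrightarrow> 0"
  shows "uniquely_mixing fields \<alpha>"
  unfolding uniquely_mixing_def Let_def
proof (intro bexI[OF _ vacuum_state] ballI)
  fix x \<phi> assume x: "x \<in> fields" and \<phi>: "\<phi> \<in> states fields"
  have "(\<lambda>n. \<phi> ((\<alpha> ^^ n) x) - vacuum_state word x) \<longlonglongrightarrow> 0"
    unfolding tendsto_0_iff_mean_null_subseq
    using states_converge_in_mean[OF correlations_vanish_if_tendsto[OF assms] x \<phi>] by blast
  then show "(\<lambda>n. \<phi> ((\<alpha> ^^ n) x)) \<longlonglongrightarrow> \<phi> (op_scaleC (vacuum_state word x) id_blinfun)"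
    by (simp add: state_scalar[OF \<phi>] LIM_zero_cancel)
qed

lemma field_op_vacuum: "field_op word h (word []) = word [h]"
  by (simp add: field_op_def blinfun.add_left)

text \<open>The expectation of \<open>s(f)\<close> in \<open>\<Omega> + g\<close> is \<open>2 Re \<langle>f, g\<rangle>\<close>, because \<open>s(f)\<close> changes the number of
  particles by one.  Its limit along the orbit of \<open>h\<close> is a multiple of the limit of the expectations in
  \<open>\<Omega>\<close>, which are zero.\<close>

lemma uniquely_mixing_imp_tendsto:
  assumes mix: "uniquely_mixing fields \<alpha>" and h: "h \<in> S"
  shows "(\<lambda>n. inner ((U ^^ n) h) g) \<longlonglongrightarrow> 0"
proof -
  obtain l where l: "\<And>\<phi>. \<phi> \<in> states fields \<Longrightarrow> (\<lambda>n. \<phi> (field_op word ((U ^^ n) h))) \<longlonglongrightarrow> l"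
  proof -
    obtain \<omega> where "\<forall>x\<in>fields. \<forall>\<phi>\<in>states fields. (\<lambda>n. \<phi> ((\<alpha> ^^ n) x)) \<longlonglongrightarrow> \<phi> (op_scaleC (\<omega> x) id_blinfun)"
      using mix unfolding uniquely_mixing_def Let_def by blast
    from bspec[OF this field_op_mem[OF h]] have "(\<lambda>n. \<phi> (field_op word ((U ^^ n) h))) \<longlonglongrightarrow> \<omega> (field_op word h)"
      if "\<phi> \<in> states fields" for \<phi>
      using that by (auto simp: power_field_op[OF h] state_scalar)
    then show ?thesis using that by blast
  qed
  have expect: "(\<lambda>n. cinner (field_op word ((U ^^ n) h) v) v) \<longlonglongrightarrow> l * of_real ((norm v)\<^sup>2)" if v: "v \<noteq> 0" for v
  proof -
    define w where "w = inverse (norm v) *\<^sub>R v"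
    have "norm w = 1" using v by (simp add: w_def)
    from l[OF vector_state[OF cstar this]]
    have "(\<lambda>n. cinner (field_op word ((U ^^ n) h) w) w * of_real ((norm v)\<^sup>2)) \<longlonglongrightarrow> l * of_real ((norm v)\<^sup>2)"
      by (intro tendsto_mult tendsto_const)
    moreover have "cinner (field_op word ((U ^^ n) h) w) w * of_real ((norm v)\<^sup>2) = cinner (field_op word ((U ^^ n) h) v) v" for n
      using v by (simp add: w_def blinfun.scaleR_right cinner.scaleR_left cinner.scaleR_right scaleR_conv_of_real field_simps power2_eq_square)
    ultimately show ?thesis by simp
  qed
  have "(\<lambda>n. cinner (field_op word ((U ^^ n) h) (word [])) (word [])) \<longlonglongrightarrow> l"
    by (rule l[OF vector_state[OF cstar norm_vacuum]])
  then have l0: "l = 0"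
    by (simp add: field_op_vacuum cinner_word_length LIMSEQ_const_iff)
  define v where "v = word [] + word [g]"
  have v: "cinner (field_op word f v) v = cinner f g + cinner g f" for f
  proof -
    have fg: "field_op word f (word [g]) = cinner g f *\<^sub>C word [] + word [f, g]"
      by (simp add: field_op_def blinfun.add_left annihilator_word_Cons)
    show ?thesis
      by (simp add: v_def blinfun.add_right field_op_vacuum fg cinner_add_left cinner_add_right
          cinner_scaleC_left cinner_word_length)
  qed
  have "cinner v (word []) = 1" by (simp add: v_def cinner_add_left cinner_word_length)
  then have "v \<noteq> 0" by (auto simp: cinner.zero_left)
  from expect[OF this] have "(\<lambda>n. cinner ((U ^^ n) h) g + cinner g ((U ^^ n) h)) \<longlonglongrightarrow> 0" by (simp add: v l0)
  from tendsto_Re[OF this] have "(\<lambda>n. inner ((U ^^ n) h) g * 2) \<longlonglongrightarrow> 0" by (simp add: Re_cinner inner_commute)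
  then show ?thesis using tendsto_mult_right_zero[of _ _ "1/2"] by fastforce
qed

text \<open>If the fixed points are scalars, then the averages of \<open>s(U\<^sup>k h)\<^sup>2\<close> tend to a scalar, so that their
  two-particle component tends to zero.\<close>

lemma trivial_fixed_points_imp_squares_average_to_zero:
  assumes triv: "\<not> nontrivial_algebra (fixed_point_algebra fields \<alpha>)" and h: "h \<in> S"
  shows "(\<lambda>N. (1 / real N) *\<^sub>R (\<Sum>k<N. (cinner ((U ^^ k) h) g)\<^sup>2)) \<longlonglongrightarrow> 0"
proof -
  define x where "x = field_op word h o\<^sub>L field_op word h"
  have x: "x \<in> fields" unfolding x_def by (intro cstar_compose cstar field_op_mem h)
  obtain c where c: "limit_average x = op_scaleC c id_blinfun"
    using limit_average_fixed[OF x] triv by (auto simp: nontrivial_algebra_def)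
  have "(\<lambda>N. cinner (average N x (word [])) (word [g, g])) \<longlonglongrightarrow> cinner (limit_average x (word [])) (word [g, g])"
    by (intro cinner.tendsto tendsto_const blinfun.tendsto limit_average[OF x])
  moreover have "cinner (limit_average x (word [])) (word [g, g]) = 0"
    by (simp add: c cinner_scaleC_left cinner_word_length)
  moreover have "cinner (average N x (word [])) (word [g, g]) = (1 / real N) *\<^sub>R (\<Sum>k<N. (cinner ((U ^^ k) h) g)\<^sup>2)" for N
  proof -
    have "cinner ((\<alpha> ^^ k) x (word [])) (word [g, g]) = (cinner ((U ^^ k) h) g)\<^sup>2" for k
    proof -
      have "(\<alpha> ^^ k) x = field_op word ((U ^^ k) h) o\<^sub>L field_op word ((U ^^ k) h)"
        by (simp add: x_def power_compose field_op_mem power_field_op h)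
      then show ?thesis
        by (simp add: field_op_vacuum)
          (simp add: field_op_def blinfun.add_left annihilator_word_Cons cinner_add_left cinner_scaleC_left
            cinner_word_length power2_eq_square)
    qed
    then show ?thesis
      by (simp add: average_def blinfun.scaleR_left blinfun.sum_left cinner.scaleR_left cinner.sum_left)
  qed
  ultimately show ?thesis by simp
qed

end

section \<open>Correlations of the classical system\<close>

lemma integrable_mult_L2:
  fixes f g :: "'a \<Rightarrow> real"
  assumes f: "f \<in> L2 M" and g: "g \<in> L2 M"
  shows "integrable M (\<lambda>x. f x * g x)" "\<bar>\<integral>x. f x * g x \<partial>M\<bar> \<le> (\<integral>x. (f x)\<^sup>2 \<partial>M) + (\<integral>x. (g x)\<^sup>2 \<partial>M)"
proof -
  have m: "f \<in> borel_measurable M" "g \<in> borel_measurable M"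
    and i: "integrable M (\<lambda>x. (f x)\<^sup>2)" "integrable M (\<lambda>x. (g x)\<^sup>2)"
    using f g by (auto simp: L2_def)
  have le: "\<bar>f x * g x\<bar> \<le> (f x)\<^sup>2 + (g x)\<^sup>2" for x
  proof -
    have "2 * (\<bar>f x\<bar> * \<bar>g x\<bar>) \<le> (f x)\<^sup>2 + (g x)\<^sup>2"
      using sum_squares_bound[of "\<bar>f x\<bar>" "\<bar>g x\<bar>"] by (simp add: mult.assoc)
    moreover have "0 \<le> \<bar>f x\<bar> * \<bar>g x\<bar>" by simp
    ultimately show ?thesis unfolding abs_mult by linarith
  qed
  show int: "integrable M (\<lambda>x. f x * g x)"
    by (rule Bochner_Integration.integrable_bound[OF Bochner_Integration.integrable_add[OF i]])
      (use m le in auto)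
  have "\<bar>\<integral>x. f x * g x \<partial>M\<bar> \<le> (\<integral>x. \<bar>f x * g x\<bar> \<partial>M)" using integral_norm_bound[of M "\<lambda>x. f x * g x"] by simp
  also have "\<dots> \<le> (\<integral>x. (f x)\<^sup>2 + (g x)\<^sup>2 \<partial>M)" using le i int by (intro integral_mono) auto
  finally show "\<bar>\<integral>x. f x * g x \<partial>M\<bar> \<le> (\<integral>x. (f x)\<^sup>2 \<partial>M) + (\<integral>x. (g x)\<^sup>2 \<partial>M)" using i by simp
qed

lemma koopman_power_comp: "(koopman M T ^^ n) (\<lambda>x. g (f x)) = (\<lambda>x. g ((koopman M T ^^ n) f x))"
  by (induction n) (auto simp: koopman_def)

definition real_correlation :: "'a measure \<Rightarrow> ('a \<Rightarrow> 'a) \<Rightarrow> ('a \<Rightarrow> real) \<Rightarrow> ('a \<Rightarrow> real) \<Rightarrow> nat \<Rightarrow> real" where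
  "real_correlation M T f g n = (\<integral>x. (koopman M T ^^ n) f x * g x \<partial>M)"

locale classical_dynamics = prob_space M for M :: "'a measure" +
  fixes T :: "'a \<Rightarrow> 'a"
  assumes system: "classical_system M T"
begin

lemma inverse_measurable: "the_inv_into (space M) T \<in> M \<rightarrow>\<^sub>M M"
  using system by (simp add: classical_system_def)

lemma distr_inverse: "distr M M (the_inv_into (space M) T) = M"
proof -
  let ?S = "the_inv_into (space M) T"
  have T: "bij_betw T (space M) (space M)" "T \<in> M \<rightarrow>\<^sub>M M" "distr M M T = M"
    using system by (auto simp: classical_system_def)
  have "distr M M ?S = distr (distr M M T) M ?S" by (simp only: T(3))
  also have "\<dots> = distr M M (?S \<circ> T)" by (rule distr_distr[OF inverse_measurable T(2)])
  also have "\<dots> = distr M M (\<lambda>x. x)"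
    using T(1) by (intro distr_cong) (auto simp: bij_betw_def the_inv_into_f_f)
  finally show ?thesis by (simp add: distr_id2)
qed

lemma koopman_measurable: "f \<in> borel_measurable M \<Longrightarrow> koopman M T f \<in> borel_measurable M"
  unfolding koopman_def by (rule measurable_compose[OF inverse_measurable])

lemma koopman_integral:
  fixes f :: "'a \<Rightarrow> 'b::{banach, second_countable_topology}"
  assumes "f \<in> borel_measurable M"
  shows "(\<integral>x. koopman M T f x \<partial>M) = (\<integral>x. f x \<partial>M)"
  using integral_distr[OF inverse_measurable assms] by (simp add: distr_inverse koopman_def)

lemma koopman_integrable:
  fixes f :: "'a \<Rightarrow> 'b::{banach, second_countable_topology}"
  assumes "integrable M f"
  shows "integrable M (koopman M T f)"
  using integrable_distr[OF inverse_measurable, of f] assms by (simp add: distr_inverse koopman_def)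

lemma koopman_L2_0: "f \<in> L2_0 M \<Longrightarrow> koopman M T f \<in> L2_0 M"
  using koopman_integrable[of "\<lambda>x. (norm (f x))\<^sup>2"]
  by (auto simp: L2_0_def L2_def koopman_measurable koopman_integral) (simp add: koopman_def)

lemma koopman_inner:
  assumes "f \<in> L2_0 M" "g \<in> L2_0 M"
  shows "(\<integral>x. koopman M T f x * koopman M T g x \<partial>M) = (\<integral>x. f x * g x \<partial>M :: real)"
  using koopman_integral[of "\<lambda>x. f x * g x"] assms by (auto simp: L2_0_def L2_def koopman_def)

lemma koopman_power_L2_0: "f \<in> L2_0 M \<Longrightarrow> (koopman M T ^^ n) f \<in> L2_0 M"
  by (induction n) (auto intro: koopman_L2_0)

lemma real_correlation_bound:
  assumes f: "f \<in> L2_0 M" and g: "g \<in> L2_0 M"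
  shows "\<bar>real_correlation M T f g n\<bar> \<le> (\<integral>x. (f x)\<^sup>2 \<partial>M) + (\<integral>x. (g x)\<^sup>2 \<partial>M)"
proof -
  have "(\<integral>x. ((koopman M T ^^ n) f x)\<^sup>2 \<partial>M) = (\<integral>x. (f x)\<^sup>2 \<partial>M)"
  proof (induction n)
    case (Suc n)
    then show ?case
      using koopman_inner[OF koopman_power_L2_0[OF f] koopman_power_L2_0[OF f], of n n]
      by (simp add: power2_eq_square)
  qed simp
  then show ?thesis
    using integrable_mult_L2(2)[of "(koopman M T ^^ n) f" M g] koopman_power_L2_0[OF f, of n] g
    by (simp add: real_correlation_def L2_0_def)
qed

lemma
  fixes \<xi> :: "'a \<Rightarrow> complex"
  assumes "\<xi> \<in> L2_0 M"
  shows Re_L2_0: "(\<lambda>x. Re (\<xi> x)) \<in> L2_0 M" and Im_L2_0: "(\<lambda>x. Im (\<xi> x)) \<in> L2_0 M"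
proof -
  have m: "\<xi> \<in> borel_measurable M" and i: "integrable M (\<lambda>x. (norm (\<xi> x))\<^sup>2)" and z: "(\<integral>x. \<xi> x \<partial>M) = 0"
    using assms by (auto simp: L2_0_def L2_def)
  have "integrable M (\<lambda>x. 1 + (norm (\<xi> x))\<^sup>2)" using i by simp
  then have int: "integrable M \<xi>"
  proof (rule Bochner_Integration.integrable_bound[OF _ m])
    have "norm (\<xi> x) \<le> 1 + (norm (\<xi> x))\<^sup>2" for x
    proof -
      have "2 * norm (\<xi> x) \<le> (norm (\<xi> x))\<^sup>2 + 1" using sum_squares_bound[of "norm (\<xi> x)" 1] by simp
      then show ?thesis using norm_ge_zero[of "\<xi> x"] by linarith
    qed
    then show "AE x in M. norm (\<xi> x) \<le> norm (1 + (norm (\<xi> x))\<^sup>2)" by simp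
  qed
  have "integrable M (\<lambda>x. (Re (\<xi> x))\<^sup>2)" "integrable M (\<lambda>x. (Im (\<xi> x))\<^sup>2)"
    by (rule Bochner_Integration.integrable_bound[OF i]; use m in \<open>auto simp: cmod_power2\<close>)+
  then show "(\<lambda>x. Re (\<xi> x)) \<in> L2_0 M" "(\<lambda>x. Im (\<xi> x)) \<in> L2_0 M"
    using m z int by (auto simp: L2_0_def L2_def)
qed

lemma of_real_L2_0: "f \<in> L2_0 M \<Longrightarrow> (\<lambda>x. complex_of_real (f x)) \<in> L2_0 M"
  by (auto simp: L2_0_def L2_def)

lemma correlation_of_real:
  "correlation M T (\<lambda>x. complex_of_real (f x)) (\<lambda>x. complex_of_real (g x)) n = of_real (real_correlation M T f g n)"
  unfolding correlation_def real_correlation_def koopman_power_comp by (simp flip: of_real_mult)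

lemma correlation_real_parts:
  assumes \<xi>: "\<xi> \<in> L2_0 M" and \<eta>: "\<eta> \<in> L2_0 M"
  shows "correlation M T \<xi> \<eta> n =
    of_real (real_correlation M T (\<lambda>x. Re (\<xi> x)) (\<lambda>x. Re (\<eta> x)) n + real_correlation M T (\<lambda>x. Im (\<xi> x)) (\<lambda>x. Im (\<eta> x)) n)
    + \<i> * of_real (real_correlation M T (\<lambda>x. Im (\<xi> x)) (\<lambda>x. Re (\<eta> x)) n - real_correlation M T (\<lambda>x. Re (\<xi> x)) (\<lambda>x. Im (\<eta> x)) n)"
proof -
  let ?u = "(koopman M T ^^ n) \<xi>"
  have L: "(\<lambda>x. Re (?u x)) \<in> L2 M" "(\<lambda>x. Im (?u x)) \<in> L2 M" "(\<lambda>x. Re (\<eta> x)) \<in> L2 M" "(\<lambda>x. Im (\<eta> x)) \<in> L2 M"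
    using Re_L2_0[OF koopman_power_L2_0[OF \<xi>]] Im_L2_0[OF koopman_power_L2_0[OF \<xi>]] Re_L2_0[OF \<eta>] Im_L2_0[OF \<eta>]
    by (auto simp: L2_0_def)
  note int = integrable_mult_L2(1)[OF L(1) L(3)] integrable_mult_L2(1)[OF L(1) L(4)]
    integrable_mult_L2(1)[OF L(2) L(3)] integrable_mult_L2(1)[OF L(2) L(4)]
  have "?u x * cnj (\<eta> x) = of_real (Re (?u x) * Re (\<eta> x) + Im (?u x) * Im (\<eta> x))
      + \<i> * of_real (Im (?u x) * Re (\<eta> x) - Re (?u x) * Im (\<eta> x))" for x
    by (simp add: complex_eq_iff)
  then have "correlation M T \<xi> \<eta> n = (\<integral>x. of_real (Re (?u x) * Re (\<eta> x) + Im (?u x) * Im (\<eta> x))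
      + \<i> * of_real (Im (?u x) * Re (\<eta> x) - Re (?u x) * Im (\<eta> x)) \<partial>M)"
    by (simp only: correlation_def)
  also have "\<dots> = of_real (\<integral>x. Re (?u x) * Re (\<eta> x) + Im (?u x) * Im (\<eta> x) \<partial>M)
      + \<i> * of_real (\<integral>x. Im (?u x) * Re (\<eta> x) - Re (?u x) * Im (\<eta> x) \<partial>M)"
    using int by (subst Bochner_Integration.integral_add)
      (auto intro!: integrable_mult_right integrable_of_real Bochner_Integration.integrable_add
        Bochner_Integration.integrable_diff simp: integral_of_real simp del: of_real_mult of_real_add of_real_diff)
  also have "\<dots> = of_real ((\<integral>x. Re (?u x) * Re (\<eta> x) \<partial>M) + (\<integral>x. Im (?u x) * Im (\<eta> x) \<partial>M))
      + \<i> * of_real ((\<integral>x. Im (?u x) * Re (\<eta> x) \<partial>M) - (\<integral>x. Re (?u x) * Im (\<eta> x) \<partial>M))"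
    using int by simp
  finally show ?thesis by (simp only: real_correlation_def koopman_power_comp)
qed

text \<open>A correlation of complex functions is a combination of four correlations of their real and
  imaginary parts.\<close>

lemma weakly_mixing_iff:
  "weakly_mixing M T \<longleftrightarrow> (\<forall>f\<in>L2_0 M. \<forall>g\<in>L2_0 M. mean_null (real_correlation M T f g))"
proof
  assume wm: "weakly_mixing M T"
  show "\<forall>f\<in>L2_0 M. \<forall>g\<in>L2_0 M. mean_null (real_correlation M T f g)"
  proof (intro ballI)
    fix f g :: "'a \<Rightarrow> real" assume f: "f \<in> L2_0 M" and g: "g \<in> L2_0 M"
    have "(\<lambda>n. (\<Sum>k=1..n. norm (real_correlation M T f g k)) / real n) \<longlonglongrightarrow> 0"
      using wm of_real_L2_0[OF f] of_real_L2_0[OF g]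
      unfolding weakly_mixing_def by (fastforce simp: correlation_of_real)
    then show "mean_null (real_correlation M T f g)"
      by (subst mean_null_from_one[of _ "(\<integral>x. (f x)\<^sup>2 \<partial>M) + (\<integral>x. (g x)\<^sup>2 \<partial>M)"])
        (simp_all add: real_correlation_bound f g)
  qed
next
  assume null: "\<forall>f\<in>L2_0 M. \<forall>g\<in>L2_0 M. mean_null (real_correlation M T f g)"
  show "weakly_mixing M T"
    unfolding weakly_mixing_def
  proof (intro ballI)
    fix \<xi> \<eta> :: "'a \<Rightarrow> complex" assume \<xi>: "\<xi> \<in> L2_0 M" and \<eta>: "\<eta> \<in> L2_0 M"
    let ?c = "\<lambda>p q. real_correlation M T (\<lambda>x. p (\<xi> x)) (\<lambda>x. q (\<eta> x))"
    let ?s = "\<lambda>k. \<bar>?c Re Re k\<bar> + \<bar>?c Im Im k\<bar> + \<bar>?c Im Re k\<bar> + \<bar>?c Re Im k\<bar>"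
    note L = Re_L2_0[OF \<xi>] Im_L2_0[OF \<xi>] Re_L2_0[OF \<eta>] Im_L2_0[OF \<eta>]
    have le: "cmod (correlation M T \<xi> \<eta> k) \<le> ?s k" for k
      using cmod_le[of "correlation M T \<xi> \<eta> k"] unfolding correlation_real_parts[OF \<xi> \<eta>] by simp
    have abs_null: "mean_null (\<lambda>k. \<bar>a k\<bar>)" if "mean_null a" for a :: "nat \<Rightarrow> real"
      using that by (simp add: mean_null_def)
    have "mean_null ?s" by (intro mean_null_add abs_null bspec[OF bspec[OF null]] L)
    then have "mean_null (correlation M T \<xi> \<eta>)" by (rule mean_null_dominated) (use le in force)
    moreover have "norm (correlation M T \<xi> \<eta> k) \<le> 
        ((\<integral>x. (Re (\<xi> x))\<^sup>2 \<partial>M) + (\<integral>x. (Re (\<eta> x))\<^sup>2 \<partial>M)) + ((\<integral>x. (Im (\<xi> x))\<^sup>2 \<partial>M) + (\<integral>x. (Im (\<eta> x))\<^sup>2 \<partial>M))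
        + ((\<integral>x. (Im (\<xi> x))\<^sup>2 \<partial>M) + (\<integral>x. (Re (\<eta> x))\<^sup>2 \<partial>M)) + ((\<integral>x. (Re (\<xi> x))\<^sup>2 \<partial>M) + (\<integral>x. (Im (\<eta> x))\<^sup>2 \<partial>M))" for k
      by (rule order_trans[OF le]) (intro add_mono real_correlation_bound L)
    ultimately show "(\<lambda>n. (\<Sum>k=1..n. cmod (correlation M T \<xi> \<eta> k)) / real n) \<longlonglongrightarrow> 0"
      using mean_null_from_one by blast
  qed
qed

lemma mixing_iff: "mixing M T \<longleftrightarrow> (\<forall>f\<in>L2_0 M. \<forall>g\<in>L2_0 M. real_correlation M T f g \<longlonglongrightarrow> 0)"
proof
  assume mix: "mixing M T"
  show "\<forall>f\<in>L2_0 M. \<forall>g\<in>L2_0 M. real_correlation M T f g \<longlonglongrightarrow> 0"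
  proof (intro ballI)
    fix f g :: "'a \<Rightarrow> real" assume f: "f \<in> L2_0 M" and g: "g \<in> L2_0 M"
    have "correlation M T (\<lambda>x. complex_of_real (f x)) (\<lambda>x. complex_of_real (g x)) \<longlonglongrightarrow> 0"
      using mix of_real_L2_0[OF f] of_real_L2_0[OF g] unfolding mixing_def by blast
    from tendsto_Re[OF this] show "real_correlation M T f g \<longlonglongrightarrow> 0" by (simp add: correlation_of_real)
  qed
next
  assume null: "\<forall>f\<in>L2_0 M. \<forall>g\<in>L2_0 M. real_correlation M T f g \<longlonglongrightarrow> 0"
  show "mixing M T"
    unfolding mixing_def
  proof (intro ballI)
    fix \<xi> \<eta> :: "'a \<Rightarrow> complex" assume \<xi>: "\<xi> \<in> L2_0 M" and \<eta>: "\<eta> \<in> L2_0 M"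
    let ?c = "\<lambda>p q k. real_correlation M T (\<lambda>x. p (\<xi> x)) (\<lambda>x. q (\<eta> x)) k"
    note L = Re_L2_0[OF \<xi>] Im_L2_0[OF \<xi>] Re_L2_0[OF \<eta>] Im_L2_0[OF \<eta>]
    have "(\<lambda>k. of_real (?c Re Re k + ?c Im Im k) + \<i> * of_real (?c Im Re k - ?c Re Im k)) \<longlonglongrightarrow> of_real (0 + 0) + \<i> * of_real (0 - 0)"
      by (intro tendsto_intros bspec[OF bspec[OF null]] L)
    then show "correlation M T \<xi> \<eta> \<longlonglongrightarrow> 0"
      by (simp add: correlation_real_parts[OF \<xi> \<eta>, abs_def])
  qed
qed

end

section \<open>The modular weight has dense range\<close>

text \<open>The range of a positive nonsingular operator is dense, since a vector orthogonal to it
  lies in the kernel of the adjoint; and the weight sends \<open>z + A z\<close> to \<open>2 A z\<close>.\<close>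

lemma modular_weight_dense_range:
  fixes D :: "'h::chilbert_space set"
  assumes "positive_nonsingular D A"
  shows "closure (range (modular_weight D A)) = UNIV"
proof -
  have sa: "x \<in> D \<and> A x = y \<longleftrightarrow> (\<forall>z\<in>D. cinner (A z) x = cinner z y)" for x y
    using assms unfolding positive_nonsingular_def selfadjoint_operator_def by auto
  have pos: "\<And>x. x \<in> D \<Longrightarrow> cinner (A x) x \<in> \<real>\<^sub>\<ge>\<^sub>0"
    and inj: "\<And>x. x \<in> D \<Longrightarrow> A x = 0 \<Longrightarrow> x = 0"
    using assms unfolding positive_nonsingular_def selfadjoint_operator_def by auto
  have sym: "cinner (A z) x = cinner z (A x)" if "x \<in> D" "z \<in> D" for x z
    using sa[of x "A x"] that by blast
  have add: "x + y \<in> D \<and> A (x + y) = A x + A y" if "x \<in> D" "y \<in> D" for x y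
    unfolding sa using that by (simp add: cinner_add_right sym)
  have scale: "c *\<^sub>C x \<in> D \<and> A (c *\<^sub>C x) = c *\<^sub>C A x" if "x \<in> D" for c x
    unfolding sa using that by (simp add: cinner_scaleC_right sym)
  have zero: "0 \<in> D \<and> A 0 = 0"
    unfolding sa by (simp add: cinner.zero_right)
  have scaleR: "r *\<^sub>R x \<in> D \<and> A (r *\<^sub>R x) = r *\<^sub>R A x" if "x \<in> D" for r x
    using scale[OF that, of "of_real r"] by (simp add: scaleC_of_real)
  have injI: "inj_on (\<lambda>z. z + A z) D"
  proof (rule inj_onI)
    fix x y assume xy: "x \<in> D" "y \<in> D" "x + A x = y + A y"
    have d: "x + (-1) *\<^sub>R y \<in> D \<and> A (x + (-1) *\<^sub>R y) = A x + (-1) *\<^sub>R A y"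
      using add[of x "(-1) *\<^sub>R y"] scaleR[of y "-1"] xy by auto
    then have D: "x - y \<in> D" and "A (x - y) = A x - A y" by simp_all
    moreover have "A x - A y = - (x - y)" using xy(3) by (simp add: algebra_simps)
    ultimately have "A (x - y) = - (x - y)" by simp
    then have "- cinner (x - y) (x - y) \<in> \<real>\<^sub>\<ge>\<^sub>0" using pos[OF D] by (simp only: cinner.minus_left)
    then have "(norm (x - y))\<^sup>2 \<le> 0" by (simp add: cinner_self complex_nonneg_Reals_iff del: zero_less_power2)
    then show "x = y" by simp
  qed
  define R where "R = A ` D"
  have "subspace R"
    unfolding R_def
  proof (rule subspaceI)
    show "0 \<in> A ` D" using zero by (metis imageI)
    show "x + y \<in> A ` D" if "x \<in> A ` D" "y \<in> A ` D" for x y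
      using that add by (metis (no_types, lifting) imageE imageI)
    show "r *\<^sub>R x \<in> A ` D" if "x \<in> A ` D" for r x
      using that scaleR by (metis (no_types, lifting) imageE imageI)
  qed
  then have "closure R = UNIV"
  proof (rule dense_if_no_orthogonal_vector)
    fix x assume x: "\<And>s. s \<in> R \<Longrightarrow> inner x s = 0"
    \<comment> \<open>orthogonality for the real inner product passes to the complex one, since \<open>R\<close> contains \<open>\<i> A z\<close>\<close>
    have "cinner (A z) x = cinner z 0" if z: "z \<in> D" for z
    proof -
      have re: "Re (cinner (A z) x) = 0" using x[of "A z"] z by (simp add: R_def Re_cinner inner_commute)
      have "\<i> *\<^sub>C A z \<in> R" unfolding R_def using scale[OF z, of \<i>] by (metis imageI)
      then have "Re (cinner (\<i> *\<^sub>C A z) x) = 0" using x by (simp add: Re_cinner inner_commute[of _ x])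
      then show ?thesis using re by (simp add: cinner_scaleC_left complex_eq_iff cinner.zero_right)
    qed
    then have "x \<in> D \<and> A x = 0" unfolding sa by blast
    then show "x = 0" using inj by blast
  qed
  moreover have "R \<subseteq> range (modular_weight D A)"
  proof
    fix y assume "y \<in> R"
    then obtain z where z: "z \<in> D" "y = A z" by (auto simp: R_def)
    define x where "x = (1/2) *\<^sub>R z"
    have x: "x \<in> D" "A x = (1/2) *\<^sub>R y" using scaleR[OF z(1), of "1/2"] by (auto simp: x_def z(2))
    have "modular_weight D A (x + A x) = y"
      unfolding modular_weight_def the_inv_into_f_f[OF injI x(1)] by (simp add: x(2))
    then show "y \<in> range (modular_weight D A)" by (metis rangeI)
  qed
  ultimately show ?thesis using closure_mono by blast
qed

section \<open>The one-particle dynamics\<close>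

lemma norm_Cx: "norm (Cx x 0) = norm x"
  by (simp add: norm_complexified_def inner_complexified_def norm_eq_sqrt_inner)

text \<open>Tensoring with this vector embeds the classical system into the one-particle space.\<close>

lemma plane_sum_unit_vector:
  assumes "1 \<in> G"
  shows "\<exists>w\<in>plane_sum G. plane_sum_inner G w w = 1"
proof
  define w :: "real \<Rightarrow> real^2" where "w l = (if l = 1 then axis 1 1 else 0)" for l
  have "(\<lambda>l. (norm (w l))\<^sup>2) summable_on G"
    by (subst summable_on_cong_neutral[of "{1}" _ _ "\<lambda>l. (norm (w l))\<^sup>2"]) (use assms in \<open>auto simp: w_def\<close>)
  then show "w \<in> plane_sum G" using assms by (auto simp: plane_sum_def w_def)
  have "plane_sum_inner G w w = (\<Sum>\<^sub>\<infinity>l\<in>{1}. inner (w l) (w l))"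
    unfolding plane_sum_inner_def by (rule infsum_cong_neutral) (use assms in \<open>auto simp: w_def\<close>)
  also have "\<dots> = 1" by (simp add: w_def inner_axis_axis)
  finally show "plane_sum_inner G w w = 1" .
qed

locale one_particle_dynamics = classical_dynamics M T for M :: "'a measure" and T +
  fixes G :: "real set" and tensor :: "('a \<Rightarrow> real) \<Rightarrow> (real \<Rightarrow> real^2) \<Rightarrow> 'k::{real_inner, complete_space}"
  assumes one_particle: "is_one_particle_space M G tensor" and one_G: "1 \<in> G"
begin

definition u :: "'k \<Rightarrow> 'k" where "u = blinfun_apply (tensor_operator M G tensor (koopman M T) id)"

lemma bounded_linear_u: "bounded_linear u"
  unfolding u_def by (rule blinfun.bounded_linear_right)

lemma inner_tensor: "f \<in> L2_0 M \<Longrightarrow> g \<in> L2_0 M \<Longrightarrow> w \<in> plane_sum G \<Longrightarrow> w' \<in> plane_sum G \<Longrightarrow>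
    inner (tensor f w) (tensor g w') = (\<integral>x. f x * g x \<partial>M) * plane_sum_inner G w w'"
  using one_particle by (auto simp: is_one_particle_space_def is_hilbert_tensor_product_def)

lemma total_tensors: "closure (span {tensor f w |f w. f \<in> L2_0 M \<and> w \<in> plane_sum G}) = UNIV"
  using one_particle by (auto simp: is_one_particle_space_def is_hilbert_tensor_product_def)

lemma
  shows u_tensor: "f \<in> L2_0 M \<Longrightarrow> w \<in> plane_sum G \<Longrightarrow> u (tensor f w) = tensor (koopman M T f) w"
    and norm_u: "norm (u x) = norm x"
proof -
  \<comment> \<open>pairs outside the two Hilbert spaces are sent to zero\<close>
  define s where "s = (\<lambda>(f, w). if f \<in> L2_0 M \<and> w \<in> plane_sum G then tensor f w else 0)"
  define g where "g = (\<lambda>(f, w). if f \<in> L2_0 M \<and> w \<in> plane_sum G then tensor (koopman M T f) w else 0)"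
  have "{tensor f w |f w. f \<in> L2_0 M \<and> w \<in> plane_sum G} \<subseteq> range s"
    by (force simp: s_def image_iff)
  then have "closure (span (range s)) = UNIV"
    using total_tensors closure_mono[OF span_mono] by blast
  moreover have "inner (g i) (g k) = 1 * inner (s i) (s k)" for i k
    by (cases i; cases k) (auto simp: g_def s_def inner_tensor koopman_L2_0 koopman_inner)
  ultimately obtain X :: "'k \<Rightarrow>\<^sub>L 'k" where X: "\<And>i. X (s i) = g i" "\<And>x. norm (X x) = norm x"
    using bounded_extension_from_total_family[of s g 1] by auto
  have X': "X (tensor f w) = tensor (koopman M T f) w" if "f \<in> L2_0 M" "w \<in> plane_sum G" for f w
    using X(1)[of "(f, w)"] that by (simp add: s_def g_def)
  have "tensor_operator M G tensor (koopman M T) id = X"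
    unfolding tensor_operator_def
  proof (rule the_equality)
    show "\<forall>f\<in>L2_0 M. \<forall>w\<in>plane_sum G. X (tensor f w) = tensor (koopman M T f) (id w)" by (simp add: X')
    fix Y :: "'k \<Rightarrow>\<^sub>L 'k" assume "\<forall>f\<in>L2_0 M. \<forall>w\<in>plane_sum G. Y (tensor f w) = tensor (koopman M T f) (id w)"
    then show "Y = X" by (intro blinfun_eq_on_total_set[OF total_tensors]) (auto simp: X')
  qed
  then show "f \<in> L2_0 M \<Longrightarrow> w \<in> plane_sum G \<Longrightarrow> u (tensor f w) = tensor (koopman M T f) w" "norm (u x) = norm x"
    using X' X(2) by (auto simp: u_def)
qed

lemma u_power_tensor:
  "f \<in> L2_0 M \<Longrightarrow> w \<in> plane_sum G \<Longrightarrow> (u ^^ n) (tensor f w) = tensor ((koopman M T ^^ n) f) w"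
  by (induction n) (auto simp: u_tensor koopman_power_L2_0)

lemma norm_u_power: "norm ((u ^^ n) x) = norm x"
  by (induction n) (auto simp: norm_u)

lemma linear_u_power: "linear (u ^^ n)"
proof (induction n)
  case (Suc n)
  then show ?case
    using linear_compose[OF Suc bounded_linear.linear[OF bounded_linear_u]] by (simp add: o_def)
qed (simp add: linear_id[unfolded id_def] id_def)

lemma inner_u_power_tensor:
  assumes "f \<in> L2_0 M" "g \<in> L2_0 M" "w \<in> plane_sum G" "w' \<in> plane_sum G"
  shows "inner ((u ^^ n) (tensor f w)) (tensor g w') = real_correlation M T f g n * plane_sum_inner G w w'"
  using assms by (simp add: u_power_tensor inner_tensor koopman_power_L2_0 real_correlation_def)

text \<open>For elementary tensors the correlation is a multiple of a classical one; the general case follows by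
  linearity and approximation in each argument.\<close>

lemma one_particle_mean_null:
  assumes null: "\<And>f g. f \<in> L2_0 M \<Longrightarrow> g \<in> L2_0 M \<Longrightarrow> mean_null (\<lambda>k. real_correlation M T f g (r k))"
  shows "mean_null (\<lambda>k. inner ((u ^^ r k) x) y)"
proof -
  let ?X = "{tensor f w |f w. f \<in> L2_0 M \<and> w \<in> plane_sum G}"
  have bound: "norm (inner ((u ^^ n) x) y) \<le> norm x * norm y" for n x y
    using Cauchy_Schwarz_ineq2[of "(u ^^ n) x" y] by (simp add: norm_u_power)
  have tensors: "mean_null (\<lambda>k. inner ((u ^^ r k) x) y)" if "x \<in> ?X" "y \<in> ?X" for x y
  proof -
    obtain f w g w' where fg: "f \<in> L2_0 M" "w \<in> plane_sum G" "x = tensor f w"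
      "g \<in> L2_0 M" "w' \<in> plane_sum G" "y = tensor g w'" using \<open>x \<in> ?X\<close> \<open>y \<in> ?X\<close> by blast
    then show ?thesis
      by (intro mean_null_scale[OF null[OF fg(1,4)], of _ "\<bar>plane_sum_inner G w w'\<bar>"])
        (simp add: inner_u_power_tensor abs_mult mult.commute)
  qed
  have left: "mean_null (\<lambda>k. inner ((u ^^ r k) x) y)" if y: "y \<in> ?X" for x y
  proof (rule mean_null_linear_total[OF total_tensors, of "\<lambda>k x. inner ((u ^^ r k) x) y" "norm y"])
    show "linear (\<lambda>x. inner ((u ^^ r k) x) y)" for k
      using linear_compose[OF linear_u_power[of "r k"] bounded_linear.linear[OF bounded_linear_inner_left[of y]]]
      by (simp add: o_def)
  qed (use bound tensors y in \<open>auto simp: mult.commute\<close>)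
  show ?thesis
    by (rule mean_null_linear_total[OF total_tensors, of "\<lambda>k y. inner ((u ^^ r k) x) y" "norm x"])
      (auto intro: bounded_linear.linear[OF bounded_linear_inner_right] left bound[simplified] simp: bound[simplified])
qed

lemma weakly_mixing_if:
  assumes "\<And>x y. mean_null (\<lambda>n. inner ((u ^^ n) x) y)"
  shows "weakly_mixing M T"
  unfolding weakly_mixing_iff
proof (intro ballI)
  fix f g :: "'a \<Rightarrow> real" assume fg: "f \<in> L2_0 M" "g \<in> L2_0 M"
  obtain w where w: "w \<in> plane_sum G" "plane_sum_inner G w w = 1" using plane_sum_unit_vector[OF one_G] by blast
  show "mean_null (real_correlation M T f g)"
    using assms[of "tensor f w" "tensor g w"] by (simp add: inner_u_power_tensor fg w)
qed

lemma mixing_if: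
  assumes "\<And>x y. (\<lambda>n. inner ((u ^^ n) x) y) \<longlonglongrightarrow> 0"
  shows "mixing M T"
  unfolding mixing_iff
proof (intro ballI)
  fix f g :: "'a \<Rightarrow> real" assume fg: "f \<in> L2_0 M" "g \<in> L2_0 M"
  obtain w where w: "w \<in> plane_sum G" "plane_sum_inner G w w = 1" using plane_sum_unit_vector[OF one_G] by blast
  show "real_correlation M T f g \<longlonglongrightarrow> 0"
    using assms[of "tensor f w" "tensor g w"] by (simp add: inner_u_power_tensor fg w)
qed

end

locale completed_dynamics = one_particle_dynamics M T G tensor
  for M :: "'a measure" and T G and tensor :: "('a \<Rightarrow> real) \<Rightarrow> (real \<Rightarrow> real^2) \<Rightarrow> 'k::{real_inner, complete_space}" +
  fixes B :: "'k complexified \<Rightarrow> 'k complexified" and j :: "'k complexified \<Rightarrow> 'h::chilbert_space" and U :: "'h \<Rightarrow> 'h"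
  assumes completion: "is_completion (\<lambda>x y. cinner (B x) y) j"
    and B_dense: "closure (range B) = UNIV"
    and unitary: "unitary U"
    and U_j: "U (j x) = j (complexify u x)"
begin

lemma unitary_isometry: "cinner (U x) (U y) = cinner x y"
  using unitary by (simp add: unitary_def)

lemma unitary_norm_power: "norm ((U ^^ n) x) = norm x"
proof (induction n)
  case (Suc n)
  have "norm (U y) = norm y" for y using unitary_isometry[of y y] unfolding cinner_self of_real_eq_iff by simp
  then show ?case using Suc by simp
qed simp

lemma linear_U_power: "linear (U ^^ n)"
proof (induction n)
  case (Suc n)
  have "linear U"
    using unitary by (intro linearI) (auto simp: unitary_def simp flip: scaleC_of_real)
  then show ?case using linear_compose[OF Suc] by (simp add: o_def)
qed (simp add: linear_id[unfolded id_def] id_def)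

lemma U_power_j: "(U ^^ n) (j x) = j (complexify (u ^^ n) x)"
  by (induction n) (simp_all add: U_j complexify_def)

text \<open>The weight may be moved to the second argument since the inner product of the completion is
  hermitian.\<close>

lemma cinner_U_power_j: "cinner ((U ^^ n) (j x)) (j y) = cinner (complexify (u ^^ n) x) (B y)"
proof -
  have ip: "cinner (j x) (j y) = cinner (B x) y" for x y using completion by (simp add: is_completion_def)
  have "cinner (j x) (j y) = cinner x (B y)" for x y
    by (metis ip cinner_commute)
  then show ?thesis by (simp add: U_power_j)
qed

lemma u_power_zero: "(u ^^ n) 0 = 0"
  by (rule linear_0[OF linear_u_power])

lemma cinner_U_power_real: "cinner ((U ^^ n) (j (Cx x 0))) (j y) = cinner (Cx ((u ^^ n) x) 0) (B y)"
  by (simp add: cinner_U_power_j complexify_def u_power_zero)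

lemma total_j: "closure (span (range j)) = UNIV"
  using completion closure_mono[OF span_superset, of "range j"] by (auto simp: is_completion_def)

lemma completed_mean_null:
  assumes null: "\<And>x y. mean_null (\<lambda>k. inner ((u ^^ r k) x) y)"
  shows "mean_null (\<lambda>k. cinner ((U ^^ r k) h) h')"
proof -
  have bound: "norm (cinner ((U ^^ n) x) y) \<le> norm x * norm y" for n x y
    using norm_cinner_le[of "(U ^^ n) x" y] by (simp add: unitary_norm_power)
  have embedded: "mean_null (\<lambda>k. cinner ((U ^^ r k) x) y)" if xy: "x \<in> range j" "y \<in> range j" for x y
  proof -
    obtain v w where vw: "x = j v" "y = j w" using xy by blast
    obtain a b where v: "v = Cx a b" by (cases v)
    obtain c d where w: "B w = Cx c d" by (cases "B w")
    have scaled: "mean_null (\<lambda>k. of_real (inner ((u ^^ r k) x) y) * z)" for x y and z :: complex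
      by (rule mean_null_scale[OF null[of x y], of _ "cmod z"]) (simp add: norm_mult mult.commute)
    have "cinner ((U ^^ r k) x) y
        = of_real (inner ((u ^^ r k) a) c) * 1 + of_real (inner ((u ^^ r k) b) d) * 1
        + of_real (inner ((u ^^ r k) b) c) * \<i> + of_real (inner ((u ^^ r k) a) d) * (- \<i>)" for k
      unfolding vw cinner_U_power_j w v by (simp add: complexify_def cinner_complexified_def complex_eq_iff)
    then show ?thesis by (simp only:) (intro mean_null_add scaled)
  qed
  have left: "mean_null (\<lambda>k. cinner ((U ^^ r k) x) y)" if y: "y \<in> range j" for x y
  proof (rule mean_null_linear_total[OF total_j, of "\<lambda>k x. cinner ((U ^^ r k) x) y" "norm y"])
    show "linear (\<lambda>x. cinner ((U ^^ r k) x) y)" for k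
      using linear_compose[OF linear_U_power[of "r k"] bounded_linear.linear[OF cinner.bounded_linear_left[of y]]]
      by (simp add: o_def)
    show "norm (cinner ((U ^^ r k) x) y) \<le> norm y * norm x" for k x
      using bound[of "r k" x y] by (simp add: mult.commute)
    show "mean_null (\<lambda>k. cinner ((U ^^ r k) x) y)" if "x \<in> range j" for x
      using that y by (rule embedded)
  qed
  show ?thesis
    by (rule mean_null_linear_total[OF total_j, of "\<lambda>k y. cinner ((U ^^ r k) h) y" "norm h"])
      (rule bounded_linear.linear[OF cinner.bounded_linear_right], rule bound, rule left)
qed

text \<open>If \<open>B y\<close> is close to \<open>z\<close>, then the squares of \<open>(u\<^sup>k x, B y)\<close> and of \<open>(u\<^sup>k x, z)\<close> are close, uniformly in
  \<open>k\<close>; and the latter are nonnegative reals, so that their averages tending to zero is vanishing in mean.\<close>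

lemma mean_null_if_squares_average_to_zero:
  assumes sq: "\<And>y. (\<lambda>N. (1 / real N) *\<^sub>R (\<Sum>k<N. (cinner ((U ^^ k) (j (Cx x 0))) (j y))\<^sup>2)) \<longlonglongrightarrow> 0"
  shows "mean_null (\<lambda>k. inner ((u ^^ k) x) z)"
proof (rule mean_null_if_square)
  define a where "a k = inner ((u ^^ k) x) z" for k
  define C where "C = (norm x)\<^sup>2 * (2 * norm z + 1)"
  have C: "0 \<le> C" by (simp add: C_def)
  have a_eq: "of_real (a k) = cinner (Cx ((u ^^ k) x) 0) (Cx z 0)" for k
    by (simp add: a_def cinner_complexified_def complex_eq_iff)
  show "mean_null (\<lambda>k. (inner ((u ^^ k) x) z)\<^sup>2)"
    unfolding mean_null_def a_def[symmetric]
  proof (rule LIMSEQ_I)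
    fix e :: real assume e: "0 < e"
    \<comment> \<open>\<open>C \<delta>\<close> will bound the difference of the squares\<close>
    define \<delta> where "\<delta> = min 1 (e / (2 * (C + 1)))"
    have \<delta>: "0 < \<delta>" "\<delta> \<le> 1" "C * \<delta> \<le> e / 2"
    proof -
      show "0 < \<delta>" "\<delta> \<le> 1" using e C by (auto simp: \<delta>_def)
      have "C * \<delta> \<le> (C + 1) * (e / (2 * (C + 1)))"
        using C e by (intro mult_mono) (auto simp: \<delta>_def min_def)
      also have "\<dots> = e / 2" using C by (simp add: field_simps)
      finally show "C * \<delta> \<le> e / 2" .
    qed
    have "Cx z 0 \<in> closure (range B)" using B_dense by simp
    then obtain y where y: "dist (B y) (Cx z 0) < \<delta>" using \<delta>(1) unfolding closure_approachable by blast
    define c where "c k = cinner ((U ^^ k) (j (Cx x 0))) (j y)" for k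
    have diff: "norm (of_real ((a k)\<^sup>2) - (c k)\<^sup>2) \<le> C * \<delta>" for k
    proof -
      let ?v = "Cx ((u ^^ k) x) 0"
      have nv: "norm ?v = norm x" by (simp add: norm_Cx norm_u_power)
      have "of_real ((a k)\<^sup>2) - (c k)\<^sup>2 = (of_real (a k) - c k) * (of_real (a k) + c k)"
        by (simp add: power2_eq_square algebra_simps)
      also have "\<dots> = cinner ?v (Cx z 0 - B y) * cinner ?v (Cx z 0 + B y)"
        by (simp add: a_eq c_def cinner_U_power_real cinner.diff_right cinner_add_right)
      finally have "norm (of_real ((a k)\<^sup>2) - (c k)\<^sup>2) = cmod (cinner ?v (Cx z 0 - B y)) * cmod (cinner ?v (Cx z 0 + B y))"
        by (simp add: norm_mult)
      also have "\<dots> \<le> (norm x * \<delta>) * (norm x * (2 * norm z + 1))"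
      proof (intro mult_mono)
        show "cmod (cinner ?v (Cx z 0 - B y)) \<le> norm x * \<delta>"
          using y by (intro order_trans[OF norm_cinner_le] mult_mono) (auto simp: nv dist_norm norm_minus_commute)
        have "norm (Cx z 0 + B y) = norm (2 *\<^sub>R Cx z 0 + (B y - Cx z 0))" by (simp add: scaleR_2)
        also have "\<dots> \<le> norm (2 *\<^sub>R Cx z 0) + norm (B y - Cx z 0)" by (rule norm_triangle_ineq)
        also have "\<dots> \<le> 2 * norm z + 1" using y \<delta>(2) by (simp add: norm_Cx dist_norm)
        finally show "cmod (cinner ?v (Cx z 0 + B y)) \<le> norm x * (2 * norm z + 1)"
          by (intro order_trans[OF norm_cinner_le] mult_mono) (auto simp: nv)
      qed (use \<delta> in auto)
      also have "\<dots> = C * \<delta>" by (simp add: C_def power2_eq_square mult_ac)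
      finally show ?thesis .
    qed
    obtain N0 where N0: "\<And>N. N \<ge> N0 \<Longrightarrow> norm ((1 / real N) *\<^sub>R (\<Sum>k<N. (c k)\<^sup>2)) < e / 2"
      using LIMSEQ_D[OF sq[of y], of "e / 2"] e unfolding c_def by auto
    have "norm ((\<Sum>k<N. norm ((a k)\<^sup>2)) / real N - 0) < e" if N: "N \<ge> N0" for N
    proof -
      have "complex_of_real ((\<Sum>k<N. norm ((a k)\<^sup>2)) / real N)
          = (1 / real N) *\<^sub>R (\<Sum>k<N. (c k)\<^sup>2) + (1 / real N) *\<^sub>R (\<Sum>k<N. of_real ((a k)\<^sup>2) - (c k)\<^sup>2)"
        by (simp add: scaleR_conv_of_real sum_subtractf algebra_simps)
      then have "norm (complex_of_real ((\<Sum>k<N. norm ((a k)\<^sup>2)) / real N))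
          \<le> norm ((1 / real N) *\<^sub>R (\<Sum>k<N. (c k)\<^sup>2)) + norm ((1 / real N) *\<^sub>R (\<Sum>k<N. of_real ((a k)\<^sup>2) - (c k)\<^sup>2))"
        by (simp only: norm_triangle_ineq)
      moreover have "norm ((1 / real N) *\<^sub>R (\<Sum>k<N. of_real ((a k)\<^sup>2) - (c k)\<^sup>2)) \<le> e / 2"
      proof -
        have "norm (\<Sum>k<N. of_real ((a k)\<^sup>2) - (c k)\<^sup>2) \<le> real N * (C * \<delta>)"
          using sum_norm_bound[of "{..<N}" "\<lambda>k. of_real ((a k)\<^sup>2) - (c k)\<^sup>2" "C * \<delta>"] diff by simp
        then have "(1 / real N) * norm (\<Sum>k<N. of_real ((a k)\<^sup>2) - (c k)\<^sup>2) \<le> (1 / real N) * (real N * (C * \<delta>))"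
          by (rule mult_left_mono) simp
        also have "\<dots> \<le> C * \<delta>" using C \<delta> by (cases "N = 0") auto
        finally show ?thesis using \<delta>(3) by (simp only: norm_scaleR real_norm_def abs_divide abs_one abs_of_nat)
      qed
      ultimately have "norm (complex_of_real ((\<Sum>k<N. norm ((a k)\<^sup>2)) / real N)) < e"
        using N0[OF N] by linarith
      then show ?thesis by (simp only: norm_of_real real_norm_def diff_zero)
    qed
    then show "\<exists>no. \<forall>N\<ge>no. norm ((\<Sum>k<N. norm ((a k)\<^sup>2)) / real N - 0) < e" by blast
  qed
qed

lemma tendsto_if_embedded_tendsto:
  assumes lim: "\<And>y. (\<lambda>n. inner ((U ^^ n) (j (Cx x 0))) (j y)) \<longlonglongrightarrow> 0"
  shows "(\<lambda>n. inner ((u ^^ n) x) z) \<longlonglongrightarrow> 0"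
  unfolding tendsto_0_iff_mean_null_subseq
proof (intro allI impI)
  fix r :: "nat \<Rightarrow> nat" assume r: "strict_mono r"
  have eq: "inner ((U ^^ n) (j (Cx x 0))) (j y) = inner (Cx ((u ^^ n) x) 0) (B y)" for n y
    by (simp add: cinner_U_power_real flip: Re_cinner)
  have "mean_null (\<lambda>k. inner (Cx ((u ^^ r k) x) 0) (Cx z 0))"
  proof (rule mean_null_linear_total[of "range B" "\<lambda>k y. inner (Cx ((u ^^ r k) x) 0) y" "norm x"])
    show "closure (span (range B)) = UNIV" using B_dense closure_mono[OF span_superset, of "range B"] by auto
    show "linear (inner (Cx ((u ^^ r k) x) 0))" for k
      by (rule bounded_linear.linear[OF bounded_linear_inner_right])
    show "norm (inner (Cx ((u ^^ r k) x) 0) y) \<le> norm x * norm y" for k y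
      using Cauchy_Schwarz_ineq2[of "Cx ((u ^^ r k) x) 0" y] by (simp add: norm_Cx norm_u_power)
    show "mean_null (\<lambda>k. inner (Cx ((u ^^ r k) x) 0) y)" if y: "y \<in> range B" for y
    proof -
      obtain y' where "y = B y'" using y by blast
      then have "(\<lambda>n. inner (Cx ((u ^^ n) x) 0) y) \<longlonglongrightarrow> 0" using lim[of y'] by (simp add: eq)
      then show ?thesis unfolding tendsto_0_iff_mean_null_subseq using r by blast
    qed
  qed
  then show "mean_null (\<lambda>k. inner ((u ^^ r k) x) z)" by (simp add: inner_complexified_def)
qed

end

theorem theorem4p2:
  fixes M :: "'a measure" and T :: "'a \<Rightarrow> 'a" and G :: "real set"
    and tensor :: "('a \<Rightarrow> real) \<Rightarrow> (real \<Rightarrow> real^2) \<Rightarrow> 'k::{real_inner, complete_space}"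
    and D :: "'k complexified set" and A :: "'k complexified \<Rightarrow> 'k complexified"
    and j :: "'k complexified \<Rightarrow> 'h::chilbert_space" and U :: "'h \<Rightarrow> 'h"
    and word :: "'h list \<Rightarrow> 'f::chilbert_space"
    and \<alpha> :: "('f \<Rightarrow>\<^sub>L 'f) \<Rightarrow> ('f \<Rightarrow>\<^sub>L 'f)"
  assumes "classical_system M T" and "infinite_dimensional_L2 M" and "separable_L2 M"
    and "countable G" and "multiplicative_subgroup G"
    and K_R: "is_one_particle_space M G tensor"
    and A: "positive_nonsingular D A"
      "\<forall>t. is_imaginary_power D A t
         (complexify (blinfun_apply (tensor_operator M G tensor id (rotation_group t))))"
    and H: "is_completion (\<lambda>x y. cinner (modular_weight D A x) y) j"
    and U: "unitary U"
      "\<forall>x. U (j x) =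
         j (complexify (blinfun_apply (tensor_operator M G tensor (koopman M T) id)) x)"
    and Fock: "is_full_fock_space word"
    and \<alpha>: "automorphism (gauss_algebra j word) \<alpha>"
      "\<forall>f. \<alpha> (field_op word (j (Cx f 0))) = field_op word (U (j (Cx f 0)))"
  shows
    "(ergodic M T \<and> \<not> weakly_mixing M T \<longrightarrow>
        uniquely_ergodic_fixed_point (gauss_algebra j word) \<alpha> \<and>
        nontrivial_algebra (fixed_point_algebra (gauss_algebra j word) \<alpha>)) \<and>
     (weakly_mixing M T \<and> \<not> mixing M T \<longrightarrow>
        uniquely_weak_mixing (gauss_algebra j word) \<alpha> \<and>
        \<not> uniquely_mixing (gauss_algebra j word) \<alpha> \<and>
        is_unique_invariant_state (gauss_algebra j word) \<alpha> (vacuum_state word)) \<and>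
     (mixing M T \<longrightarrow>
        uniquely_mixing (gauss_algebra j word) \<alpha> \<and>
        is_unique_invariant_state (gauss_algebra j word) \<alpha> (vacuum_state word))"
proof -
  interpret prob_space M using \<open>classical_system M T\<close> by (simp add: classical_system_def)
  interpret classical: one_particle_dynamics M T G tensor
    by unfold_locales
      (use \<open>classical_system M T\<close> \<open>multiplicative_subgroup G\<close> K_R in \<open>simp_all add: multiplicative_subgroup_def\<close>)
  interpret completed: completed_dynamics M T G tensor "modular_weight D A" j U
    by unfold_locales (use H U modular_weight_dense_range[OF A(1)] in \<open>auto simp: classical.u_def\<close>)
  define S where "S = range (\<lambda>f. j (Cx f 0))"
  have gauss: "gauss_algebra j word = generated_cstar_algebra (field_op word ` S)"
    unfolding gauss_algebra_def S_def image_image by (simp add: full_SetCompr_eq)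
  interpret quantum: field_dynamics word U S \<alpha>
  proof unfold_locales
    show "U h \<in> S" if "h \<in> S" for h
      using that completed.U_j by (auto simp: S_def complexify_def linear_0[OF bounded_linear.linear[OF classical.bounded_linear_u]])
    show "\<alpha> (field_op word h) = field_op word (U h)" if "h \<in> S" for h using that \<alpha>(2) by (auto simp: S_def)
  qed (use Fock \<alpha>(1) gauss completed.unitary_isometry in auto)
  have fields: "gauss_algebra j word = quantum.fields" by (simp add: gauss quantum.fields_def)
  have S: "j (Cx x 0) \<in> S" for x by (simp add: S_def)
  have wm: "mean_null (\<lambda>n. cinner ((U ^^ n) h) h)" if "weakly_mixing M T" for h
    using that unfolding classical.weakly_mixing_iff
    by (intro completed.completed_mean_null classical.one_particle_mean_null) auto
  have mix: "(\<lambda>n. cinner ((U ^^ n) h) h) \<longlonglongrightarrow> 0" if "mixing M T" for h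
    using that unfolding classical.mixing_iff tendsto_0_iff_mean_null_subseq
    by (intro allI impI completed.completed_mean_null classical.one_particle_mean_null) auto
  have "nontrivial_algebra (fixed_point_algebra quantum.fields \<alpha>)" if "\<not> weakly_mixing M T"
  proof (rule ccontr)
    assume "\<not> nontrivial_algebra (fixed_point_algebra quantum.fields \<alpha>)"
    then have "mean_null (\<lambda>n. inner ((classical.u ^^ n) x) y)" for x y
      by (intro completed.mean_null_if_squares_average_to_zero
          quantum.trivial_fixed_points_imp_squares_average_to_zero S)
    then show False using classical.weakly_mixing_if that by blast
  qed
  moreover have "\<not> uniquely_mixing quantum.fields \<alpha>" if "\<not> mixing M T"
  proof
    assume "uniquely_mixing quantum.fields \<alpha>"
    then have "(\<lambda>n. inner ((classical.u ^^ n) x) y) \<longlonglongrightarrow> 0" for x y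
      by (intro completed.tendsto_if_embedded_tendsto quantum.uniquely_mixing_imp_tendsto S)
    then show False using classical.mixing_if that by blast
  qed
  moreover have "mean_null (\<lambda>n. cinner ((U ^^ n) h) h)" if "mixing M T" for h
    by (rule mean_null_if_tendsto_0[OF mix[OF that]])
  ultimately show ?thesis
    unfolding fields
    using quantum.uniquely_ergodic quantum.uniquely_weak_mixing_if quantum.unique_invariant_state_if
      quantum.uniquely_mixing_if wm mix by blast
qed

end
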